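(* Let $\mathcal F_A,\mathcal G_A,\mathcal F_B,\mathcal G_B$ be unital C*-algebras, and let $$\Phi_A:\mathcal F_A\otimes\mathcal G_A\to\mathcal F_A,\qquad \Phi_B:\mathcal F_B\otimes\mathcal G_B\to\mathcal F_B$$ be *-isomorphisms, inducing (with implicit re-ordering of the factors $\mathcal G_A$ and $\mathcal F_B$) $$\Phi:=\Phi_A\otimes\Phi_B:\ \mathcal F_A\otimes\mathcal F_B\otimes\mathcal G_A\otimes\mathcal G_B\to\mathcal F_A\otimes\mathcal F_B .$$ Let $f\in\mathcal S(\mathcal F_A\otimes\mathcal F_B)$ be a state such that $f\circ\Phi=f\otimes g$ for some entangled state $g\in\mathcal S(\mathcal G_A\otimes\mathcal G_B)$, i.e. $f(\Phi_A(a\otimes x)\otimes\Phi_B(b\otimes y))=f(a\otimes b)\,g(x\otimes y)$ for all $a\in\mathcal F_A$, $b\in\mathcal F_B$, $x\in\mathcal G_A$, $y\in\mathcal G_B$. Then $f$ locally contains infinitely many copies of $g$.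
   Context: $\mathcal S(\mathcal A)$ is the set of states of a C*-algebra $\mathcal A$. Tensor products between an Alice algebra (index $A$) and a Bob algebra (index $B$) are maximal C*-tensor products; tensor products between algebras on the same party's side are minimal (spatial) tensor products. A state on $\mathcal G_A\otimes\mathcal G_B$ is entangled if it is not separable. $\mathrm C^*(S)$ denotes the unital C*-algebra generated by a subset $S$. Infinite containment: for a state $g\in\mathcal S(\mathcal G)$ and a state $f\in\mathcal S(\mathcal F)$, $f$ contains infinitely many copies of $g$ if there is a family of sets $\{\Sigma^{(i)}\subset\mathcal F\}_{i\in\mathbb N}$ such that (1) for each $i$ there is a *-isomorphism $\pi^{(i)}:\mathcal G\to \mathrm C^*(\Sigma^{(i)})$ with $f(\pi^{(i)}(P))=g(P)$ for all $P\in\mathcal G$; (2) for all $i\neq j$, every element of $\Sigma^{(i)}$ commutes with every element of $\Sigma^{(j)}$; (3) for every finite $N\subset\mathbb N$ and all $a_i\in\mathcal G$ ($i\in N$), $f\big(\prod_{i\in N}\pi^{(i)}(a_i)\big)=\prod_{i\in N}g(a_i)$. Local infinite containment: for $f\in\mathcal S(\mathcal F_A\otimes\mathcal F_B)$ and $g\in\mathcal S(\mathcal G_A\otimes\mathcal G_B)$, $f$ locally contains infinitely many copies of $g$ if $f$ contains infinitely many copies of $g$ (with $\mathcal G=\mathcal G_A\otimes\mathcal G_B$, $\mathcal F=\mathcal F_A\otimes\mathcal F_B$) in such a way that each *-isomorphism $\pi^{(n)}:\mathcal G_A\otimes\mathcal G_B\to \mathrm C^*(\Sigma^{(n)})$ factors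 as $\pi^{(n)}=\pi^{(n)}_A\otimes\pi^{(n)}_B$, where $\pi^{(n)}_A:\mathcal G_A\to \mathrm C^*(\Sigma^{(n)}_A)$ and $\pi^{(n)}_B:\mathcal G_B\to \mathrm C^*(\Sigma^{(n)}_B)$ are *-isomorphisms for some $\Sigma^{(n)}_A\subset\mathcal F_A$, $\Sigma^{(n)}_B\subset\mathcal F_B$. *)

theory Defs
  imports "HOL-Analysis.Analysis"
begin

section \<open>Unital C*-algebras\<close>

text \<open>The zero algebra is excluded, since \<open>real_normed_algebra_1\<close> has \<open>norm 1 = 1\<close>;
  it has no states.\<close>

class cstar_algebra = real_normed_algebra_1 + banach +
  fixes scaleC :: "complex \<Rightarrow> 'a \<Rightarrow> 'a"  (infixr \<open>*\<^sub>C\<close> 75)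
    and star :: "'a \<Rightarrow> 'a"
  assumes scaleC_of_real: "complex_of_real r *\<^sub>C x = r *\<^sub>R x"
    and scaleC_add_right: "c *\<^sub>C (x + y) = c *\<^sub>C x + c *\<^sub>C y"
    and scaleC_add_left: "(c + d) *\<^sub>C x = c *\<^sub>C x + d *\<^sub>C x"
    and scaleC_scaleC: "c *\<^sub>C d *\<^sub>C x = (c * d) *\<^sub>C x"
    and mult_scaleC_left: "(c *\<^sub>C x) * y = c *\<^sub>C (x * y)"
    and mult_scaleC_right: "x * (c *\<^sub>C y) = c *\<^sub>C (x * y)"
    and norm_scaleC: "norm (c *\<^sub>C x) = cmod c * norm x"
    and star_add: "star (x + y) = star x + star y"
    and star_scaleC: "star (c *\<^sub>C x) = cnj c *\<^sub>C star x"
    and star_mult: "star (x * y) = star y * star x"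
    and star_star: "star (star x) = x"
    and cstar_identity: "norm (star x * x) = (norm x)\<^sup>2"

instantiation complex :: cstar_algebra
begin

definition scaleC_complex :: "complex \<Rightarrow> complex \<Rightarrow> complex"
  where "scaleC_complex = (*)"

definition star_complex :: "complex \<Rightarrow> complex"
  where "star_complex = cnj"

instance
  by standard
    (simp_all add: scaleC_complex_def star_complex_def algebra_simps norm_mult
      power2_eq_square scaleR_conv_of_real)

end

interpretation complex_vector: vector_space "scaleC :: complex \<Rightarrow> 'a \<Rightarrow> 'a::cstar_algebra"
proof
  show "1 *\<^sub>C x = x" for x :: 'a
    using scaleC_of_real[of 1 x] by simp
qed (simp_all add: scaleC_add_right scaleC_add_left scaleC_scaleC)

abbreviation clinear :: "('a::cstar_algebra \<Rightarrow> 'b::cstar_algebra) \<Rightarrow> bool"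
  where "clinear \<equiv> Vector_Spaces.linear scaleC scaleC"

abbreviation cspan :: "'a::cstar_algebra set \<Rightarrow> 'a set"
  where "cspan \<equiv> module.span scaleC"

abbreviation csubspace :: "'a::cstar_algebra set \<Rightarrow> bool"
  where "csubspace \<equiv> module.subspace scaleC"

abbreviation cindependent :: "'a::cstar_algebra set \<Rightarrow> bool"
  where "cindependent S \<equiv> \<not> module.dependent scaleC S"

definition unital_cstar_subalgebra :: "'a::cstar_algebra set \<Rightarrow> bool"
  where "unital_cstar_subalgebra B \<longleftrightarrow>
    csubspace B \<and> 1 \<in> B \<and> (\<forall>x\<in>B. \<forall>y\<in>B. x * y \<in> B) \<and> (\<forall>x\<in>B. star x \<in> B) \<and> closed B"

definition cstar_generated :: "'a::cstar_algebra set \<Rightarrow> 'a set"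
  where "cstar_generated S = unital_cstar_subalgebra hull S"

definition star_hom :: "('a::cstar_algebra \<Rightarrow> 'b::cstar_algebra) \<Rightarrow> bool"
  where "star_hom \<pi> \<longleftrightarrow>
    clinear \<pi> \<and> (\<forall>x y. \<pi> (x * y) = \<pi> x * \<pi> y) \<and> (\<forall>x. \<pi> (star x) = star (\<pi> x))"

definition star_iso_onto :: "('a::cstar_algebra \<Rightarrow> 'b::cstar_algebra) \<Rightarrow> 'b set \<Rightarrow> bool"
  where "star_iso_onto \<pi> B \<longleftrightarrow> star_hom \<pi> \<and> bij_betw \<pi> UNIV B"

definition state :: "('a::cstar_algebra \<Rightarrow> complex) \<Rightarrow> bool"
  where "state f \<longleftrightarrow> clinear f \<and> (\<forall>x. f (star x * x) \<in> \<real>\<^sub>\<ge>\<^sub>0) \<and> f 1 = 1"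


section \<open>C*-tensor products\<close>

text \<open>Tensor products are described up to isomorphism: a C*-tensor product of \<open>'a\<close> and \<open>'b\<close>
  is a C*-algebra \<open>'c\<close> with a map \<open>(a, b) \<mapsto> a \<otimes> b\<close> that exhibits \<open>'c\<close> as a completion of
  the algebraic tensor product. The axiom \<open>tens_inj\<close> says that the canonical map from the
  algebraic tensor product to \<open>'c\<close> is injective.\<close>

locale cstar_tensor =
  fixes tens :: "'a::cstar_algebra \<Rightarrow> 'b::cstar_algebra \<Rightarrow> 'c::cstar_algebra"
  assumes tens_linear_left: "clinear (\<lambda>a. tens a b)"
    and tens_linear_right: "clinear (\<lambda>b. tens a b)"
    and tens_one: "tens 1 1 = 1"
    and tens_mult: "tens a b * tens a' b' = tens (a * a') (b * b')"
    and tens_star: "star (tens a b) = tens (star a) (star b)"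
    and tens_inj: "\<lbrakk>finite S; cindependent S; (\<Sum>a\<in>S. tens a (\<beta> a)) = 0; a \<in> S\<rbrakk> \<Longrightarrow> \<beta> a = 0"
    and tens_dense: "closure (cspan {tens a b |a b. True}) = UNIV"

definition cstar_seminorm_on :: "'a::cstar_algebra set \<Rightarrow> ('a \<Rightarrow> real) \<Rightarrow> bool"
  where "cstar_seminorm_on D p \<longleftrightarrow>
    (\<forall>x\<in>D. 0 \<le> p x) \<and>
    (\<forall>x\<in>D. \<forall>y\<in>D. p (x + y) \<le> p x + p y) \<and>
    (\<forall>c. \<forall>x\<in>D. p (c *\<^sub>C x) = cmod c * p x) \<and>
    (\<forall>x\<in>D. \<forall>y\<in>D. p (x * y) \<le> p x * p y) \<and>
    (\<forall>x\<in>D. p (star x * x) = (p x)\<^sup>2)"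

text \<open>The maximal norm is the supremum of all C*-seminorms on the algebraic tensor product.
  The norm of \<open>'c\<close> is one of them, so it suffices to say that it is an upper bound.\<close>

locale max_tensor = cstar_tensor +
  assumes norm_max: "\<lbrakk>cstar_seminorm_on (cspan {tens a b |a b. True}) p;
      x \<in> cspan {tens a b |a b. True}\<rbrakk> \<Longrightarrow> p x \<le> norm x"

text \<open>Hilbert spaces are realised as spaces of functions \<open>'i \<Rightarrow> complex\<close> with pointwise vector
  space operations and an arbitrary inner product (linear in the second argument), so that
  one can quantify over them within a formula.\<close>

locale hilbert_space =
  fixes H :: "('i \<Rightarrow> complex) set"
    and ip :: "('i \<Rightarrow> complex) \<Rightarrow> ('i \<Rightarrow> complex) \<Rightarrow> complex"
  assumes zero_in: "(\<lambda>i. 0) \<in> H"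
    and add_in: "\<lbrakk>h \<in> H; k \<in> H\<rbrakk> \<Longrightarrow> (\<lambda>i. h i + k i) \<in> H"
    and scale_in: "h \<in> H \<Longrightarrow> (\<lambda>i. c * h i) \<in> H"
    and ip_add: "\<lbrakk>h \<in> H; k \<in> H; l \<in> H\<rbrakk> \<Longrightarrow> ip h (\<lambda>i. k i + l i) = ip h k + ip h l"
    and ip_scale: "\<lbrakk>h \<in> H; k \<in> H\<rbrakk> \<Longrightarrow> ip h (\<lambda>i. c * k i) = c * ip h k"
    and ip_cnj: "\<lbrakk>h \<in> H; k \<in> H\<rbrakk> \<Longrightarrow> ip k h = cnj (ip h k)"
    and ip_nonneg: "h \<in> H \<Longrightarrow> ip h h \<in> \<real>\<^sub>\<ge>\<^sub>0"
    and ip_definite: "\<lbrakk>h \<in> H; ip h h = 0\<rbrakk> \<Longrightarrow> h = (\<lambda>i. 0)"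
    and complete: "\<lbrakk>\<And>n. X n \<in> H;
        \<And>e. e > 0 \<Longrightarrow> \<exists>N. \<forall>m\<ge>N. \<forall>n\<ge>N.
          Re (ip (\<lambda>i. X m i - X n i) (\<lambda>i. X m i - X n i)) < e\<rbrakk> \<Longrightarrow>
      \<exists>h\<in>H. (\<lambda>n. ip (\<lambda>i. X n i - h i) (\<lambda>i. X n i - h i)) \<longlonglongrightarrow> 0"

locale representation = hilbert_space H ip
  for H :: "('i \<Rightarrow> complex) set" and ip +
  fixes \<pi> :: "'a::cstar_algebra \<Rightarrow> ('i \<Rightarrow> complex) \<Rightarrow> ('i \<Rightarrow> complex)"
  assumes rep_in: "h \<in> H \<Longrightarrow> \<pi> a h \<in> H"
    and rep_vec_add: "\<lbrakk>h \<in> H; k \<in> H\<rbrakk> \<Longrightarrow> \<pi> a (\<lambda>i. h i + k i) = (\<lambda>i. \<pi> a h i + \<pi> a k i)"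
    and rep_vec_scale: "h \<in> H \<Longrightarrow> \<pi> a (\<lambda>i. c * h i) = (\<lambda>i. c * \<pi> a h i)"
    and rep_bounded: "\<exists>C. \<forall>h\<in>H. Re (ip (\<pi> a h) (\<pi> a h)) \<le> C * Re (ip h h)"
    and rep_add: "h \<in> H \<Longrightarrow> \<pi> (a + b) h = (\<lambda>i. \<pi> a h i + \<pi> b h i)"
    and rep_scale: "h \<in> H \<Longrightarrow> \<pi> (c *\<^sub>C a) h = (\<lambda>i. c * \<pi> a h i)"
    and rep_mult: "h \<in> H \<Longrightarrow> \<pi> (a * b) h = \<pi> a (\<pi> b h)"
    and rep_one: "h \<in> H \<Longrightarrow> \<pi> 1 h = h"
    and rep_star: "\<lbrakk>h \<in> H; k \<in> H\<rbrakk> \<Longrightarrow> ip (\<pi> (star a) h) k = ip h (\<pi> a k)"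

text \<open>The squared norm of the vector \<open>\<Sum>i\<in>I. \<xi> i \<otimes> \<eta> i\<close> in the tensor product of two Hilbert
  spaces.\<close>

definition tensor_sqnorm :: "('h \<Rightarrow> 'h \<Rightarrow> complex) \<Rightarrow> ('k \<Rightarrow> 'k \<Rightarrow> complex) \<Rightarrow>
    'n set \<Rightarrow> ('n \<Rightarrow> 'h) \<Rightarrow> ('n \<Rightarrow> 'k) \<Rightarrow> real"
  where "tensor_sqnorm ipH ipK I \<xi> \<eta> =
    Re (\<Sum>i\<in>I. \<Sum>j\<in>I. ipH (\<xi> i) (\<xi> j) * ipK (\<eta> i) (\<eta> j))"

text \<open>\<open>spatially_bounded n a b C\<close> says that for all representations \<open>\<pi>\<close>, \<open>\<rho>\<close> of the two
  algebras the operator \<open>T = \<Sum>i<n. \<pi> (a i) \<otimes> \<rho> (b i)\<close> has norm at most \<open>C\<close>, tested on the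
  dense subspace of vectors \<open>v = \<Sum>k<m. \<xi> k \<otimes> \<eta> k\<close>, for which
  \<open>T v = \<Sum>i<n. \<Sum>k<m. \<pi> (a i) (\<xi> k) \<otimes> \<rho> (b i) (\<eta> k)\<close>.

  Representations on spaces of functions \<open>'a \<Rightarrow> complex\<close> suffice: a representation with cyclic
  vector \<open>\<xi>\<close> is realised there by sending a vector \<open>h\<close> to the function taking \<open>a\<close> to the inner
  product of \<open>\<pi> a \<xi>\<close> and \<open>h\<close>, and every representation is a direct sum of cyclic ones.\<close>

definition spatially_bounded ::
    "nat \<Rightarrow> (nat \<Rightarrow> 'a::cstar_algebra) \<Rightarrow> (nat \<Rightarrow> 'b::cstar_algebra) \<Rightarrow> real \<Rightarrow> bool"
  where "spatially_bounded n a b C \<longleftrightarrow>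
    (\<forall>(H :: ('a \<Rightarrow> complex) set) ipH \<pi> (K :: ('b \<Rightarrow> complex) set) ipK \<rho> m \<xi> \<eta>.
      representation H ipH \<pi> \<and> representation K ipK \<rho> \<and>
      (\<forall>k<m. \<xi> k \<in> H) \<and> (\<forall>k<m. \<eta> k \<in> K) \<longrightarrow>
      tensor_sqnorm ipH ipK ({..<n} \<times> {..<m})
        (\<lambda>(i, k). \<pi> (a i) (\<xi> k)) (\<lambda>(i, k). \<rho> (b i) (\<eta> k))
      \<le> C\<^sup>2 * tensor_sqnorm ipH ipK {..<m::nat} \<xi> \<eta>)"

text \<open>The minimal (spatial) norm of \<open>\<Sum>i<n. a i \<otimes> b i\<close> is the supremum of the norms of its
  images under tensor products of representations.\<close>

locale min_tensor = cstar_tensor +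
  assumes norm_min: "0 \<le> C \<Longrightarrow>
      norm (\<Sum>i<n. tens (a i) (b i)) \<le> C \<longleftrightarrow> spatially_bounded n a b C"


section \<open>Entanglement\<close>

definition product_state ::
    "('a::cstar_algebra \<Rightarrow> 'b::cstar_algebra \<Rightarrow> 'c::cstar_algebra) \<Rightarrow> ('c \<Rightarrow> complex) \<Rightarrow> bool"
  where "product_state tens \<omega> \<longleftrightarrow> state \<omega> \<and>
    (\<exists>\<phi> \<psi>. state \<phi> \<and> state \<psi> \<and> (\<forall>a b. \<omega> (tens a b) = \<phi> a * \<psi> b))"

text \<open>The topology of the function space is that of pointwise convergence, hence on states it
  is the weak-* topology: separable states form the weak-* closed convex hull of the product
  states.\<close>

definition separable ::
    "('a::cstar_algebra \<Rightarrow> 'b::cstar_algebra \<Rightarrow> 'c::cstar_algebra) \<Rightarrow> ('c \<Rightarrow> complex) \<Rightarrow> bool"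
  where "separable tens s \<longleftrightarrow> state s \<and>
    s \<in> closure {\<lambda>x. \<Sum>i<n. complex_of_real (w i) * \<omega> i x | (n::nat) w \<omega>.
      (\<forall>i<n. 0 \<le> w i \<and> product_state tens (\<omega> i)) \<and> (\<Sum>i<n. w i) = 1}"

definition entangled ::
    "('a::cstar_algebra \<Rightarrow> 'b::cstar_algebra \<Rightarrow> 'c::cstar_algebra) \<Rightarrow> ('c \<Rightarrow> complex) \<Rightarrow> bool"
  where "entangled tens s \<longleftrightarrow> state s \<and> \<not> separable tens s"


section \<open>Infinite containment\<close>

text \<open>The factors in the third condition commute pairwise by the second one; the product is
  written in increasing order of the indices.\<close>

definition infinite_copies ::
    "('f::cstar_algebra \<Rightarrow> complex) \<Rightarrow> ('g::cstar_algebra \<Rightarrow> complex) \<Rightarrow>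
      (nat \<Rightarrow> 'f set) \<Rightarrow> (nat \<Rightarrow> 'g \<Rightarrow> 'f) \<Rightarrow> bool"
  where "infinite_copies f g \<Sigma> \<pi> \<longleftrightarrow>
    (\<forall>i. star_iso_onto (\<pi> i) (cstar_generated (\<Sigma> i)) \<and> (\<forall>P. f (\<pi> i P) = g P)) \<and>
    (\<forall>i j. i \<noteq> j \<longrightarrow> (\<forall>x\<in>\<Sigma> i. \<forall>y\<in>\<Sigma> j. x * y = y * x)) \<and>
    (\<forall>N a. finite N \<longrightarrow>
      f (prod_list (map (\<lambda>i. \<pi> i (a i)) (sorted_list_of_set N))) = (\<Prod>i\<in>N. g (a i)))"

definition contains_infinitely_many_copies ::
    "('f::cstar_algebra \<Rightarrow> complex) \<Rightarrow> ('g::cstar_algebra \<Rightarrow> complex) \<Rightarrow> bool"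
  where "contains_infinitely_many_copies f g \<longleftrightarrow> (\<exists>\<Sigma> \<pi>. infinite_copies f g \<Sigma> \<pi>)"

text \<open>A *-homomorphism on \<open>G\<^sub>A \<otimes> G\<^sub>B\<close> equals \<open>\<pi>\<^sub>A \<otimes> \<pi>\<^sub>B\<close> iff it does so on elementary tensors.\<close>

definition locally_contains_infinitely_many_copies ::
    "('fa::cstar_algebra \<Rightarrow> 'fb::cstar_algebra \<Rightarrow> 'f::cstar_algebra) \<Rightarrow>
     ('ga::cstar_algebra \<Rightarrow> 'gb::cstar_algebra \<Rightarrow> 'g::cstar_algebra) \<Rightarrow>
     ('f \<Rightarrow> complex) \<Rightarrow> ('g \<Rightarrow> complex) \<Rightarrow> bool"
  where "locally_contains_infinitely_many_copies tensF tensG f g \<longleftrightarrow>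
    (\<exists>\<Sigma> \<pi>. infinite_copies f g \<Sigma> \<pi> \<and>
      (\<forall>n. \<exists>\<Sigma>A \<Sigma>B \<pi>A \<pi>B.
        star_iso_onto \<pi>A (cstar_generated \<Sigma>A) \<and>
        star_iso_onto \<pi>B (cstar_generated \<Sigma>B) \<and>
        (\<forall>x y. \<pi> n (tensG x y) = tensF (\<pi>A x) (\<pi>B y))))"

end

theory Submission
  imports Defs
begin

text \<open>Put \<open>\<iota> = \<Phi> (1 \<otimes> \<cdot>)\<close> and \<open>\<alpha> = \<Phi> (\<cdot> \<otimes> 1)\<close>. The \<open>n\<close>-th copy of \<open>g\<close> is \<open>\<alpha>\<^sup>n \<circ> \<iota>\<close>: the range of \<open>\<iota>\<close> commutes
  with that of \<open>\<alpha>\<close>, and \<open>f (\<alpha> Y \<cdot> \<iota> P) = f Y \<cdot> g P\<close> peels the copies off one after the other.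

  The difficulty is that \<open>\<iota>\<^sub>A \<otimes> \<iota>\<^sub>B\<close> must be injective with closed range although the maximal tensor
  product does not preserve injectivity in general. Here it does: a state \<open>\<psi>\<close> of \<open>G\<^sub>A \<otimes> G\<^sub>B\<close> composed with
  the slice maps \<open>\<phi>\<^sub>A \<otimes> id\<close> and \<open>\<phi>\<^sub>B \<otimes> id\<close> of the minimal tensor products is positive on the algebraic
  tensor product of \<open>F\<^sub>A\<close> and \<open>F\<^sub>B\<close> (Schur product theorem), hence bounded by the maximal norm, and it
  extends \<open>\<psi>\<close>. Letting \<open>\<psi>\<close> run through norming states shows that \<open>\<iota>\<^sub>A \<otimes> \<iota>\<^sub>B\<close> is isometric; the same
  argument applies to \<open>\<alpha>\<close>.\<close>

section \<open>Square roots and positive elements\<close>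

text \<open>The minimal norm is given through representations, whereas slice maps come from states.
  The GNS construction for two states, tested on the cyclic vectors, is the link between them. On
  the maximal side the obstacle is that the sliced functional is at first only a positive form on an
  algebraic tensor product, with no bound available. The operator norm of its own GNS space is a
  C*-seminorm there, and the maximal norm dominates every such seminorm; this is how positivity
  alone yields continuity. The order theory behind this (square roots, positivity of
  \<open>star x * x\<close>, norming states) is derived from the C*-identity by norm estimates,
  without spectra or functional calculus. The four-fold map \<open>\<Phi>\<close> is never formed as
  a whole: only \<open>\<iota>\<close> and \<open>\<alpha>\<close> are, and the hypothesis on
  \<open>f\<close> is used for products \<open>\<iota> P * \<alpha> Y\<close> of elementary tensors
  and then extended by density.\<close>

lemma star_zero [simp]: "star (0::'a::cstar_algebra) = 0"
  using star_add[of "0::'a" 0] by simp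

lemma star_one [simp]: "star (1::'a::cstar_algebra) = 1"
proof -
  have "star (star 1 * (1::'a)) = star 1 * star (star 1)" by (rule star_mult)
  then show ?thesis by (simp add: star_star)
qed

lemma star_minus [simp]: "star (- x) = - star (x::'a::cstar_algebra)"
  using star_add[of x "- x"] by (simp add: eq_neg_iff_add_eq_0 add.commute)

lemma star_diff: "star (x - y) = star x - star (y::'a::cstar_algebra)"
  using star_add[of x "- y"] by simp

lemma star_scaleR: "star (r *\<^sub>R x) = r *\<^sub>R star (x::'a::cstar_algebra)"
  by (simp add: scaleC_of_real[symmetric] star_scaleC)

lemma star_of_real [simp]: "star (of_real r :: 'a::cstar_algebra) = of_real r"
  by (simp add: of_real_def star_scaleR)

lemma star_sum: "star (sum f A) = (\<Sum>i\<in>A. star (f i :: 'a::cstar_algebra))"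
  by (induction A rule: infinite_finite_induct) (auto simp: star_add)

lemma norm_star [simp]: "norm (star x) = norm (x::'a::cstar_algebra)"
proof -
  have *: "norm y \<le> norm (star y)" for y :: 'a
  proof (cases "y = 0")
    case False
    have "norm y * norm y \<le> norm (star y) * norm y"
      using norm_mult_ineq[of "star y" y] by (simp add: cstar_identity power2_eq_square)
    with False show ?thesis by simp
  qed simp
  show ?thesis using *[of x] *[of "star x"] by (simp add: star_star)
qed

lemma star_bounded_linear: "bounded_linear (star :: 'a::cstar_algebra \<Rightarrow> 'a)"
  by (rule bounded_linear_intro[of _ 1]) (simp_all add: star_add star_scaleR)

lemma scaleC_bounded_linear: "bounded_linear (\<lambda>x::'a::cstar_algebra. c *\<^sub>C x)"
proof (rule bounded_linear_intro[of _ "cmod c"])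
  show "c *\<^sub>C (r *\<^sub>R x) = r *\<^sub>R (c *\<^sub>C x)" for r and x :: 'a
    by (simp add: scaleC_of_real[symmetric] scaleC_scaleC mult.commute)
qed (simp_all add: scaleC_add_right norm_scaleC)

lemma scaleC_scaleR: "c *\<^sub>C (r *\<^sub>R x) = r *\<^sub>R (c *\<^sub>C (x::'a::cstar_algebra))"
  by (rule linear_scale[OF bounded_linear.linear[OF scaleC_bounded_linear]])

lemmas tendsto_star = bounded_linear.tendsto[OF star_bounded_linear]
lemmas continuous_on_star = bounded_linear.continuous_on[OF star_bounded_linear]
lemmas continuous_on_scaleC = bounded_linear.continuous_on[OF scaleC_bounded_linear]

lemma norm_square_selfadjoint: "star s = s \<Longrightarrow> norm (s * s) = (norm (s::'a::cstar_algebra))\<^sup>2"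
  using cstar_identity[of s] by simp

text \<open>The iteration \<open>z \<mapsto> (u + z\<^sup>2) / 2\<close> has the fixed point \<open>1 - sqrt (1 - u)\<close>. It is dominated by
  the scalar iteration for \<open>u = 1\<close>, which increases to \<open>1\<close>.\<close>

primrec sqrt_iter :: "'a::real_normed_algebra_1 \<Rightarrow> nat \<Rightarrow> 'a" where
  "sqrt_iter u 0 = 0"
| "sqrt_iter u (Suc n) = (1/2) *\<^sub>R (u + sqrt_iter u n * sqrt_iter u n)"

text \<open>Each iterate is a polynomial in \<open>u\<close>. In the limit this is why square roots
  of commuting elements commute.\<close>

lemma sqrt_iter_commute: "x * u = u * x \<Longrightarrow> x * sqrt_iter u n = sqrt_iter u n * x"
  by (induction n) (simp_all add: algebra_simps, metis mult.assoc)

lemma sqrt_iter_bounds: "0 \<le> sqrt_iter (1::real) n" "sqrt_iter (1::real) n \<le> 1"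
proof -
  have "0 \<le> sqrt_iter (1::real) n \<and> sqrt_iter (1::real) n \<le> 1"
  proof (induction n)
    case (Suc n)
    then show ?case using mult_le_one[of "sqrt_iter (1::real) n" "sqrt_iter 1 n"] by simp
  qed simp
  then show "0 \<le> sqrt_iter (1::real) n" "sqrt_iter (1::real) n \<le> 1" by auto
qed

lemma norm_sqrt_iter:
  assumes "norm u \<le> 1"
  shows "norm (sqrt_iter u n) \<le> sqrt_iter 1 n"
proof (induction n)
  case (Suc n)
  have "norm (sqrt_iter u (Suc n)) \<le> (1/2) * (norm u + norm (sqrt_iter u n) * norm (sqrt_iter u n))"
    using norm_triangle_ineq[of u "sqrt_iter u n * sqrt_iter u n"]
      norm_mult_ineq[of "sqrt_iter u n" "sqrt_iter u n"] by simp
  also have "\<dots> \<le> (1/2) * (1 + sqrt_iter 1 n * sqrt_iter 1 n)"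
    using Suc assms sqrt_iter_bounds(1)[of n] by (intro mult_left_mono add_mono mult_mono) auto
  finally show ?case by simp
qed simp

text \<open>Commuting iterates satisfy \<open>a * a - b * b = (a - b) * (a + b)\<close>, so each
  increment is dominated by the scalar one. At \<open>norm u = 1\<close> the iteration need not be a
  strict contraction; summability comes from the telescoping scalar sequence instead.\<close>

lemma norm_sqrt_iter_diff:
  assumes "norm u \<le> 1"
  shows "norm (sqrt_iter u (Suc n) - sqrt_iter u n) \<le> sqrt_iter 1 (Suc n) - sqrt_iter 1 n"
proof (induction n)
  case 0
  then show ?case using assms by simp
next
  case (Suc n)
  define a b where "a = sqrt_iter u (Suc n)" and "b = sqrt_iter u n"
  define s t where "s = sqrt_iter (1::real) (Suc n)" and "t = sqrt_iter (1::real) n"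
  have comm: "a * b = b * a"
    unfolding a_def b_def by (intro sqrt_iter_commute[symmetric] sqrt_iter_commute) simp
  have "sqrt_iter u (Suc (Suc n)) - sqrt_iter u (Suc n) = (1/2) *\<^sub>R (a * a - b * b)"
    by (simp add: a_def b_def scaleR_diff_right[symmetric])
  also have "a * a - b * b = (a - b) * (a + b)"
    using comm by (simp add: algebra_simps)
  finally have "norm (sqrt_iter u (Suc (Suc n)) - sqrt_iter u (Suc n)) \<le> (1/2) * (norm (a - b) * norm (a + b))"
    using norm_mult_ineq[of "a - b" "a + b"] by simp
  also have "\<dots> \<le> (1/2) * ((s - t) * (s + t))"
  proof (intro mult_left_mono mult_mono)
    show "norm (a - b) \<le> s - t" using Suc by (simp add: a_def b_def s_def t_def)
    show "norm (a + b) \<le> s + t"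
      using norm_triangle_ineq[of a b] norm_sqrt_iter[OF assms, of "Suc n"] norm_sqrt_iter[OF assms, of n]
      unfolding a_def b_def s_def t_def by linarith
    show "0 \<le> s - t"
      using Suc norm_ge_zero[of "sqrt_iter u (Suc n) - sqrt_iter u n"] unfolding s_def t_def by linarith
    show "0 \<le> norm (a + b)" by simp
  qed simp_all
  also have "\<dots> = sqrt_iter 1 (Suc (Suc n)) - sqrt_iter 1 (Suc n)"
    by (simp add: s_def t_def algebra_simps)
  finally show ?case .
qed

lemma sqrt_iter_convergent:
  fixes u :: "'a::cstar_algebra"
  assumes "norm u \<le> 1"
  obtains z where "sqrt_iter u \<longlonglongrightarrow> z"
proof -
  have nn: "0 \<le> sqrt_iter (1::real) (Suc n) - sqrt_iter 1 n" for n
    using norm_sqrt_iter_diff[OF assms, of n] norm_ge_zero order_trans by blast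
  have "incseq (sqrt_iter (1::real))"
    using nn by (intro incseq_SucI) (simp del: sqrt_iter.simps)
  then obtain l where "sqrt_iter (1::real) \<longlonglongrightarrow> l"
    using incseq_convergent[of "sqrt_iter (1::real)" 1] sqrt_iter_bounds(2) by blast
  then have "summable (\<lambda>n. sqrt_iter (1::real) (Suc n) - sqrt_iter 1 n)"
    using telescope_summable by blast
  then have "summable (\<lambda>n. sqrt_iter u (Suc n) - sqrt_iter u n)"
    using norm_sqrt_iter_diff[OF assms] by (rule summable_comparison_test'[where N = 0])
  then have "convergent (\<lambda>n. \<Sum>k<n. sqrt_iter u (Suc k) - sqrt_iter u k)"
    by (simp only: summable_iff_convergent)
  then have "convergent (sqrt_iter u)"
    by (simp add: sum_lessThan_telescope del: sqrt_iter.simps(2))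
  then show thesis using that by (auto simp: convergent_def)
qed

text \<open>The root is \<open>1 - z\<close> for the limit \<open>z\<close> of the iteration. The
  bound on \<open>norm (1 - s)\<close> is recorded because it is the norm form of positivity: the
  root is itself positive.\<close>

lemma sqrt_one_minus:
  fixes u :: "'a::cstar_algebra"
  assumes "norm u \<le> 1" "star u = u"
  obtains s where "star s = s" "s * s = 1 - u" "norm (1 - s) \<le> 1"
    "\<And>x. x * u = u * x \<Longrightarrow> x * s = s * x"
proof -
  obtain z where z: "sqrt_iter u \<longlonglongrightarrow> z" using sqrt_iter_convergent[OF assms(1)] .
  have "(\<lambda>n. sqrt_iter u (Suc n)) \<longlonglongrightarrow> (1/2) *\<^sub>R (u + z * z)"
    by (simp, intro tendsto_intros z)
  moreover have "(\<lambda>n. sqrt_iter u (Suc n)) \<longlonglongrightarrow> z" using z by (rule LIMSEQ_Suc)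
  ultimately have "z = (1/2) *\<^sub>R (u + z * z)" using LIMSEQ_unique by blast
  then have "2 *\<^sub>R z = 2 *\<^sub>R ((1/2) *\<^sub>R (u + z * z))" by simp
  then have fp: "u = z + z - z * z" by (simp add: scaleR_2 algebra_simps)
  have "star (sqrt_iter u n) = sqrt_iter u n" for n
    by (induction n) (simp_all add: star_scaleR star_add star_mult assms(2))
  then have "star z = z" using tendsto_star[OF z] z LIMSEQ_unique by auto
  have "norm (sqrt_iter u n) \<le> 1" for n
    using norm_sqrt_iter[OF assms(1)] sqrt_iter_bounds(2) order_trans by blast
  then have nz: "norm z \<le> 1" using tendsto_norm[OF z] by (intro LIMSEQ_le_const2) auto
  show thesis
  proof
    show "norm (1 - (1 - z)) \<le> 1" using nz by simp
    show "star (1 - z) = 1 - z" using \<open>star z = z\<close> by (simp add: star_diff)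
    show "(1 - z) * (1 - z) = 1 - u" by (simp add: fp algebra_simps)
    fix x assume "x * u = u * x"
    then have "(\<lambda>n. x * sqrt_iter u n) = (\<lambda>n. sqrt_iter u n * x)" using sqrt_iter_commute by blast
    moreover have "(\<lambda>n. x * sqrt_iter u n) \<longlonglongrightarrow> x * z" "(\<lambda>n. sqrt_iter u n * x) \<longlonglongrightarrow> z * x"
      by (intro tendsto_intros z)+
    ultimately have "x * z = z * x" using LIMSEQ_unique by metis
    then show "x * (1 - z) = (1 - z) * x" by (simp add: algebra_simps)
  qed
qed

text \<open>Self-adjoint squares instead of spectra: a square root is available by definition,
  whereas closure under addition and positivity of \<open>star x * x\<close> become
  theorems.\<close>

definition pos_elem :: "'a::cstar_algebra \<Rightarrow> bool"
  where "pos_elem h \<longleftrightarrow> (\<exists>s. star s = s \<and> h = s * s)"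

lemma positive_selfadjoint: "pos_elem h \<Longrightarrow> star h = h"
  by (auto simp: pos_elem_def star_mult)

text \<open>Writing \<open>h\<close> as \<open>c\<close> times \<open>1 - u\<close> reduces this to
  \<open>sqrt_one_minus\<close>. The hypothesis places \<open>h\<close> in the ball of radius
  \<open>c\<close> around \<open>c\<close>, and the root inherits the same property with
  \<open>sqrt c\<close>.\<close>

lemma positive_sqrt_commute:
  fixes h :: "'a::cstar_algebra"
  assumes "star h = h" "norm (of_real c - h) \<le> c"
  obtains s where "star s = s" "s * s = h" "norm (of_real (sqrt c) - s) \<le> sqrt c"
    "\<And>x. x * h = h * x \<Longrightarrow> x * s = s * x"
proof (cases "c = 0")
  case True
  then have "h = 0" using assms by simp
  then show thesis using that[of 0] True by simp
next
  case False
  have c: "c > 0" using False assms(2) norm_ge_zero[of "of_real c - h"] by linarith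
  define u where "u = 1 - (1/c) *\<^sub>R h"
  have "u = (1/c) *\<^sub>R (of_real c - h)" using c by (simp add: u_def of_real_def scaleR_diff_right)
  then have "norm u = norm (of_real c - h) / c" using c by simp
  then have "norm u \<le> 1" using assms(2) c by simp
  moreover have "star u = u" by (simp add: u_def star_diff star_scaleR assms(1))
  ultimately obtain s where s: "star s = s" "s * s = 1 - u" "norm (1 - s) \<le> 1"
    "\<And>x. x * u = u * x \<Longrightarrow> x * s = s * x"
    using sqrt_one_minus by blast
  show thesis
  proof
    show "star (sqrt c *\<^sub>R s) = sqrt c *\<^sub>R s" by (simp add: star_scaleR s)
    show "(sqrt c *\<^sub>R s) * (sqrt c *\<^sub>R s) = h" using c s(2) by (simp add: u_def)
    have "of_real (sqrt c) - sqrt c *\<^sub>R s = sqrt c *\<^sub>R (1 - s)" by (simp add: scaleR_diff_right of_real_def)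
    then show "norm (of_real (sqrt c) - sqrt c *\<^sub>R s) \<le> sqrt c"
      using s(3) c by (simp add: mult_left_le)
    fix x assume "x * h = h * x"
    then have "x * u = u * x" by (simp add: u_def algebra_simps)
    then show "x * (sqrt c *\<^sub>R s) = (sqrt c *\<^sub>R s) * x" using s(4) by simp
  qed
qed

text \<open>The element s + i t is unitary, and \<open>s\<close> is the mean of it and its
  adjoint.\<close>

lemma norm_unitary_parts:
  fixes s t :: "'a::cstar_algebra"
  assumes "star s = s" "star t = t" "s * t = t * s" "s * s + t * t = 1"
  shows "norm s \<le> 1"
proof -
  define u where "u = s + \<i> *\<^sub>C t"
  have su: "star u = s - \<i> *\<^sub>C t"
    by (simp add: u_def star_add star_scaleC assms)
  have "star u * u = 1"
    using assms(3,4) by (simp add: su) (simp add: u_def algebra_simps mult_scaleC_left mult_scaleC_right scaleC_scaleC scaleC_add_right complex_vector.scale_right_diff_distrib)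
  then have "norm u = 1" using cstar_identity[of u] by (simp add: power2_eq_1_iff, use norm_ge_zero[of u] in linarith)
  moreover have "s = (1/2) *\<^sub>R (u + star u)"
    unfolding su by (simp add: u_def scaleR_2[symmetric])
  ultimately show ?thesis using norm_triangle_ineq[of u "star u"] by simp
qed

text \<open>With \<open>c\<close> a root of \<open>1 - s * s\<close>, the element c + i s is
  unitary, hence \<open>norm c \<le> 1\<close>. This replaces the spectral estimate for squares of
  contractions.\<close>

lemma norm_one_minus_square:
  fixes s :: "'a::cstar_algebra"
  assumes "star s = s" "norm s \<le> 1"
  shows "norm (1 - s * s) \<le> 1"
proof -
  have "norm (s * s) \<le> 1" using assms by (simp add: norm_square_selfadjoint power_le_one)
  moreover have "star (s * s) = s * s" using assms by (simp add: star_mult)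
  ultimately obtain c where c: "star c = c" "c * c = 1 - s * s" "\<And>x. x * (s * s) = (s * s) * x \<Longrightarrow> x * c = c * x"
    using sqrt_one_minus by blast
  have "norm c \<le> 1" using c assms by (intro norm_unitary_parts[of c s]) (auto simp: mult.assoc)
  then show ?thesis using c by (metis norm_square_selfadjoint norm_ge_zero power_le_one)
qed

lemma positive_square: "star s = s \<Longrightarrow> pos_elem (s * s)"
  by (auto simp: pos_elem_def)

text \<open>The norm condition is the useful side for sums: by the triangle inequality it makes the
  positive elements a convex cone. One direction scales the root to norm one and uses
  \<open>norm_one_minus_square\<close>, the other extracts a root.\<close>

lemma positive_iff:
  fixes h :: "'a::cstar_algebra"
  shows "pos_elem h \<longleftrightarrow> star h = h \<and> norm (of_real (norm h) - h) \<le> norm h"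
proof
  assume "pos_elem h"
  then obtain s where s: "star s = s" "h = s * s" by (auto simp: pos_elem_def)
  show "star h = h \<and> norm (of_real (norm h) - h) \<le> norm h"
  proof (cases "s = 0")
    case False
    define r where "r = (1 / norm s) *\<^sub>R s"
    have "norm (1 - r * r) \<le> 1"
      using False s by (intro norm_one_minus_square) (auto simp: r_def star_scaleR)
    moreover have "of_real (norm h) - h = (norm s * norm s) *\<^sub>R (1 - r * r)"
      using False s by (simp add: r_def norm_square_selfadjoint power2_eq_square of_real_def scaleR_diff_right)
    ultimately show ?thesis using s False
      by (simp add: star_mult norm_square_selfadjoint power2_eq_square mult_left_le)
  qed (use s in auto)
next
  assume "star h = h \<and> norm (of_real (norm h) - h) \<le> norm h"
  then show "pos_elem h" using positive_sqrt_commute[of h "norm h"] unfolding pos_elem_def by metis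
qed

lemma positiveI: "star h = h \<Longrightarrow> norm (of_real c - h) \<le> c \<Longrightarrow> pos_elem h"
  using positive_sqrt_commute[of h c] unfolding pos_elem_def by metis

lemma positive_sqrtE:
  assumes "pos_elem h"
  obtains s where "star s = s" "s * s = h" "\<And>x. x * h = h * x \<Longrightarrow> x * s = s * x" "pos_elem s"
  using assms positive_sqrt_commute[of h "norm h"] positiveI unfolding positive_iff by metis

lemma positive_add:
  assumes "pos_elem h" "pos_elem k" shows "pos_elem (h + k)"
proof (rule positiveI)
  show "star (h + k) = h + k" using assms by (simp add: star_add positive_selfadjoint)
  have "of_real (norm h + norm k) - (h + k) = (of_real (norm h) - h) + (of_real (norm k) - k)" by simp
  then show "norm (of_real (norm h + norm k) - (h + k)) \<le> norm h + norm k"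
    using assms norm_triangle_mono unfolding positive_iff by metis
qed

lemma positive_scaleR: "0 \<le> c \<Longrightarrow> pos_elem h \<Longrightarrow> pos_elem (c *\<^sub>R h)"
  unfolding pos_elem_def
  by (metis star_scaleR scaleR_scaleR mult_scaleR_left mult_scaleR_right real_sqrt_mult_self abs_of_nonneg)

lemma positive_of_real: "0 \<le> c \<Longrightarrow> pos_elem (of_real c)"
  using positive_scaleR[of c 1] positive_square[of 1] by (simp add: of_real_def)

text \<open>Roots of commuting elements can be chosen to commute, so the product is the square of
  \<open>s * t\<close>.\<close>

lemma positive_mult_commute:
  assumes "pos_elem h" "pos_elem k" "h * k = k * h" shows "pos_elem (h * k)"
proof -
  obtain s where s: "star s = s" "s * s = h" "\<And>x. x * h = h * x \<Longrightarrow> x * s = s * x"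
    using positive_sqrtE[OF assms(1)] by blast
  obtain t where t: "star t = t" "t * t = k" "\<And>x. x * k = k * x \<Longrightarrow> x * t = t * x"
    using positive_sqrtE[OF assms(2)] by blast
  have "k * s = s * k" using s(3) assms(3) by simp
  then have st: "s * t = t * s" using t(3) by metis
  have "h * k = (s * t) * (s * t)" using s(2) t(2) st by (metis mult.assoc)
  moreover have "star (s * t) = s * t" by (simp add: star_mult s t st)
  ultimately show ?thesis unfolding pos_elem_def by blast
qed

lemma positive_norm_minus: "star h = h \<Longrightarrow> pos_elem (of_real (norm h) - h)"
  by (rule positiveI[where c = "norm h"]) (simp_all add: star_diff)

lemma positive_norm_plus: "star h = h \<Longrightarrow> pos_elem (of_real (norm h) + h)"
  using positive_norm_minus[of "- h"] by simp

text \<open>In the scaled case \<open>c = 1\<close> the roots \<open>s\<close> of \<open>k\<close>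
  and \<open>t\<close> of \<open>1 - k\<close> commute and \<open>s * s + t * t = 1\<close>, so
  \<open>s\<close> is the real part of a unitary.\<close>

lemma norm_le_of_positive:
  fixes h :: "'a::cstar_algebra"
  assumes "pos_elem h" "pos_elem (of_real c - h)" "0 \<le> c"
  shows "norm h \<le> c"
proof -
  have main: "norm k \<le> 1" if k: "pos_elem k" "pos_elem (1 - k)" for k :: 'a
  proof -
    obtain s where s: "star s = s" "s * s = k" "\<And>x. x * k = k * x \<Longrightarrow> x * s = s * x"
      using positive_sqrtE[OF k(1)] by blast
    obtain t where t: "star t = t" "t * t = 1 - k" "\<And>x. x * (1 - k) = (1 - k) * x \<Longrightarrow> x * t = t * x"
      using positive_sqrtE[OF k(2)] by blast
    have "s * (1 - k) = (1 - k) * s" by (simp add: algebra_simps flip: s(2))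
    then have "norm s \<le> 1" using norm_unitary_parts[OF s(1) t(1) t(3)] by (simp add: s(2) t(2))
    then have "(norm s)\<^sup>2 \<le> 1" by (simp add: power_le_one)
    then show ?thesis using norm_square_selfadjoint[OF s(1)] s(2) by simp
  qed
  have scaled: "norm h \<le> d" if d: "d > 0" "pos_elem (of_real d - h)" for d
  proof -
    have "norm ((1/d) *\<^sub>R h) \<le> 1"
    proof (rule main)
      show "pos_elem ((1/d) *\<^sub>R h)" using d assms by (simp add: positive_scaleR)
      have "1 - (1/d) *\<^sub>R h = (1/d) *\<^sub>R (of_real d - h)" using d by (simp add: scaleR_diff_right of_real_def)
      then show "pos_elem (1 - (1/d) *\<^sub>R h)" using d by (simp add: positive_scaleR)
    qed
    then show ?thesis using d(1) by (simp add: pos_divide_le_eq)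
  qed
  show ?thesis
  \<comment> \<open>Scaling needs a positive bound, but \<open>c\<close> may be zero: use
    \<open>c + e\<close> and let \<open>e\<close> tend to zero.\<close>
  proof (rule field_le_epsilon)
    fix e :: real assume "e > 0"
    then have "pos_elem (of_real e + (of_real c - h))" using assms by (intro positive_add positive_of_real) auto
    then show "norm h \<le> c + e" using \<open>e > 0\<close> assms(3) by (intro scaled) (auto simp: algebra_simps)
  qed
qed

lemma positive_norm_mono:
  fixes h k :: "'a::cstar_algebra"
  assumes "pos_elem h" "pos_elem (k - h)"
  shows "norm h \<le> norm k"
proof (rule norm_le_of_positive)
  have "pos_elem k" using positive_add[OF assms] by simp
  then have "pos_elem ((of_real (norm k) - k) + (k - h))"
    using assms by (intro positive_add positive_norm_minus) (auto simp: positive_selfadjoint)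
  then show "pos_elem (of_real (norm k) - h)" by simp
qed (use assms in auto)

text \<open>If both \<open>y y\<^sup>*\<close> and \<open>- y\<^sup>* y\<close> are positive, then \<open>h = - y\<^sup>* y\<close> satisfies
  \<open>\<parallel>(1 + h)\<^sup>n h\<parallel> = \<parallel>y\<^sup>* (1 - y y\<^sup>*)\<^sup>n y\<parallel> \<le> 1\<close> for small \<open>y\<close>, while \<open>(1 + h)\<^sup>n h \<ge> n h\<^sup>2\<close>.\<close>

lemma star_mult_eq_zero:
  fixes y :: "'a::cstar_algebra"
  assumes "pos_elem (y * star y)" "pos_elem (- (star y * y))"
  shows "y = 0"
proof -
  have small: "y = 0" if y: "pos_elem (y * star y)" "pos_elem (- (star y * y))" "norm y \<le> 1" for y :: 'a
  proof -
    define h where "h = - (star y * y)"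
    define w where "w = 1 - y * star y"
    have ns: "norm (y * star y) = (norm y)\<^sup>2" using cstar_identity[of "star y"] by (simp add: star_star)
    have "pos_elem ((of_real (norm (y * star y)) - y * star y) + of_real (1 - norm (y * star y)))"
      using y ns by (intro positive_add positive_norm_minus positive_of_real) (auto simp: star_mult star_star power_le_one)
    then have w: "pos_elem w" by (simp add: w_def)
    have wn: "norm w \<le> 1"
      using w y by (intro norm_le_of_positive) (auto simp: w_def)
    have comm: "(1 + h) ^ n * star y = star y * w ^ n" for n
    proof (induction n)
      case (Suc n)
      have "(1 + h) ^ Suc n * star y = (1 + h) * (star y * w ^ n)" using Suc by (simp add: mult.assoc)
      also have "\<dots> = star y * (w * w ^ n)" by (simp add: h_def w_def algebra_simps)
      finally show ?case by simp
    qed simp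
    have hp: "pos_elem h" using y by (simp add: h_def)
    have bound: "norm ((1 + h) ^ n * h) \<le> 1" for n
    proof -
      have "(1 + h) ^ n * h = - (star y * w ^ n * y)"
        using comm[of n] by (simp add: h_def mult.assoc[symmetric])
      then have "norm ((1 + h) ^ n * h) \<le> norm (star y * w ^ n) * norm y"
        using norm_mult_ineq by (metis norm_minus_cancel)
      also have "\<dots> \<le> (norm y * norm w ^ n) * norm y"
        using norm_mult_ineq[of "star y" "w ^ n"] mult_left_mono[OF norm_power_ineq[of w n], of "norm y"]
        by (intro mult_right_mono) auto
      also have "\<dots> \<le> (1 * 1) * 1" using y(3) wn by (intro mult_mono) (auto simp: power_le_one)
      finally show ?thesis by simp
    qed
    have commh: "h * (1 + h) ^ n = (1 + h) ^ n * h" for n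
      using power_commuting_commutes[of "1 + h" h n] by (simp add: algebra_simps)
    have grow: "pos_elem ((1 + h) ^ n * h - real n *\<^sub>R (h * h)) \<and> pos_elem ((1 + h) ^ n * h)" for n
    proof (induction n)
      case 0
      then show ?case using hp by simp
    next
      case (Suc n)
      let ?k = "(1 + h) ^ n * h"
      have hk: "h * ?k = ?k * h" using commh[of n] by (metis mult.assoc)
      have p1: "pos_elem (h * ?k)" by (rule positive_mult_commute[OF hp _ hk]) (use Suc in blast)
      have step: "(1 + h) ^ Suc n * h = ?k + h * ?k" by (simp add: algebra_simps)
      have "pos_elem (h * (?k - h))"
      proof (rule positive_mult_commute[OF hp])
        show "pos_elem (?k - h)"
        proof -
          \<comment> \<open>That \<open>(1 + h) ^ m * h\<close> dominates \<open>h\<close> is what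
            adds another \<open>h * h\<close> in each step of the outer induction.\<close>
          have "pos_elem ((1 + h) ^ m * h) \<and> pos_elem ((1 + h) ^ m * h - h)" for m
          proof (induction m)
            case 0
            then show ?case using hp by (simp add: pos_elem_def exI[of _ 0])
          next
            case (Suc m)
            let ?l = "(1 + h) ^ m * h"
            have "h * ?l = ?l * h" using commh[of m] by (metis mult.assoc)
            then have "pos_elem (h * ?l)" using positive_mult_commute[OF hp] Suc by blast
            then have "pos_elem (?l + h * ?l)" "pos_elem ((?l - h) + h * ?l)"
              using Suc positive_add by blast+
            then show ?case by (simp add: algebra_simps)
          qed
          then show ?thesis by blast
        qed
        show "h * (?k - h) = (?k - h) * h" using hk by (simp add: algebra_simps)
      qed
      then have "pos_elem ((?k - real n *\<^sub>R (h * h)) + h * (?k - h))" using Suc positive_add by blast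
      moreover have "(?k - real n *\<^sub>R (h * h)) + h * (?k - h) = (1 + h) ^ Suc n * h - real (Suc n) *\<^sub>R (h * h)"
        unfolding step by (simp add: algebra_simps)
      moreover have "pos_elem ((1 + h) ^ Suc n * h)" unfolding step using Suc p1 positive_add by blast
      ultimately show ?case by simp
    qed
    have "real n * norm (h * h) \<le> 1" for n
    proof -
      have "pos_elem (real n *\<^sub>R (h * h))"
        using hp by (intro positive_scaleR positive_square positive_selfadjoint) auto
      then have "norm (real n *\<^sub>R (h * h)) \<le> norm ((1 + h) ^ n * h)"
        using grow[of n] by (intro positive_norm_mono) auto
      then show ?thesis using bound[of n] by simp
    qed
    then have "norm (h * h) = 0"
      by (metis norm_ge_zero order.not_eq_order_implies_strict reals_Archimedean3 not_less)
    then have "norm h = 0" using norm_square_selfadjoint[OF positive_selfadjoint[OF hp]] by simp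
    then show "y = 0" using cstar_identity[of y] by (simp add: h_def)
  qed
  show ?thesis
  proof (cases "y = 0")
    case False
    \<comment> \<open>Both hypotheses are invariant under real scaling, while the power estimate
      needs norm at most one.\<close>
    let ?y = "(1 / norm y) *\<^sub>R y"
    have "?y = 0"
    proof (rule small)
      show "pos_elem (?y * star ?y)"
        using positive_scaleR[OF _ assms(1), of "1 / norm y * (1 / norm y)"] by (simp add: star_scaleR)
      show "pos_elem (- (star ?y * ?y))"
        using positive_scaleR[OF _ assms(2), of "1 / norm y * (1 / norm y)"] by (simp add: star_scaleR)
    qed (use False in simp)
    then show ?thesis using False by simp
  qed
qed

section \<open>Self-adjoint parts and the positivity of \<open>star x * x\<close>\<close>

definition re_part :: "'a::cstar_algebra \<Rightarrow> 'a" where "re_part x = (1/2) *\<^sub>R (x + star x)"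
definition im_part :: "'a::cstar_algebra \<Rightarrow> 'a" where "im_part x = (- \<i> / 2) *\<^sub>C (x - star x)"

lemma re_part_selfadjoint: "star (re_part x) = re_part x"
  by (simp add: re_part_def star_scaleR star_add star_star add.commute)

lemma im_part_selfadjoint: "star (im_part x) = im_part x"
proof -
  have "star (im_part x) = (\<i> / 2) *\<^sub>C (- (x - star x))"
    by (simp add: im_part_def star_scaleC star_diff star_star)
  then show ?thesis by (simp add: im_part_def complex_vector.scale_right_diff_distrib)
qed

lemma re_im_part: "x = re_part x + \<i> *\<^sub>C im_part x"
proof -
  have "\<i> *\<^sub>C im_part x = (1/2) *\<^sub>R (x - star x)"
    by (simp add: im_part_def scaleC_scaleC flip: scaleC_of_real)
  then show ?thesis by (simp add: re_part_def scaleR_add_right[symmetric] flip: scaleR_2)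
qed

text \<open>With \<open>p\<close> the absolute value of \<open>h\<close>, \<open>k = p - h\<close>
  is twice the negative part of \<open>h\<close>. For \<open>y = x * k\<close> the product
  \<open>star y * y\<close> is minus the positive element \<open>p * (k * k)\<close>, and then
  \<open>y * star y\<close> is positive; so \<open>star_mult_eq_zero\<close> gives
  \<open>y = 0\<close>. This forces the cube of \<open>k\<close>, and hence \<open>k\<close>, to
  vanish.\<close>

lemma positive_star_mult: "pos_elem (star x * x)" for x :: "'a::cstar_algebra"
proof -
  define h where "h = star x * x"
  have h: "star h = h" by (simp add: h_def star_mult star_star)
  obtain p where p: "star p = p" "p * p = h * h" "\<And>z. z * (h * h) = (h * h) * z \<Longrightarrow> z * p = p * z" "pos_elem p"
    using positive_sqrtE[OF positive_square[OF h]] by blast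
  have hp: "h * p = p * h" using p(3) by (simp add: mult.assoc)
  define k where "k = p - h"
  have k: "star k = k" by (simp add: k_def star_diff p h)
  have pk: "p * k = k * p" using hp by (simp add: k_def algebra_simps)
  have hk: "h * k = - (p * k)" using hp p(2) by (simp add: k_def algebra_simps)
  define y where "y = x * k"
  have yy: "star y * y = - (p * (k * k))"
  proof -
    have "star y * y = k * (h * k)" by (simp add: y_def star_mult k h_def mult.assoc)
    also have "\<dots> = - (p * (k * k))" by (simp add: hk) (metis pk mult.assoc)
    finally show ?thesis .
  qed
  have neg: "pos_elem (- (star y * y))"
    unfolding yy minus_minus
    using p(4) positive_square[OF k] by (rule positive_mult_commute) (metis pk mult.assoc)
  \<comment> \<open>For y = a + i b the products \<open>y * star y\<close> and
    \<open>star y * y\<close> add up to twice the sum of the squares of a and b.\<close>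
  have "y * star y = 2 *\<^sub>R (re_part y * re_part y) + 2 *\<^sub>R (im_part y * im_part y) + - (star y * y)"
  proof -
    define a b where "a = re_part y" and "b = im_part y"
    have ab: "y = a + \<i> *\<^sub>C b" unfolding a_def b_def by (rule re_im_part)
    have "star (a + \<i> *\<^sub>C b) = a - \<i> *\<^sub>C b"
      by (simp add: a_def b_def star_add star_scaleC re_part_selfadjoint im_part_selfadjoint)
    then have ab': "star y = a - \<i> *\<^sub>C b" using ab by simp
    show ?thesis unfolding a_def[symmetric] b_def[symmetric]
      unfolding ab' unfolding ab
      by (simp add: algebra_simps mult_scaleC_left mult_scaleC_right scaleC_scaleC scaleR_2)
  qed
  moreover have "pos_elem \<dots>"
    using neg by (intro positive_add positive_scaleR positive_square re_part_selfadjoint im_part_selfadjoint) auto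
  ultimately have "y = 0" using star_mult_eq_zero[of y] neg by simp
  then have "p * (k * k) = 0" using yy by simp
  moreover have "k * k = 2 *\<^sub>R (p * k)" using hp p(2) by (simp add: k_def algebra_simps scaleR_2)
  ultimately have "k * k * k = 0" by (simp add: mult.assoc)
  then have "(k * k) * (k * k) = 0" by (metis mult.assoc mult_zero_left)
  then have "norm (k * k) = 0" using norm_square_selfadjoint[of "k * k"] k by (simp add: star_mult)
  then have "k = 0" using norm_square_selfadjoint[OF k] by simp
  then show ?thesis using p(4) by (simp add: k_def h_def)
qed

section \<open>States\<close>

definition sublinear :: "('a::real_vector \<Rightarrow> real) \<Rightarrow> bool"
  where "sublinear q \<longleftrightarrow> q 0 = 0 \<and> (\<forall>x y. q (x + y) \<le> q x + q y) \<and> (\<forall>t>0. \<forall>x. q (t *\<^sub>R x) \<le> t * q x)"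

lemma sublinear_scaleR:
  assumes "sublinear q" "t \<ge> 0" shows "q (t *\<^sub>R x) = t * q x"
proof (cases "t = 0")
  case False
  then have t: "t > 0" using assms by simp
  have "q ((1/t) *\<^sub>R (t *\<^sub>R x)) \<le> (1/t) * q (t *\<^sub>R x)"
    using assms(1) t unfolding sublinear_def by (meson zero_less_divide_1_iff)
  then have "t * q x \<le> q (t *\<^sub>R x)" using t by (simp add: field_simps)
  moreover have "q (t *\<^sub>R x) \<le> t * q x" using assms(1) t unfolding sublinear_def by blast
  ultimately show ?thesis by simp
qed (use assms in \<open>simp add: sublinear_def\<close>)

lemma sublinear_lower: "sublinear q \<Longrightarrow> - q (- x) \<le> q x"
proof -
  assume "sublinear q"
  then have "q (x + - x) \<le> q x + q (- x)" "q 0 = 0" unfolding sublinear_def by blast+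
  then show ?thesis by simp
qed

text \<open>The auxiliary functional of Hahn-Banach: it is sublinear, lies below \<open>q\<close>,
  and is at most \<open>- q y\<close> at \<open>- y\<close> (take t = 1). Every linear functional
  below it therefore attains \<open>q y\<close> at \<open>y\<close>.\<close>

definition sublinear_shift :: "('a::real_vector \<Rightarrow> real) \<Rightarrow> 'a \<Rightarrow> 'a \<Rightarrow> real"
  where "sublinear_shift q y x = (INF t\<in>{0..}. q (x + t *\<^sub>R y) - t * q y)"

lemma sublinear_shift_lower:
  assumes "sublinear q" "t \<ge> 0"
  shows "- q (- x) \<le> q (x + t *\<^sub>R y) - t * q y"
proof -
  have "q (t *\<^sub>R y) \<le> q (x + t *\<^sub>R y) + q (- x)"
  proof -
    have "q ((x + t *\<^sub>R y) + - x) \<le> q (x + t *\<^sub>R y) + q (- x)"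
      using assms(1) unfolding sublinear_def by blast
    then show ?thesis by simp
  qed
  then show ?thesis using sublinear_scaleR[OF assms, of y] by simp
qed

lemma sublinear_shift_le:
  assumes "sublinear q" "t \<ge> 0"
  shows "sublinear_shift q y x \<le> q (x + t *\<^sub>R y) - t * q y"
  unfolding sublinear_shift_def using assms sublinear_shift_lower[OF assms(1), of _ x y]
  by (intro cINF_lower bdd_belowI2[of _ "- q (- x)"]) auto

lemma sublinear_shift_greatest:
  assumes "\<And>t. t \<ge> 0 \<Longrightarrow> c \<le> q (x + t *\<^sub>R y) - t * q y"
  shows "c \<le> sublinear_shift q y x"
  unfolding sublinear_shift_def using assms by (intro cINF_greatest) auto

lemma sublinear_shift_sublinear:
  assumes q: "sublinear q" shows "sublinear (sublinear_shift q y)"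
  unfolding sublinear_def
proof (intro conjI allI impI)
  let ?s = "sublinear_shift q y"
  have "?s 0 \<le> 0" using sublinear_shift_le[OF q, of 0 y 0] q by (simp add: sublinear_def)
  moreover have "0 \<le> ?s 0"
    by (rule sublinear_shift_greatest) (simp add: sublinear_scaleR[OF q])
  ultimately show "?s 0 = 0" by simp
  show "?s (u + v) \<le> ?s u + ?s v" for u v
  proof -
    have "?s (u + v) - (q (u + t *\<^sub>R y) - t * q y) \<le> ?s v" if t: "t \<ge> 0" for t
    proof (rule sublinear_shift_greatest)
      fix r :: real assume r: "r \<ge> 0"
      have "?s (u + v) \<le> q (u + v + (t + r) *\<^sub>R y) - (t + r) * q y"
        using t r by (intro sublinear_shift_le q) auto
      also have "u + v + (t + r) *\<^sub>R y = (u + t *\<^sub>R y) + (v + r *\<^sub>R y)" by (simp add: algebra_simps)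
      also have "q \<dots> \<le> q (u + t *\<^sub>R y) + q (v + r *\<^sub>R y)" using q unfolding sublinear_def by blast
      finally show "?s (u + v) - (q (u + t *\<^sub>R y) - t * q y) \<le> q (v + r *\<^sub>R y) - r * q y"
        by (simp add: algebra_simps)
    qed
    then have "?s (u + v) - ?s v \<le> ?s u" by (intro sublinear_shift_greatest) (simp add: algebra_simps)
    then show ?thesis by simp
  qed
  show "?s (c *\<^sub>R u) \<le> c * ?s u" if c: "c > 0" for c u
  proof -
    have "(1/c) * ?s (c *\<^sub>R u) \<le> ?s u"
    proof (rule sublinear_shift_greatest)
      fix t :: real assume t: "t \<ge> 0"
      have "?s (c *\<^sub>R u) \<le> q (c *\<^sub>R u + (c * t) *\<^sub>R y) - (c * t) * q y"
        using t c by (intro sublinear_shift_le q) auto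
      also have "c *\<^sub>R u + (c * t) *\<^sub>R y = c *\<^sub>R (u + t *\<^sub>R y)" by (simp add: algebra_simps)
      also have "q \<dots> = c * q (u + t *\<^sub>R y)" using c by (intro sublinear_scaleR q) auto
      finally have "?s (c *\<^sub>R u) \<le> c * (q (u + t *\<^sub>R y) - t * q y)" by (simp add: algebra_simps)
      then show "(1/c) * ?s (c *\<^sub>R u) \<le> q (u + t *\<^sub>R y) - t * q y" using c by (simp add: field_simps)
    qed
    then show ?thesis using c by (simp add: field_simps)
  qed
qed

text \<open>Zorn's lemma needs a lower bound for each chain. The values at \<open>x\<close> are
  bounded below by \<open>- q (- x)\<close>, and subadditivity of the infimum uses the smaller one
  of any two members.\<close>

lemma sublinear_chain_INF:
  assumes C: "C \<noteq> {}" "\<And>s. s \<in> C \<Longrightarrow> sublinear s \<and> (\<forall>x. s x \<le> q x)"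
    and chain: "\<And>s s'. s \<in> C \<Longrightarrow> s' \<in> C \<Longrightarrow> s \<le> s' \<or> s' \<le> (s :: 'a::real_vector \<Rightarrow> real)"
  shows "sublinear (\<lambda>x. INF s\<in>C. s x)" "\<And>s x. s \<in> C \<Longrightarrow> (INF s\<in>C. s x) \<le> s x"
proof -
  have lower: "- q (- x) \<le> s x" if "s \<in> C" for s x
    using C(2)[OF that] sublinear_lower[of s x] by (meson neg_le_iff_le order_trans)
  show le: "(INF s\<in>C. s x) \<le> s x" if "s \<in> C" for s x
    using that lower by (intro cINF_lower bdd_belowI2[of _ "- q (- x)"]) auto
  show "sublinear (\<lambda>x. INF s\<in>C. s x)"
    unfolding sublinear_def
  proof (intro conjI allI impI)
    have "(\<lambda>s. s 0) ` C = {0}" using C unfolding sublinear_def by force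
    then show "(INF s\<in>C. s 0) = 0" by simp
    show "(INF s\<in>C. s (x + y)) \<le> (INF s\<in>C. s x) + (INF s\<in>C. s y)" for x y
    proof -
      have "(INF s\<in>C. s (x + y)) - s x \<le> s' y" if s: "s \<in> C" "s' \<in> C" for s s'
      proof -
        obtain r where r: "r \<in> C" "r \<le> s" "r \<le> s'" using chain[OF s] s by blast
        have "(INF s\<in>C. s (x + y)) \<le> r x + r y"
          using le[OF r(1), of "x + y"] C(2)[OF r(1)] unfolding sublinear_def by (meson order_trans)
        also have "\<dots> \<le> s x + s' y" using r by (intro add_mono) (auto simp: le_fun_def)
        finally show ?thesis by simp
      qed
      then have "(INF s\<in>C. s (x + y)) - s x \<le> (INF s\<in>C. s y)" if "s \<in> C" for s
        using that C(1) by (intro cINF_greatest) auto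
      then have "(INF s\<in>C. s (x + y)) - (INF s\<in>C. s y) \<le> (INF s\<in>C. s x)"
        using C(1) by (intro cINF_greatest) (auto simp: algebra_simps)
      then show ?thesis by simp
    qed
    show "(INF s\<in>C. s (t *\<^sub>R x)) \<le> t * (INF s\<in>C. s x)" if t: "t > 0" for t x
    proof -
      have "(1/t) * (INF s\<in>C. s (t *\<^sub>R x)) \<le> s x" if s: "s \<in> C" for s
        using le[OF s, of "t *\<^sub>R x"] C(2)[OF s] t sublinear_scaleR[of s t x] by (simp add: field_simps)
      then have "(1/t) * (INF s\<in>C. s (t *\<^sub>R x)) \<le> (INF s\<in>C. s x)" using C(1) by (intro cINF_greatest) auto
      then show ?thesis using t by (simp add: field_simps)
    qed
  qed
qed

text \<open>Hahn--Banach: by Zorn's lemma there is a minimal sublinear functional below \<open>sublinear_shift q y\<close>;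
  it equals all its own shifts and is therefore additive.\<close>

lemma sublinear_majorant_attained:
  assumes q: "sublinear q"
  obtains l where "linear l" "\<And>x. l x \<le> q x" "l y = q y"
proof -
  define q' where "q' = sublinear_shift q y"
  define A where "A = {s. sublinear s \<and> s \<le> q'}"
  \<comment> \<open>The order is reversed: a maximal element for \<open>P\<close> is a pointwise
    minimal functional.\<close>
  define P where "P = (\<lambda>s s' :: 'a \<Rightarrow> real. s' \<le> s)"
  have q': "sublinear q'" unfolding q'_def by (rule sublinear_shift_sublinear[OF q])
  have "\<exists>m\<in>A. \<forall>a\<in>A. P m a \<longrightarrow> a = m"
  proof (rule predicate_Zorn)
    show "partial_order_on A (relation_of P A)"
      by (rule partial_order_on_relation_ofI) (auto simp: P_def)
    fix C assume "C \<in> Chains (relation_of P A)"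
    then have CA: "C \<subseteq> A" and ch: "\<And>s s'. s \<in> C \<Longrightarrow> s' \<in> C \<Longrightarrow> s \<le> s' \<or> s' \<le> s"
      by (auto simp: Chains_def relation_of_def P_def)
    show "\<exists>u\<in>A. \<forall>a\<in>C. P a u"
    proof (cases "C = {}")
      case True
      then show ?thesis using q' by (auto simp: A_def)
    next
      case False
      have C: "\<And>s. s \<in> C \<Longrightarrow> sublinear s \<and> (\<forall>x. s x \<le> q' x)"
        using CA by (auto simp: A_def le_fun_def)
      let ?u = "\<lambda>x. INF s\<in>C. s x"
      have "?u x \<le> q' x" for x
        using False C sublinear_chain_INF(2)[OF False C ch] by (meson all_not_in_conv order_trans)
      then have "?u \<in> A" using sublinear_chain_INF(1)[OF False C ch] by (simp add: A_def le_fun_def)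
      moreover have "\<forall>s\<in>C. ?u \<le> s" using sublinear_chain_INF(2)[OF False C ch] by (simp add: le_fun_def)
      ultimately show ?thesis unfolding P_def by blast
    qed
  qed
  then obtain l where l: "sublinear l" "l \<le> q'" and min: "\<And>s. sublinear s \<Longrightarrow> s \<le> l \<Longrightarrow> s = l"
  proof -
    assume *: "\<And>l. sublinear l \<Longrightarrow> l \<le> q' \<Longrightarrow> (\<And>s. sublinear s \<Longrightarrow> s \<le> l \<Longrightarrow> s = l) \<Longrightarrow> thesis"
    obtain m where m: "m \<in> A" "\<And>a. a \<in> A \<Longrightarrow> P m a \<Longrightarrow> a = m"
      using \<open>\<exists>m\<in>A. \<forall>a\<in>A. P m a \<longrightarrow> a = m\<close> by blast
    show thesis
    proof (rule *[of m])
      show "sublinear m" "m \<le> q'" using m(1) by (auto simp: A_def)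
      fix s assume "sublinear s" "s \<le> m"
      then show "s = m" using m(1) by (intro m(2)) (auto simp: A_def P_def)
    qed
  qed
  have "l x + l z \<le> l (x + z)" for x z
  proof -
    have "sublinear_shift l z x \<le> l x" for x using sublinear_shift_le[OF l(1), of 0 z x] by simp
    then have "sublinear_shift l z = l"
      using sublinear_shift_sublinear[OF l(1)] by (intro min) (auto simp: le_fun_def)
    then show ?thesis using sublinear_shift_le[OF l(1), of 1 z x] by simp
  qed
  then have add: "l (x + z) = l x + l z" for x z using l(1) unfolding sublinear_def by (meson antisym)
  have neg: "l (- x) = - l x" for x using add[of x "- x"] l(1) by (simp add: sublinear_def)
  have "l (c *\<^sub>R x) = c * l x" for c x
  proof (cases "c \<ge> 0")
    case False
    then show ?thesis using sublinear_scaleR[OF l(1), of "- c" x] neg[of "c *\<^sub>R x"] by simp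
  qed (simp add: sublinear_scaleR[OF l(1)])
  with add have lin: "linear l" by (intro linearI) auto
  have q'q: "q' x \<le> q x" for x using sublinear_shift_le[OF q, of 0 y x] by (simp add: q'_def)
  have "l (- y) \<le> - q y"
    using l(2) sublinear_shift_le[OF q, of 1 y "- y"] q by (auto simp: q'_def le_fun_def sublinear_def intro: order_trans)
  then have "q y \<le> l y" by (simp add: neg)
  moreover have "l x \<le> q x" for x using l(2) q'q by (auto simp: le_fun_def intro: order_trans)
  ultimately show thesis using that[OF lin] by (simp add: antisym)
qed

section \<open>Complex-linear maps, positive functionals and norming states\<close>

lemma clinearI:
  assumes "\<And>x y. L (x + y) = L x + L y" "\<And>c x. L (c *\<^sub>C x) = c *\<^sub>C L x"
  shows "clinear L"
  using assms by unfold_locales (auto simp: complex_vector.scale_right_distrib complex_vector.scale_left_distrib)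

lemma clinear_module_hom: "clinear L \<Longrightarrow> module_hom scaleC scaleC L"
  by (simp add: Vector_Spaces.linear_def)

lemmas clinear_add = module_hom.add[OF clinear_module_hom]
lemmas clinear_scale = module_hom.scale[OF clinear_module_hom]
lemmas clinear_zero = module_hom.zero[OF clinear_module_hom]
lemmas clinear_diff = module_hom.diff[OF clinear_module_hom]
lemmas clinear_minus = module_hom.neg[OF clinear_module_hom]
lemmas clinear_sum = module_hom.sum[OF clinear_module_hom]

lemma scaleC_complex [simp]: "c *\<^sub>C (z::complex) = c * z"
  by (simp add: scaleC_complex_def)

lemma scaleR_conv_scaleC: "r *\<^sub>R x = of_real r *\<^sub>C (x::'a::cstar_algebra)"
  by (simp add: scaleC_of_real)

lemma clinear_of_real:
  fixes L :: "'a::cstar_algebra \<Rightarrow> 'b::cstar_algebra"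
  assumes "clinear L" shows "L (of_real r) = of_real r * L 1"
proof -
  have "L (of_real r) = L (of_real r *\<^sub>C 1)" unfolding of_real_def[where 'a='a] scaleC_of_real ..
  also have "\<dots> = of_real r *\<^sub>C L 1" by (rule clinear_scale[OF assms])
  also have "\<dots> = of_real r * L 1" unfolding of_real_def[where 'a='b] scaleC_of_real by simp
  finally show ?thesis .
qed

lemma clinear_compose: "clinear L \<Longrightarrow> clinear M \<Longrightarrow> clinear (\<lambda>x. M (L x))"
  using Vector_Spaces.linear_compose[of scaleC scaleC L scaleC M] by (simp add: o_def)

text \<open>Compressions \<open>f (star y * x * y)\<close> of a state are in general not normalised,
  so positivity is kept apart from \<open>f 1 = 1\<close>.\<close>

definition pos_functional :: "('a::cstar_algebra \<Rightarrow> complex) \<Rightarrow> bool"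
  where "pos_functional f \<longleftrightarrow> clinear f \<and> (\<forall>x. f (star x * x) \<in> \<real>\<^sub>\<ge>\<^sub>0)"

lemma state_iff: "state f \<longleftrightarrow> pos_functional f \<and> f 1 = 1"
  by (auto simp: state_def pos_functional_def)

lemma pos_functional_pos_elem: "pos_functional f \<Longrightarrow> pos_elem h \<Longrightarrow> f h \<in> \<real>\<^sub>\<ge>\<^sub>0"
  unfolding pos_functional_def pos_elem_def by metis

lemma pos_functional_conj:
  assumes "pos_functional f" shows "pos_functional (\<lambda>x. f (star y * x * y))"
  unfolding pos_functional_def
proof (intro conjI allI clinearI)
  show "f (star y * (star x * x) * y) \<in> \<real>\<^sub>\<ge>\<^sub>0" for x
    using assms unfolding pos_functional_def by (metis mult.assoc star_mult)
qed (use assms in \<open>auto simp: pos_functional_def clinear_add clinear_scale algebra_simps mult_scaleC_left mult_scaleC_right\<close>)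

text \<open>A positive \<open>h\<close> has distance at most \<open>norm h\<close> from
  \<open>norm h\<close> times the unit, and \<open>l\<close> is dominated by the norm.\<close>

lemma linear_le_norm_nonneg:
  fixes l :: "'a::cstar_algebra \<Rightarrow> real"
  assumes "linear l" "\<And>x. l x \<le> norm x" "l 1 = 1" "pos_elem h"
  shows "l h \<ge> 0"
proof -
  have "norm h - l h = l (of_real (norm h) - h)"
    using assms(1,3) by (simp add: linear_diff of_real_def linear_scale)
  also have "\<dots> \<le> norm h" using assms(2)[of "of_real (norm h) - h"] assms(4) unfolding positive_iff by linarith
  finally show ?thesis by simp
qed

text \<open>Norming \<open>1 + h\<close> instead of \<open>h\<close> controls two values at once:
  for positive \<open>h\<close> its norm is at least \<open>1 + norm h\<close>, so
  \<open>l 1 = 1\<close> and \<open>l h = norm h\<close> both follow. The first makes the functional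
  positive.\<close>

lemma norming_state:
  fixes h :: "'a::cstar_algebra"
  assumes h: "pos_elem h"
  obtains \<psi> where "state \<psi>" "\<psi> h = of_real (norm h)"
proof -
  have "sublinear (norm :: 'a \<Rightarrow> real)" by (simp add: sublinear_def norm_triangle_ineq)
  then obtain l where l: "linear l" "\<And>x. l x \<le> norm x" "l (1 + h) = norm (1 + h)"
    using sublinear_majorant_attained by blast
  have p1: "pos_elem (1 + h)" using positive_add[OF positive_of_real[of 1] h] by simp
  have "1 \<le> norm (1 + h)" using positive_norm_mono[OF positive_of_real[of 1], of "1 + h"] h by simp
  then have "norm h \<le> norm (1 + h) - 1"
  proof (intro norm_le_of_positive[OF h])
    have "pos_elem (of_real (norm (1 + h)) - (1 + h))"
      by (intro positive_norm_minus positive_selfadjoint p1)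
    then show "pos_elem (of_real (norm (1 + h) - 1) - h)" by (simp add: algebra_simps)
  qed auto
  then have l1: "l 1 = 1" "l h = norm h"
    using l(2)[of 1] l(2)[of h] l(3) by (auto simp: linear_add[OF l(1)])
  \<comment> \<open>\<open>l\<close> is only real linear; using it on self-adjoint parts alone gives
    a complex-linear functional.\<close>
  define \<psi> where "\<psi> x = Complex (l (re_part x)) (l (im_part x))" for x
  have "state \<psi>"
    unfolding state_def
  proof (intro conjI allI clinearI)
    show add: "\<psi> (x + y) = \<psi> x + \<psi> y" for x y
    proof -
      have "re_part (x + y) = re_part x + re_part y" "im_part (x + y) = im_part x + im_part y"
        by (simp_all add: re_part_def im_part_def star_add scaleR_add_right scaleC_add_right complex_vector.scale_right_diff_distrib algebra_simps)
      then show ?thesis by (simp add: \<psi>_def linear_add[OF l(1)] complex_eq_iff)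
    qed
    show "\<psi> (c *\<^sub>C x) = c *\<^sub>C \<psi> x" for c x
    proof -
      have real: "\<psi> (r *\<^sub>R y) = of_real r * \<psi> y" for r y
      proof -
        have "re_part (r *\<^sub>R y) = r *\<^sub>R re_part y" "im_part (r *\<^sub>R y) = r *\<^sub>R im_part y"
          by (simp_all add: re_part_def im_part_def star_scaleR scaleR_add_right scaleC_scaleR
              flip: scaleR_diff_right)
        then show ?thesis by (simp add: \<psi>_def linear_scale[OF l(1)] complex_eq_iff)
      qed
      have imag: "\<psi> (\<i> *\<^sub>C y) = \<i> * \<psi> y" for y
      proof -
        have "re_part (\<i> *\<^sub>C y) = - im_part y" "im_part (\<i> *\<^sub>C y) = re_part y"
          by (simp_all add: re_part_def im_part_def star_scaleC scaleC_scaleC complex_vector.scale_right_diff_distrib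
              complex_vector.scale_right_distrib flip: scaleC_of_real)
        then show ?thesis by (simp add: \<psi>_def linear_neg[OF l(1)] complex_eq_iff)
      qed
      have "c *\<^sub>C x = Re c *\<^sub>R x + Im c *\<^sub>R (\<i> *\<^sub>C x)"
        by (simp add: scaleC_scaleC mult.commute flip: scaleC_of_real complex_vector.scale_left_distrib complex_eq)
      then have "\<psi> (c *\<^sub>C x) = (of_real (Re c) + \<i> * of_real (Im c)) * \<psi> x"
        by (simp add: add real imag algebra_simps)
      then show ?thesis by (simp add: scaleC_complex_def flip: complex_eq)
    qed
    have sa: "\<psi> x = of_real (l x)" if "star x = x" for x
      using that by (simp add: \<psi>_def re_part_def im_part_def linear_0[OF l(1)] complex_eq_iff flip: scaleR_2)
    show "\<psi> 1 = 1" by (simp add: sa l1)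
    show "\<psi> (star x * x) \<in> \<real>\<^sub>\<ge>\<^sub>0" for x
      using linear_le_norm_nonneg[OF l(1,2) l1(1) positive_star_mult[of x]]
      by (simp add: sa positive_selfadjoint positive_star_mult)
  qed
  moreover have "\<psi> h = of_real (norm h)"
    using positive_selfadjoint[OF h] by (simp add: \<psi>_def re_part_def im_part_def linear_0[OF l(1)] complex_eq_iff l1 flip: scaleR_2)
  ultimately show thesis using that by blast
qed

lemma norming_state_norm:
  obtains \<psi> where "state \<psi>" "\<psi> (star x * x) = of_real ((norm x)\<^sup>2)"
  using norming_state[OF positive_star_mult[of x]] by (metis cstar_identity)

subsection \<open>Semi-inner products\<close>

text \<open>The expression is the quadratic form of the matrix with rows \<open>A\<close>,
  \<open>C\<close> and \<open>C'\<close>, \<open>B\<close> at the vector \<open>(1, c)\<close>; the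
  conclusion is Hermitian symmetry and nonnegative determinant. This one computation serves all
  Cauchy-Schwarz inequalities below.\<close>

lemma psd_two_by_two:
  fixes A B C C' :: complex
  assumes "\<And>c. A + c * C + cnj c * C' + cnj c * c * B \<in> \<real>\<^sub>\<ge>\<^sub>0"
  shows "C' = cnj C" "(cmod C)\<^sup>2 \<le> Re A * Re B"
proof -
  have pos: "0 \<le> Re (A + c * C + cnj c * C' + cnj c * c * B)" "Im (A + c * C + cnj c * C' + cnj c * c * B) = 0" for c
    using assms[of c] by (simp_all add: complex_nonneg_Reals_iff)
  have A: "0 \<le> Re A" "Im A = 0" using pos[of 0] by auto
  have B: "Im B = 0" using pos(2)[of 1] pos(2)[of "- 1"] A by simp
  have "Im C + Im C' = 0" using pos(2)[of 1] A B by simp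
  moreover have "Re C - Re C' = 0" using pos(2)[of "\<i>"] A B by simp
  ultimately show C': "C' = cnj C" by (simp add: complex_eq_iff)
  \<comment> \<open>\<open>c = - t * cnj C\<close> makes both cross terms real and equal, leaving a
    real quadratic polynomial in \<open>t\<close>.\<close>
  have q: "0 \<le> Re A - 2 * t * (cmod C)\<^sup>2 + t\<^sup>2 * (cmod C)\<^sup>2 * Re B" for t
    using pos(1)[of "- of_real t * cnj C"]
    unfolding cmod_power2 by (simp add: C' power2_eq_square algebra_simps)
  show "(cmod C)\<^sup>2 \<le> Re A * Re B"
  proof (cases "C = 0")
    case True
    have "0 \<le> Re B"
    proof (rule ccontr)
      assume "\<not> 0 \<le> Re B"
      \<comment> \<open>This \<open>t\<close> would give the form the value -1.\<close>
      define t where "t = sqrt ((Re A + 1) / - Re B)"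
      have "t * t * Re B = - (Re A + 1)"
        using \<open>\<not> 0 \<le> Re B\<close> A by (simp add: t_def field_simps)
      then show False using pos(1)[of "of_real t"] by (simp add: True C' algebra_simps)
    qed
    then show ?thesis using A True by simp
  next
    case False
    then have C: "(cmod C)\<^sup>2 > 0" by simp
    show ?thesis
    proof (cases "Re B > 0")
      case True
      have "Re A - 2 * (1 / Re B) * (cmod C)\<^sup>2 + (1 / Re B)\<^sup>2 * (cmod C)\<^sup>2 * Re B = Re A - (cmod C)\<^sup>2 / Re B"
        using True by (simp add: power2_eq_square field_simps)
      then have "(cmod C)\<^sup>2 / Re B \<le> Re A" using q[of "1 / Re B"] by simp
      then show ?thesis using True by (simp add: field_simps)
    next
      case neg: False
      \<comment> \<open>With \<open>Re B \<le> 0\<close> this \<open>t\<close> bounds the polynomial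
        by \<open>- Re A - 2\<close>, a contradiction.\<close>
      define t where "t = (Re A + 1) / (cmod C)\<^sup>2"
      have "t * (cmod C)\<^sup>2 = Re A + 1" using C by (simp add: t_def)
      moreover have "t\<^sup>2 * (cmod C)\<^sup>2 * Re B \<le> 0" using neg by (simp add: mult_nonneg_nonpos)
      ultimately show ?thesis using q[of t] A by (simp add: mult.assoc)
    qed
  qed
qed

text \<open>The carrier is a subspace rather than the whole type: besides the GNS spaces of
  C*-algebras it has to serve functionals that are only controlled on an algebraic tensor
  product.\<close>

locale semi_inner =
  fixes D :: "'a::cstar_algebra set" and s :: "'a \<Rightarrow> 'a \<Rightarrow> complex"
  assumes subspace: "csubspace D"
    and add_right: "\<lbrakk>x \<in> D; y \<in> D; z \<in> D\<rbrakk> \<Longrightarrow> s x (y + z) = s x y + s x z"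
    and scale_right: "\<lbrakk>x \<in> D; y \<in> D\<rbrakk> \<Longrightarrow> s x (c *\<^sub>C y) = c * s x y"
    and add_left: "\<lbrakk>x \<in> D; y \<in> D; z \<in> D\<rbrakk> \<Longrightarrow> s (x + y) z = s x z + s y z"
    and scale_left: "\<lbrakk>x \<in> D; y \<in> D\<rbrakk> \<Longrightarrow> s (c *\<^sub>C x) y = cnj c * s x y"
    and nonneg: "x \<in> D \<Longrightarrow> s x x \<in> \<real>\<^sub>\<ge>\<^sub>0"
begin

definition sn :: "'a \<Rightarrow> real" where "sn x = sqrt (Re (s x x))"

lemma in_D: "x \<in> D \<Longrightarrow> y \<in> D \<Longrightarrow> x + y \<in> D" "x \<in> D \<Longrightarrow> c *\<^sub>C x \<in> D" "0 \<in> D"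
  "x \<in> D \<Longrightarrow> - x \<in> D" "x \<in> D \<Longrightarrow> y \<in> D \<Longrightarrow> x - y \<in> D"
  using subspace by (auto intro: complex_vector.subspace_add complex_vector.subspace_scale
    complex_vector.subspace_0 complex_vector.subspace_neg complex_vector.subspace_diff)

lemma expand:
  assumes "x \<in> D" "y \<in> D"
  shows "s (x + c *\<^sub>C y) (x + c *\<^sub>C y) = s x x + c * s x y + cnj c * s y x + cnj c * c * s y y"
  using assms by (simp add: add_left add_right scale_left scale_right in_D algebra_simps)

lemma
  assumes "x \<in> D" "y \<in> D"
  shows hermitian: "s y x = cnj (s x y)" and Cauchy_Schwarz_sq: "(cmod (s x y))\<^sup>2 \<le> Re (s x x) * Re (s y y)"
proof -
  have "s x x + c * s x y + cnj c * s y x + cnj c * c * s y y \<in> \<real>\<^sub>\<ge>\<^sub>0" for c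
    using nonneg[of "x + c *\<^sub>C y"] assms by (simp add: expand[symmetric] in_D)
  from psd_two_by_two[OF this] show "s y x = cnj (s x y)" "(cmod (s x y))\<^sup>2 \<le> Re (s x x) * Re (s y y)" by auto
qed

lemma sn_nonneg: "x \<in> D \<Longrightarrow> 0 \<le> sn x"
  using nonneg[of x] by (simp add: sn_def complex_nonneg_Reals_iff)

lemma sn_square: "x \<in> D \<Longrightarrow> s x x = of_real ((sn x)\<^sup>2)"
  using nonneg[of x] by (simp add: sn_def complex_nonneg_Reals_iff complex_eq_iff)

lemma Cauchy_Schwarz:
  assumes "x \<in> D" "y \<in> D" shows "cmod (s x y) \<le> sn x * sn y"
proof -
  have "(cmod (s x y))\<^sup>2 \<le> (sn x * sn y)\<^sup>2"
    using Cauchy_Schwarz_sq[OF assms] assms by (simp add: sn_square power_mult_distrib)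
  then show ?thesis using assms by (simp add: power2_le_iff_abs_le sn_nonneg)
qed

lemma sn_scale: "x \<in> D \<Longrightarrow> sn (c *\<^sub>C x) = cmod c * sn x"
proof -
  assume x: "x \<in> D"
  then have "s (c *\<^sub>C x) (c *\<^sub>C x) = (c * cnj c) * s x x" by (simp add: scale_left scale_right in_D)
  also have "\<dots> = of_real ((cmod c)\<^sup>2) * s x x" by (simp only: complex_norm_square)
  finally show ?thesis by (simp add: sn_def real_sqrt_mult)
qed

lemma sn_triangle:
  assumes "x \<in> D" "y \<in> D" shows "sn (x + y) \<le> sn x + sn y"
proof -
  have "(sn (x + y))\<^sup>2 = Re (s (x + y) (x + y))" using assms by (simp add: sn_square in_D)
  also have "\<dots> = (sn x)\<^sup>2 + 2 * Re (s x y) + (sn y)\<^sup>2"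
    using expand[OF assms, of 1] hermitian[OF assms] assms by (simp add: sn_square)
  also have "\<dots> \<le> (sn x)\<^sup>2 + 2 * (sn x * sn y) + (sn y)\<^sup>2"
    using Cauchy_Schwarz[OF assms] complex_Re_le_cmod[of "s x y"] by simp
  also have "\<dots> = (sn x + sn y)\<^sup>2" by (simp add: power2_eq_square algebra_simps)
  finally show ?thesis using assms by (simp add: power2_le_iff_abs_le sn_nonneg)
qed

lemma sn_zero: "sn 0 = 0"
  using sn_scale[OF in_D(3), of 0] by simp

lemma sn_minus_commute:
  assumes "x \<in> D" "y \<in> D" shows "sn (x - y) = sn (y - x)"
proof -
  have "sn (y - x) = sn ((- 1) *\<^sub>C (x - y))" by simp
  also have "\<dots> = sn (x - y)" using sn_scale[OF in_D(5)[OF assms], of "- 1"] by simp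
  finally show ?thesis by simp
qed

lemma sn_sum: "finite I \<Longrightarrow> (\<And>i. i \<in> I \<Longrightarrow> h i \<in> D) \<Longrightarrow> sn (sum h I) \<le> (\<Sum>i\<in>I. sn (h i)) \<and> sum h I \<in> D"
proof (induction I rule: finite_induct)
  case (insert i I)
  then have "sn (h i + sum h I) \<le> sn (h i) + sn (sum h I)" by (intro sn_triangle) auto
  then show ?case using insert by (auto intro: in_D)
qed (simp add: sn_zero in_D)

end

locale pos_functional_on =
  fixes D :: "'a::cstar_algebra set" and L :: "'a \<Rightarrow> complex"
  assumes csub: "csubspace D" and one_D: "1 \<in> D"
    and mult_D: "\<lbrakk>x \<in> D; y \<in> D\<rbrakk> \<Longrightarrow> x * y \<in> D" and star_D: "x \<in> D \<Longrightarrow> star x \<in> D"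
    and L_add: "\<lbrakk>x \<in> D; y \<in> D\<rbrakk> \<Longrightarrow> L (x + y) = L x + L y"
    and L_scale: "x \<in> D \<Longrightarrow> L (c *\<^sub>C x) = c * L x"
    and L_nonneg: "x \<in> D \<Longrightarrow> L (star x * x) \<in> \<real>\<^sub>\<ge>\<^sub>0"

sublocale pos_functional_on \<subseteq> semi_inner D "\<lambda>x y. L (star x * y)"
proof
  fix x y z c assume D: "x \<in> D" "y \<in> D" "z \<in> D"
  show "L (star x * (y + z)) = L (star x * y) + L (star x * z)"
    using D by (simp only: distrib_left L_add mult_D star_D)
  show "L (star (x + y) * z) = L (star x * z) + L (star y * z)"
    using D by (simp only: distrib_right star_add L_add mult_D star_D)
next
  fix x y c assume D: "x \<in> D" "y \<in> D"
  show "L (star x * (c *\<^sub>C y)) = c * L (star x * y)"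
    using D by (simp only: mult_scaleC_right L_scale mult_D star_D)
  show "L (star (c *\<^sub>C x) * y) = cnj c * L (star x * y)"
    using D by (simp only: star_scaleC mult_scaleC_left L_scale mult_D star_D)
qed (simp_all add: csub L_nonneg)


lemma pos_functional_on_UNIV: "pos_functional f \<Longrightarrow> pos_functional_on UNIV f"
  by unfold_locales (auto simp: pos_functional_def clinear_add clinear_scale scaleC_complex_def)

lemma pos_functional_le:
  fixes f :: "'a::cstar_algebra \<Rightarrow> complex"
  assumes "pos_functional f"
  shows "Re (f (star x * x)) \<le> (norm x)\<^sup>2 * Re (f 1)"
proof -
  have "pos_elem (of_real ((norm x)\<^sup>2) - star x * x)"
    using positive_norm_minus[of "star x * x"] by (simp add: star_mult star_star cstar_identity)
  then have "f (of_real ((norm x)\<^sup>2) - star x * x) \<in> \<real>\<^sub>\<ge>\<^sub>0" by (rule pos_functional_pos_elem[OF assms])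
  moreover have "f (of_real ((norm x)\<^sup>2)) = of_real ((norm x)\<^sup>2) * f 1"
    using assms unfolding pos_functional_def by (intro clinear_of_real) blast
  ultimately show ?thesis
    using assms by (simp add: pos_functional_def clinear_diff complex_nonneg_Reals_iff)
qed

lemma pos_functional_bound:
  fixes f :: "'a::cstar_algebra \<Rightarrow> complex"
  assumes "pos_functional f"
  shows "cmod (f x) \<le> norm x * Re (f 1)"
proof -
  interpret pos_functional_on UNIV f by (rule pos_functional_on_UNIV[OF assms])
  have "(cmod (f x))\<^sup>2 \<le> Re (f 1) * Re (f (star x * x))" using Cauchy_Schwarz_sq[of 1 x] by simp
  also have "\<dots> \<le> Re (f 1) * ((norm x)\<^sup>2 * Re (f 1))"
    using pos_functional_le[OF assms] nonneg[of 1] by (intro mult_left_mono) (auto simp: complex_nonneg_Reals_iff)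
  also have "\<dots> = (norm x * Re (f 1))\<^sup>2" by (simp add: power2_eq_square)
  finally show ?thesis using nonneg[of 1] by (simp add: power2_le_iff_abs_le complex_nonneg_Reals_iff)
qed

lemma clinear_bounded_linear:
  assumes "clinear L" "\<And>x. norm (L x) \<le> K * norm x" shows "bounded_linear L"
proof (rule bounded_linear_intro[of _ K])
  show "L (r *\<^sub>R x) = r *\<^sub>R L x" for r x
    using clinear_scale[OF assms(1), of "of_real r" x] by (simp add: scaleC_of_real)
qed (use assms in \<open>auto simp: clinear_add mult.commute\<close>)

lemma pos_functional_bounded_linear: "pos_functional f \<Longrightarrow> bounded_linear f"
  using pos_functional_bound[of f]
  by (intro clinear_bounded_linear[of _ "Re (f 1)"]) (auto simp: pos_functional_def mult.commute)

subsection \<open>Contractivity of *-homomorphisms\<close>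

text \<open>Self-adjoint squares are mapped to such squares, so the positivity of the squared norm
  minus \<open>star x * x\<close> is inherited by \<open>\<pi> x\<close>. Continuity is a conclusion
  here and not an assumption.\<close>

lemma star_hom_contractive:
  fixes \<pi> :: "'a::cstar_algebra \<Rightarrow> 'b::cstar_algebra"
  assumes "star_hom \<pi>" "\<pi> 1 = 1"
  shows "norm (\<pi> x) \<le> norm x"
proof -
  have hom: "clinear \<pi>" "\<And>x y. \<pi> (x * y) = \<pi> x * \<pi> y" "\<And>x. \<pi> (star x) = star (\<pi> x)"
    using assms by (auto simp: star_hom_def)
  have pos: "pos_elem (\<pi> h)" if "pos_elem h" for h
    using that hom unfolding pos_elem_def by metis
  have "pos_elem (of_real ((norm x)\<^sup>2) - star x * x)"
    using positive_norm_minus[of "star x * x"] by (simp add: star_mult star_star cstar_identity)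
  then have "pos_elem (\<pi> (of_real ((norm x)\<^sup>2) - star x * x))" by (rule pos)
  moreover have "\<pi> (of_real r) = of_real r" for r
    using clinear_of_real[OF hom(1), of r] assms(2) by simp
  ultimately have "pos_elem (of_real ((norm x)\<^sup>2) - star (\<pi> x) * \<pi> x)"
    using hom(2,3) by (simp only: clinear_diff[OF hom(1)])
  then have "norm (star (\<pi> x) * \<pi> x) \<le> (norm x)\<^sup>2"
    by (intro norm_le_of_positive positive_star_mult) auto
  then show ?thesis by (simp add: cstar_identity power2_le_iff_abs_le)
qed

section \<open>The GNS representation\<close>

text \<open>The completion of the semi-inner product \<open>\<psi> (x\<^sup>* y)\<close> is realised as a space of functions:
  the limit of a Cauchy sequence \<open>b\<close> is the function \<open>a \<mapsto> lim \<psi> (a\<^sup>* b\<^sub>n)\<close>.\<close>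

locale gns =
  fixes \<psi> :: "'a::cstar_algebra \<Rightarrow> complex"
  assumes pos: "pos_functional \<psi>"

sublocale gns \<subseteq> pos_functional_on UNIV \<psi>
  by (rule pos_functional_on_UNIV[OF pos])

context gns
begin

abbreviation ip :: "'a \<Rightarrow> 'a \<Rightarrow> complex" where "ip x y \<equiv> \<psi> (star x * y)"

lemma clin: "clinear \<psi>" using pos by (simp add: pos_functional_def)

lemma ip_diff_right: "ip x (y - z) = ip x y - ip x z"
  by (simp add: right_diff_distrib clinear_diff[OF clin])

lemma ip_diff_left: "ip (x - y) z = ip x z - ip y z"
  by (simp add: star_diff left_diff_distrib clinear_diff[OF clin])

lemma sn_triangle_diff: "sn (x - z) \<le> sn (x - y) + sn (y - z)"
  using sn_triangle[of "x - y" "y - z"] by simp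

lemma sn_mult: "sn (x * y) \<le> norm x * sn y"
proof -
  have "Re (\<psi> (star y * (star x * x) * y)) \<le> (norm x)\<^sup>2 * Re (\<psi> (star y * 1 * y))"
    by (rule pos_functional_le[OF pos_functional_conj[OF pos]])
  then have "(sn (x * y))\<^sup>2 \<le> (norm x * sn y)\<^sup>2"
    using sn_square[of "x * y"] sn_square[of y] by (simp add: star_mult mult.assoc power_mult_distrib)
  then show ?thesis using sn_nonneg[of y] by (simp add: power2_le_iff_abs_le)
qed

definition sn_Cauchy :: "(nat \<Rightarrow> 'a) \<Rightarrow> bool"
  where "sn_Cauchy b \<longleftrightarrow> (\<forall>e>0. \<exists>N. \<forall>m\<ge>N. \<forall>n\<ge>N. sn (b m - b n) < e)"

definition represents :: "(nat \<Rightarrow> 'a) \<Rightarrow> ('a \<Rightarrow> complex) \<Rightarrow> bool"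
  where "represents b h \<longleftrightarrow> sn_Cauchy b \<and> (\<forall>a. (\<lambda>n. ip a (b n)) \<longlonglongrightarrow> h a)"

text \<open>Null vectors represent the zero function, so no quotient has to be formed, and the
  function type is the one over which \<open>spatially_bounded\<close> quantifies.\<close>

definition Hspace :: "('a \<Rightarrow> complex) set" where "Hspace = {h. \<exists>b. represents b h}"

definition Hseq :: "('a \<Rightarrow> complex) \<Rightarrow> nat \<Rightarrow> 'a" where "Hseq h = (SOME b. represents b h)"

definition Hip :: "('a \<Rightarrow> complex) \<Rightarrow> ('a \<Rightarrow> complex) \<Rightarrow> complex"
  where "Hip h k = lim (\<lambda>n. ip (Hseq h n) (Hseq k n))"

definition vec :: "'a \<Rightarrow> 'a \<Rightarrow> complex" where "vec x = (\<lambda>a. ip a x)"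

text \<open>Moving \<open>x\<close> to the other side of the inner product turns left multiplication
  into an operation on functions that involves no choice of a sequence.\<close>

definition act :: "'a \<Rightarrow> ('a \<Rightarrow> complex) \<Rightarrow> 'a \<Rightarrow> complex"
  where "act x h = (\<lambda>a. h (star x * a))"

section \<open>Cauchy sequences and the functions they represent\<close>

lemma sn_Cauchy_bounded:
  assumes "sn_Cauchy b" obtains K where "K > 0" "\<And>n. sn (b n) \<le> K"
proof -
  obtain N where N: "\<And>m n. m \<ge> N \<Longrightarrow> n \<ge> N \<Longrightarrow> sn (b m - b n) < 1"
    using assms unfolding sn_Cauchy_def by (meson zero_less_one)
  define K where "K = (\<Sum>n\<le>N. sn (b n)) + 1"
  have le: "sn (b n) \<le> (\<Sum>n\<le>N. sn (b n))" if "n \<le> N" for n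
    using that by (intro member_le_sum) (auto simp: sn_nonneg)
  have "sn (b n) \<le> K" for n
  proof (cases "n \<le> N")
    case False
    have "sn (b n) \<le> sn (b N) + sn (b n - b N)" using sn_triangle[of "b N" "b n - b N"] by simp
    then show ?thesis using N[of n N] le[of N] False by (simp add: K_def)
  qed (use le in \<open>simp add: K_def add_increasing2\<close>)
  moreover have "K > 0" unfolding K_def by (intro add_nonneg_pos sum_nonneg) (auto simp: sn_nonneg)
  ultimately show thesis using that by blast
qed

lemma ip_diff_bound: "cmod (ip x y - ip x' y') \<le> sn (x - x') * sn y + sn x' * sn (y - y')"
proof -
  have "ip x y - ip x' y' = ip (x - x') y + ip x' (y - y')" by (simp add: ip_diff_left ip_diff_right)
  then have "cmod (ip x y - ip x' y') \<le> cmod (ip (x - x') y) + cmod (ip x' (y - y'))"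
    by (simp add: norm_triangle_ineq)
  also have "\<dots> \<le> sn (x - x') * sn y + sn x' * sn (y - y')" by (intro add_mono Cauchy_Schwarz) auto
  finally show ?thesis .
qed

lemma ip_convergent:
  assumes "sn_Cauchy b" "sn_Cauchy c" shows "convergent (\<lambda>n. ip (b n) (c n))"
proof -
  obtain K where K: "K > 0" "\<And>n. sn (b n) \<le> K" using sn_Cauchy_bounded[OF assms(1)] by blast
  obtain M where M: "M > 0" "\<And>n. sn (c n) \<le> M" using sn_Cauchy_bounded[OF assms(2)] by blast
  have "Cauchy (\<lambda>n. ip (b n) (c n))"
  proof (rule CauchyI)
    fix e :: real assume e: "e > 0"
    obtain N1 where N1: "\<And>m n. m \<ge> N1 \<Longrightarrow> n \<ge> N1 \<Longrightarrow> sn (b m - b n) < e / (2 * M)"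
      using assms(1) e M(1) unfolding sn_Cauchy_def by (meson divide_pos_pos mult_pos_pos zero_less_numeral)
    obtain N2 where N2: "\<And>m n. m \<ge> N2 \<Longrightarrow> n \<ge> N2 \<Longrightarrow> sn (c m - c n) < e / (2 * K)"
      using assms(2) e K(1) unfolding sn_Cauchy_def by (meson divide_pos_pos mult_pos_pos zero_less_numeral)
    have "cmod (ip (b m) (c m) - ip (b n) (c n)) < e" if mn: "m \<ge> max N1 N2" "n \<ge> max N1 N2" for m n
    proof -
      have "cmod (ip (b m) (c m) - ip (b n) (c n)) \<le> sn (b m - b n) * sn (c m) + sn (b n) * sn (c m - c n)"
        by (rule ip_diff_bound)
      also have "\<dots> \<le> sn (b m - b n) * M + K * sn (c m - c n)"
        by (intro add_mono mult_left_mono mult_right_mono K(2) M(2)) (auto simp: sn_nonneg)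
      also have "\<dots> < (e / (2 * M)) * M + K * (e / (2 * K))"
        using N1[of m n] N2[of m n] mn M(1) K(1) by (intro add_strict_mono mult_strict_right_mono mult_strict_left_mono) auto
      also have "\<dots> = e" using K(1) M(1) by simp
      finally show ?thesis .
    qed
    then show "\<exists>N. \<forall>m\<ge>N. \<forall>n\<ge>N. norm (ip (b m) (c m) - ip (b n) (c n)) < e" by blast
  qed
  then show ?thesis by (simp add: Cauchy_convergent_iff)
qed

text \<open>\<open>k (b n)\<close> is the limit of \<open>ip (b n) (c m)\<close> in
  \<open>m\<close>, uniformly in \<open>n\<close> because \<open>b\<close> is bounded. With it one
  representing sequence can be exchanged for another.\<close>

lemma ip_sub_eval:
  assumes b: "represents b h" and c: "represents c k"
  shows "(\<lambda>n. ip (b n) (c n) - k (b n)) \<longlonglongrightarrow> 0"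
proof (rule LIMSEQ_I)
  fix e :: real assume e: "e > 0"
  obtain K where K: "K > 0" "\<And>n. sn (b n) \<le> K" using sn_Cauchy_bounded b unfolding represents_def by blast
  obtain N where N: "\<And>m n. m \<ge> N \<Longrightarrow> n \<ge> N \<Longrightarrow> sn (c m - c n) < e / (2 * K)"
    using c e K(1) unfolding represents_def sn_Cauchy_def by (meson divide_pos_pos mult_pos_pos zero_less_numeral)
  have "cmod (ip (b n) (c n) - k (b n)) < e" if n: "n \<ge> N" for n
  proof -
    have "(\<lambda>m. cmod (ip (b n) (c n) - ip (b n) (c m))) \<longlonglongrightarrow> cmod (ip (b n) (c n) - k (b n))"
      using c unfolding represents_def by (intro tendsto_intros) auto
    moreover have "cmod (ip (b n) (c n) - ip (b n) (c m)) \<le> e / 2" if m: "m \<ge> N" for m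
    proof -
      have "cmod (ip (b n) (c n) - ip (b n) (c m)) \<le> sn (b n) * sn (c n - c m)"
        using ip_diff_bound[of "b n" "c n" "b n" "c m"] by (simp add: sn_zero)
      also have "\<dots> \<le> K * (e / (2 * K))"
        using N[OF n m] K by (intro mult_mono) (auto simp: sn_nonneg)
      also have "\<dots> = e / 2" using K(1) by simp
      finally show ?thesis .
    qed
    ultimately have "cmod (ip (b n) (c n) - k (b n)) \<le> e / 2" by (intro LIMSEQ_le_const2) auto
    then show ?thesis using e by simp
  qed
  then show "\<exists>N. \<forall>n\<ge>N. norm (ip (b n) (c n) - k (b n) - 0) < e" by auto
qed

lemma ip_sub_eval':
  assumes "represents b h" "represents c k"
  shows "(\<lambda>n. ip (b n) (c n) - cnj (h (c n))) \<longlonglongrightarrow> 0"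
proof -
  have "(\<lambda>n. cnj (ip (c n) (b n) - h (c n))) \<longlonglongrightarrow> cnj 0"
    by (intro tendsto_cnj ip_sub_eval[OF assms(2,1)])
  then show ?thesis using hermitian[of "c _" "b _"] by simp
qed

lemma Hip_tendsto:
  assumes b: "represents b h" and c: "represents c k"
  shows "(\<lambda>n. ip (b n) (c n)) \<longlonglongrightarrow> Hip h k"
proof -
  have B: "represents (Hseq h) h" unfolding Hseq_def by (rule someI[of "\<lambda>b. represents b h", OF b])
  have C: "represents (Hseq k) k" unfolding Hseq_def by (rule someI[of "\<lambda>b. represents b k", OF c])
  have "convergent (\<lambda>n. ip (Hseq h n) (Hseq k n))"
    using ip_convergent B C unfolding represents_def by blast
  then have lim: "(\<lambda>n. ip (Hseq h n) (Hseq k n)) \<longlonglongrightarrow> Hip h k"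
    unfolding Hip_def by (simp add: convergent_LIMSEQ_iff)
  \<comment> \<open>Four exchanges lead from the chosen sequences to \<open>b\<close> and
    \<open>c\<close>, one argument at a time; the intermediate values are
    \<open>cnj (h (Hseq k n))\<close> and \<open>k (b n)\<close>.\<close>
  have "(\<lambda>n. ip (Hseq h n) (Hseq k n) - (ip (Hseq h n) (Hseq k n) - cnj (h (Hseq k n)))
      + (ip (b n) (Hseq k n) - cnj (h (Hseq k n))) - (ip (b n) (Hseq k n) - k (b n))
      + (ip (b n) (c n) - k (b n))) \<longlonglongrightarrow> Hip h k - 0 + 0 - 0 + 0"
    by (intro tendsto_add tendsto_diff lim ip_sub_eval[OF b C] ip_sub_eval[OF b c] ip_sub_eval'[OF B C] ip_sub_eval'[OF b C])
  then show ?thesis by simp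
qed

lemma sn_tendsto:
  assumes "represents b h" shows "(\<lambda>n. (sn (b n))\<^sup>2) \<longlonglongrightarrow> Re (Hip h h)"
  using tendsto_Re[OF Hip_tendsto[OF assms assms]] by (simp add: sn_square)

lemma Hspace_cases:
  assumes "h \<in> Hspace" obtains b where "represents b h"
  using assms by (auto simp: Hspace_def)

lemma representsD: "represents b h \<Longrightarrow> (\<lambda>n. ip a (b n)) \<longlonglongrightarrow> h a"
  by (simp add: represents_def)

lemma represents_in: "represents b h \<Longrightarrow> h \<in> Hspace"
  by (auto simp: Hspace_def)

lemma represents_add:
  assumes "represents b h" "represents c k" shows "represents (\<lambda>n. b n + c n) (\<lambda>i. h i + k i)"
  unfolding represents_def
proof (intro conjI allI)
  show "sn_Cauchy (\<lambda>n. b n + c n)"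
    unfolding sn_Cauchy_def
  proof (intro allI impI)
    fix e :: real assume "e > 0"
    then have "e / 2 > 0" by simp
    obtain M where M: "\<And>m n. m \<ge> M \<Longrightarrow> n \<ge> M \<Longrightarrow> sn (b m - b n) < e / 2"
      using assms(1) \<open>e / 2 > 0\<close> unfolding represents_def sn_Cauchy_def by blast
    obtain N where N: "\<And>m n. m \<ge> N \<Longrightarrow> n \<ge> N \<Longrightarrow> sn (c m - c n) < e / 2"
      using assms(2) \<open>e / 2 > 0\<close> unfolding represents_def sn_Cauchy_def by blast
    have "sn ((b m + c m) - (b n + c n)) < e" if "m \<ge> max M N" "n \<ge> max M N" for m n
      using sn_triangle[of "b m - b n" "c m - c n"] M[of m n] N[of m n] that by (simp add: algebra_simps)
    then show "\<exists>N. \<forall>m\<ge>N. \<forall>n\<ge>N. sn ((b m + c m) - (b n + c n)) < e" by blast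
  qed
  show "(\<lambda>n. ip a (b n + c n)) \<longlonglongrightarrow> h a + k a" for a
    using assms by (simp add: add_right) (intro tendsto_add representsD)
qed

lemma sn_Cauchy_Lipschitz:
  assumes "sn_Cauchy b" "\<And>x y. sn (f x - f y) \<le> K * sn (x - y)" shows "sn_Cauchy (\<lambda>n. f (b n))"
  unfolding sn_Cauchy_def
proof (intro allI impI)
  fix e :: real assume e: "e > 0"
  define M where "M = max K 1"
  have M: "M > 0" "K \<le> M" by (auto simp: M_def)
  obtain N where N: "\<And>m n. m \<ge> N \<Longrightarrow> n \<ge> N \<Longrightarrow> sn (b m - b n) < e / M"
    using assms(1) e M(1) unfolding sn_Cauchy_def by (meson divide_pos_pos)
  have "sn (f (b m) - f (b n)) < e" if "m \<ge> N" "n \<ge> N" for m n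
  proof -
    have "sn (f (b m) - f (b n)) \<le> M * sn (b m - b n)"
      using assms(2)[of "b m" "b n"] mult_right_mono[OF M(2), of "sn (b m - b n)"] by (simp add: sn_nonneg)
    also have "\<dots> < M * (e / M)" using N[OF that] M(1) by (intro mult_strict_left_mono) auto
    finally show ?thesis using M(1) by simp
  qed
  then show "\<exists>N. \<forall>m\<ge>N. \<forall>n\<ge>N. sn (f (b m) - f (b n)) < e" by blast
qed

lemma represents_scale:
  assumes "represents b h" shows "represents (\<lambda>n. c *\<^sub>C b n) (\<lambda>i. c * h i)"
  unfolding represents_def
proof (intro conjI allI)
  show "sn_Cauchy (\<lambda>n. c *\<^sub>C b n)"
  proof (rule sn_Cauchy_Lipschitz[of b "(*\<^sub>C) c" "cmod c"])
    show "sn (c *\<^sub>C x - c *\<^sub>C y) \<le> cmod c * sn (x - y)" for x y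
      using sn_scale[of "x - y" c] by (simp add: complex_vector.scale_right_diff_distrib)
  qed (use assms in \<open>simp add: represents_def\<close>)
  show "(\<lambda>n. ip a (c *\<^sub>C b n)) \<longlonglongrightarrow> c * h a" for a
    using assms by (simp add: scale_right) (intro tendsto_mult_left representsD)
qed

lemma represents_diff:
  assumes "represents b h" "represents c k" shows "represents (\<lambda>n. b n - c n) (\<lambda>i. h i - k i)"
  using represents_add[OF assms(1) represents_scale[OF assms(2), of "- 1"]] by simp

lemma represents_act:
  assumes "represents b h" shows "represents (\<lambda>n. x * b n) (act x h)"
  unfolding represents_def
proof (intro conjI allI)
  show "sn_Cauchy (\<lambda>n. x * b n)"
  proof (rule sn_Cauchy_Lipschitz[of b "(*) x" "norm x"])
    show "sn (x * y - x * z) \<le> norm x * sn (y - z)" for y z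
      using sn_mult[of x "y - z"] by (simp add: right_diff_distrib)
  qed (use assms in \<open>simp add: represents_def\<close>)
  show "(\<lambda>n. ip a (x * b n)) \<longlonglongrightarrow> act x h a" for a
    using representsD[OF assms, of "star x * a"] by (simp add: act_def star_mult star_star mult.assoc)
qed

lemma represents_vec: "represents (\<lambda>n. x) (vec x)"
  by (simp add: represents_def sn_Cauchy_def vec_def sn_zero)

lemma Hip_vec: "Hip (vec x) (vec y) = ip x y"
  by (rule LIMSEQ_unique[OF Hip_tendsto[OF represents_vec represents_vec] tendsto_const])

lemma act_vec: "act x (vec y) = vec (x * y)"
  by (simp add: act_def vec_def star_mult star_star mult.assoc)

text \<open>A diagonal sequence: \<open>c m\<close> is a member of the sequence representing
  \<open>X m\<close> from which the later members differ by less than \<open>1 / (m + 1)\<close>.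
  The function represented by \<open>c\<close> is the limit.\<close>

lemma complete:
  assumes X: "\<And>n. X n \<in> Hspace"
    and Cau: "\<And>e. e > 0 \<Longrightarrow> \<exists>N. \<forall>m\<ge>N. \<forall>n\<ge>N. Re (Hip (\<lambda>i. X m i - X n i) (\<lambda>i. X m i - X n i)) < e"
  shows "\<exists>h\<in>Hspace. (\<lambda>n. Hip (\<lambda>i. X n i - h i) (\<lambda>i. X n i - h i)) \<longlonglongrightarrow> 0"
proof -
  have "\<forall>n. \<exists>b. represents b (X n)" using X by (simp add: Hspace_def)
  then obtain b where b: "\<And>n. represents (b n) (X n)" by metis
  have "\<exists>N. \<forall>k\<ge>N. sn (b m k - b m N) < 1 / real (Suc m)" for m
  proof -
    have "0 < 1 / real (Suc m)" by simp
    with b[of m] obtain N where "\<forall>j\<ge>N. \<forall>k\<ge>N. sn (b m j - b m k) < 1 / real (Suc m)"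
      unfolding represents_def sn_Cauchy_def by blast
    then show ?thesis by blast
  qed
  then obtain N where N: "\<And>m k. k \<ge> N m \<Longrightarrow> sn (b m k - b m (N m)) < 1 / real (Suc m)" by metis
  define c where "c m = b m (N m)" for m
  have Cauchy_bound: "\<exists>M. \<forall>m\<ge>M. \<forall>n\<ge>M. sn (c m - c n) < e" if e: "e > 0" for e
  proof -
    have "(e/3)\<^sup>2 > 0" using e by simp
    then obtain M where M: "\<And>m n. m \<ge> M \<Longrightarrow> n \<ge> M \<Longrightarrow> Re (Hip (\<lambda>i. X m i - X n i) (\<lambda>i. X m i - X n i)) < (e/3)\<^sup>2"
      using Cau by blast
    obtain L where L: "1 / real (Suc L) < e / 3" using e nat_approx_posE[of "e/3"] by auto
    have "sn (c m - c n) < e" if mn: "m \<ge> max L M" "n \<ge> max L M" for m n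
    proof -
      have "\<forall>\<^sub>F k in sequentially. (sn (b m k - b n k))\<^sup>2 < (e/3)\<^sup>2"
        using sn_tendsto[OF represents_diff[OF b[of m] b[of n]]] M[of m n] mn by (intro order_tendstoD(2)) auto
      then have "\<forall>\<^sub>F k in sequentially. (sn (b m k - b n k))\<^sup>2 < (e/3)\<^sup>2 \<and> k \<ge> max (N m) (N n)"
        by (intro eventually_conj eventually_ge_at_top)
      \<comment> \<open>One index late enough for both tails and for the difference of the two
        sequences to be close to its limit.\<close>
      then obtain k where k: "(sn (b m k - b n k))\<^sup>2 < (e/3)\<^sup>2" "k \<ge> max (N m) (N n)"
        using eventually_happens'[OF sequentially_bot] by blast
      have 1: "sn (b m k - b n k) < e/3" using e by (intro power_less_imp_less_base[OF k(1)]) simp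
      have "1 / real (Suc m) \<le> 1 / real (Suc L)" "1 / real (Suc n) \<le> 1 / real (Suc L)"
        using mn by (auto intro!: divide_left_mono)
      then have "sn (b m k - c m) < e / 3" "sn (b n k - c n) < e / 3"
        using N[of m k] N[of n k] k(2) L by (auto simp: c_def)
      moreover have "sn (c m - c n) \<le> sn (c m - b m k) + (sn (b m k - b n k) + sn (b n k - c n))"
        using sn_triangle_diff[of "c m" "c n" "b m k"] sn_triangle_diff[of "b m k" "c n" "b n k"] by linarith
      ultimately show ?thesis using 1 sn_minus_commute[of "c m" "b m k"] by simp
    qed
    then show ?thesis by blast
  qed
  then have cc: "sn_Cauchy c" unfolding sn_Cauchy_def by blast
  define h where "h a = lim (\<lambda>n. ip a (c n))" for a
  have h: "represents c h"
    unfolding represents_def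
  proof (intro conjI allI cc)
    fix a
    have "sn_Cauchy (\<lambda>n. a)" by (simp add: sn_Cauchy_def sn_zero)
    then show "(\<lambda>n. ip a (c n)) \<longlonglongrightarrow> h a"
      using ip_convergent[OF _ cc, of "\<lambda>n. a"] unfolding h_def by (simp add: convergent_LIMSEQ_iff)
  qed
  have lim: "(\<lambda>n. Hip (\<lambda>i. X n i - h i) (\<lambda>i. X n i - h i)) \<longlonglongrightarrow> 0"
  proof (rule LIMSEQ_I)
    fix e :: real assume e: "e > 0"
    \<comment> \<open>Chosen so that \<open>(2 * d)\<^sup>2 = e / 2\<close>; the bound in the limit
      then stays strictly below \<open>e\<close>.\<close>
    define d where "d = sqrt (e / 2) / 2"
    have d: "d > 0" using e by (simp add: d_def)
    obtain M where M: "\<And>m n. m \<ge> M \<Longrightarrow> n \<ge> M \<Longrightarrow> sn (c m - c n) < d" using Cauchy_bound[OF d] by blast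
    obtain L where L: "1 / real (Suc L) < d" using nat_approx_posE[OF d] by auto
    have "cmod (Hip (\<lambda>i. X n i - h i) (\<lambda>i. X n i - h i)) < e" if n: "n \<ge> max L M" for n
    proof -
      note rd = represents_diff[OF b[of n] h]
      have "(sn (b n k - c k))\<^sup>2 \<le> e / 2" if k: "k \<ge> max M (N n)" for k
      proof -
        have "1 / real (Suc n) \<le> 1 / real (Suc L)" using n by (auto intro!: divide_left_mono)
        then have "sn (b n k - c n) < d" using N[of n k] k L by (auto simp: c_def)
        moreover have "sn (c n - c k) < d" using M n k by simp
        ultimately have "sn (b n k - c k) \<le> 2 * d" using sn_triangle_diff[of "b n k" "c k" "c n"] by simp
        then have "(sn (b n k - c k))\<^sup>2 \<le> (2 * d)\<^sup>2" by (intro power_mono) (auto simp: sn_nonneg)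
        also have "\<dots> = e / 2" using e by (simp add: d_def)
        finally show ?thesis .
      qed
      then have "Re (Hip (\<lambda>i. X n i - h i) (\<lambda>i. X n i - h i)) \<le> e / 2"
        by (intro LIMSEQ_le_const2[OF sn_tendsto[OF rd]]) blast
      moreover have "Hip (\<lambda>i. X n i - h i) (\<lambda>i. X n i - h i) \<in> \<real>\<^sub>\<ge>\<^sub>0"
      proof -
        have "(\<lambda>k. ip (b n k - c k) (b n k - c k)) \<longlonglongrightarrow> Hip (\<lambda>i. X n i - h i) (\<lambda>i. X n i - h i)"
          by (rule Hip_tendsto[OF rd rd])
        then show ?thesis
          by (rule closed_sequentially[OF closed_nonneg_Reals_complex, rotated]) (use nonneg in auto)
      qed
      ultimately show ?thesis using e by (auto simp: complex_nonneg_Reals_iff cmod_eq_Re)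
    qed
    then show "\<exists>N. \<forall>n\<ge>N. norm (Hip (\<lambda>i. X n i - h i) (\<lambda>i. X n i - h i) - 0) < e"
      by (intro exI[of _ "max L M"]) simp
  qed
  show ?thesis using lim represents_in[OF h] by blast
qed

lemma hilbert: "hilbert_space Hspace Hip"
proof
  show "(\<lambda>i. 0) \<in> Hspace" using represents_in[OF represents_vec[of 0]] clinear_zero[OF clin] by (simp add: vec_def)
  fix h k l c assume "h \<in> Hspace" "k \<in> Hspace" "l \<in> Hspace"
  then obtain b b' b'' where b: "represents b h" "represents b' k" "represents b'' l" by (meson Hspace_cases)
  show "(\<lambda>i. h i + k i) \<in> Hspace" by (rule represents_in[OF represents_add[OF b(1,2)]])
  have "(\<lambda>n. ip (b n) (b' n) + ip (b n) (b'' n)) \<longlonglongrightarrow> Hip h (\<lambda>i. k i + l i)"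
    using Hip_tendsto[OF b(1) represents_add[OF b(2,3)]] by (simp add: add_right)
  then show "Hip h (\<lambda>i. k i + l i) = Hip h k + Hip h l"
    using LIMSEQ_unique tendsto_add[OF Hip_tendsto[OF b(1,2)] Hip_tendsto[OF b(1,3)]] by blast
next
  fix h c assume "h \<in> Hspace"
  then obtain b where b: "represents b h" by (meson Hspace_cases)
  show "(\<lambda>i. c * h i) \<in> Hspace" by (rule represents_in[OF represents_scale[OF b]])
  show "Hip h h \<in> \<real>\<^sub>\<ge>\<^sub>0"
    by (rule closed_sequentially[OF closed_nonneg_Reals_complex _ Hip_tendsto[OF b b]]) (use nonneg in auto)
next
  fix h k c assume "h \<in> Hspace" "k \<in> Hspace"
  then obtain b b' where b: "represents b h" "represents b' k" by (meson Hspace_cases)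
  have "(\<lambda>n. c * ip (b n) (b' n)) \<longlonglongrightarrow> Hip h (\<lambda>i. c * k i)"
    using Hip_tendsto[OF b(1) represents_scale[OF b(2)], of c] by (simp add: scale_right)
  then show "Hip h (\<lambda>i. c * k i) = c * Hip h k"
    using LIMSEQ_unique tendsto_mult_left[OF Hip_tendsto[OF b]] by blast
  have "(\<lambda>n. cnj (ip (b n) (b' n))) \<longlonglongrightarrow> Hip k h"
    using Hip_tendsto[OF b(2,1)] hermitian[of "b _" "b' _"] by simp
  then show "Hip k h = cnj (Hip h k)"
    using LIMSEQ_unique tendsto_cnj[OF Hip_tendsto[OF b]] by blast
next
  fix h assume "h \<in> Hspace" "Hip h h = 0"
  then obtain b where b: "represents b h" by (meson Hspace_cases)
  have "(\<lambda>n. (sn (b n))\<^sup>2) \<longlonglongrightarrow> 0" using sn_tendsto[OF b] \<open>Hip h h = 0\<close> by simp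
  then have "(\<lambda>n. sqrt ((sn (b n))\<^sup>2)) \<longlonglongrightarrow> sqrt 0" by (rule tendsto_real_sqrt)
  then have sn0: "(\<lambda>n. sn (b n)) \<longlonglongrightarrow> 0" by (simp add: sn_nonneg)
  have "h a = 0" for a
  proof -
    have "(\<lambda>n. sn a * sn (b n)) \<longlonglongrightarrow> 0" using tendsto_mult_left[OF sn0, of "sn a"] by simp
    then have "(\<lambda>n. ip a (b n)) \<longlonglongrightarrow> 0"
      by (rule Lim_null_comparison[rotated]) (simp add: Cauchy_Schwarz)
    then show ?thesis using representsD[OF b, of a] LIMSEQ_unique by blast
  qed
  then show "h = (\<lambda>i. 0)" by blast
qed (rule complete)

text \<open>\<open>act x h\<close> evaluates \<open>h\<close> at \<open>star x * a\<close>, so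
  antilinearity of the vectors is what makes the action linear in \<open>x\<close>.\<close>

lemma Hspace_antilinear:
  assumes "h \<in> Hspace" shows "h (x + y) = h x + h y" "h (c *\<^sub>C x) = cnj c * h x"
proof -
  obtain b where b: "represents b h" using assms by (rule Hspace_cases)
  have "(\<lambda>n. ip x (b n) + ip y (b n)) \<longlonglongrightarrow> h (x + y)" using representsD[OF b, of "x + y"] by (simp add: add_left)
  then show "h (x + y) = h x + h y" using tendsto_add[OF representsD[OF b] representsD[OF b]] LIMSEQ_unique by blast
  have "(\<lambda>n. cnj c * ip x (b n)) \<longlonglongrightarrow> h (c *\<^sub>C x)" using representsD[OF b, of "c *\<^sub>C x"] by (simp add: scale_left)
  then show "h (c *\<^sub>C x) = cnj c * h x" using tendsto_mult_left[OF representsD[OF b]] LIMSEQ_unique by blast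
qed

lemma representation: "representation Hspace Hip act"
proof (intro representation.intro hilbert representation_axioms.intro)
  show "act a h \<in> Hspace" if "h \<in> Hspace" for a h
    using that represents_act represents_in by (meson Hspace_cases)
  show "\<exists>C. \<forall>h\<in>Hspace. Re (Hip (act a h) (act a h)) \<le> C * Re (Hip h h)" for a
  proof (intro exI ballI)
    fix h assume "h \<in> Hspace"
    then obtain b where b: "represents b h" by (rule Hspace_cases)
    have "(sn (a * b n))\<^sup>2 \<le> (norm a)\<^sup>2 * (sn (b n))\<^sup>2" for n
      using power_mono[OF sn_mult[of a "b n"], of 2] sn_nonneg by (simp add: power_mult_distrib)
    then show "Re (Hip (act a h) (act a h)) \<le> (norm a)\<^sup>2 * Re (Hip h h)"
      by (intro LIMSEQ_le[OF sn_tendsto[OF represents_act[OF b]] tendsto_mult_left[OF sn_tendsto[OF b]]]) blast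
  qed
  show "Hip (act (star a) h) k = Hip h (act a k)" if "h \<in> Hspace" "k \<in> Hspace" for a h k
  proof -
    obtain b c where b: "represents b h" "represents c k" using \<open>h \<in> Hspace\<close> \<open>k \<in> Hspace\<close> by (meson Hspace_cases)
    show ?thesis
      using Hip_tendsto[OF represents_act[OF b(1)] b(2), of "star a"] Hip_tendsto[OF b(1) represents_act[OF b(2)], of a]
      unfolding star_mult star_star mult.assoc by (rule LIMSEQ_unique)
  qed
qed (simp_all add: act_def star_add star_scaleC star_mult distrib_right mult_scaleC_left mult.assoc Hspace_antilinear)

end

section \<open>Positive semidefinite kernels\<close>

text \<open>Membership in the nonnegative reals also says that the form is real; Hermitian symmetry
  of the kernel is derived from this.\<close>

definition psd :: "'i set \<Rightarrow> ('i \<Rightarrow> 'i \<Rightarrow> complex) \<Rightarrow> bool"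
  where "psd I K \<longleftrightarrow> (\<forall>c. (\<Sum>i\<in>I. \<Sum>j\<in>I. cnj (c i) * c j * K i j) \<in> \<real>\<^sub>\<ge>\<^sub>0)"

lemma nonneg_Reals_sum: "(\<And>i. i \<in> I \<Longrightarrow> h i \<in> \<real>\<^sub>\<ge>\<^sub>0) \<Longrightarrow> sum h I \<in> (\<real>\<^sub>\<ge>\<^sub>0 :: complex set)"
  by (induction I rule: infinite_finite_induct) auto

text \<open>One step of Cholesky elimination; the first claim concerns the Schur complement. Fixing
  the coefficients on \<open>I\<close> and varying the one at \<open>m\<close> leaves a form in two
  variables, to which \<open>psd_two_by_two\<close> applies. If the pivot \<open>K m m\<close> is
  zero, then row \<open>m\<close> vanishes, so the value 0 of the division does no harm.\<close>

lemma psd_insert: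
  assumes I: "finite I" "m \<notin> I" and K: "psd (insert m I) K"
  shows "psd I (\<lambda>i j. K i j - K i m * K m j / K m m)"
    and "\<And>j. j \<in> I \<Longrightarrow> K j m = cnj (K m j)"
    and "\<And>j. j \<in> I \<Longrightarrow> K m m = 0 \<Longrightarrow> K m j = 0" and "K m m \<in> \<real>\<^sub>\<ge>\<^sub>0"
proof -
  define A where "A c = (\<Sum>i\<in>I. \<Sum>j\<in>I. cnj (c i) * c j * K i j)" for c
  define C where "C c = (\<Sum>i\<in>I. cnj (c i) * K i m)" for c
  define C' where "C' c = (\<Sum>j\<in>I. c j * K m j)" for c
  have "A c + t * C c + cnj t * C' c + cnj t * t * K m m \<in> \<real>\<^sub>\<ge>\<^sub>0" for c t
  proof -
    define d where "d = c(m := t)"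
    have dI: "i \<in> I \<Longrightarrow> d i = c i" for i using I by (auto simp: d_def)
    have "(\<Sum>i\<in>insert m I. \<Sum>j\<in>insert m I. cnj (d i) * d j * K i j) \<in> \<real>\<^sub>\<ge>\<^sub>0"
      using K unfolding psd_def by (rule spec)
    also have "(\<Sum>i\<in>insert m I. \<Sum>j\<in>insert m I. cnj (d i) * d j * K i j)
        = cnj t * t * K m m + (\<Sum>j\<in>I. cnj t * c j * K m j) + (\<Sum>i\<in>I. cnj (c i) * t * K i m + (\<Sum>j\<in>I. cnj (c i) * c j * K i j))"
      using I by (simp add: dI) (simp add: d_def)
    also have "\<dots> = A c + t * C c + cnj t * C' c + cnj t * t * K m m"
      by (simp add: A_def C_def C'_def sum.distrib sum_distrib_left algebra_simps)
    finally show ?thesis .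
  qed
  note two = psd_two_by_two[OF this]
  have A0: "A c \<in> \<real>\<^sub>\<ge>\<^sub>0" for c
    using \<open>\<And>t c. A c + t * C c + cnj t * C' c + cnj t * t * K m m \<in> \<real>\<^sub>\<ge>\<^sub>0\<close>[of c 0] by simp
  show K0: "K m m \<in> \<real>\<^sub>\<ge>\<^sub>0"
    using \<open>\<And>t c. A c + t * C c + cnj t * C' c + cnj t * t * K m m \<in> \<real>\<^sub>\<ge>\<^sub>0\<close>[of "\<lambda>_. 0" 1]
    by (simp add: A_def C_def C'_def)
  have single: "C (\<lambda>i. if i = j then 1 else 0) = K j m" "C' (\<lambda>i. if i = j then 1 else 0) = K m j" if "j \<in> I" for j
  proof -
    have "C (\<lambda>i. if i = j then 1 else 0) = (\<Sum>i\<in>I. if i = j then K i m else 0)"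
      unfolding C_def by (intro sum.cong) auto
    then show "C (\<lambda>i. if i = j then 1 else 0) = K j m" using I that by simp
    have "C' (\<lambda>i. if i = j then 1 else 0) = (\<Sum>i\<in>I. if i = j then K m i else 0)"
      unfolding C'_def by (intro sum.cong) auto
    then show "C' (\<lambda>i. if i = j then 1 else 0) = K m j" using I that by simp
  qed
  show herm: "K j m = cnj (K m j)" if "j \<in> I" for j
    using two(1)[of "\<lambda>i. if i = j then 1 else 0"] single[OF that] by simp
  show "K m j = 0" if "j \<in> I" "K m m = 0" for j
    using two(2)[of "\<lambda>i. if i = j then 1 else 0"] single[OF that(1)] that(2) herm[OF that(1)] by simp
  show "psd I (\<lambda>i j. K i j - K i m * K m j / K m m)"
    unfolding psd_def
  proof
    fix c
    have "(\<Sum>i\<in>I. \<Sum>j\<in>I. cnj (c i) * c j * (K i j - K i m * K m j / K m m)) = A c - C c * C' c / K m m"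
      by (simp add: A_def C_def C'_def sum_product sum_divide_distrib algebra_simps sum_subtractf, rule sum.swap)
    also have "C c * C' c = of_real ((cmod (C c))\<^sup>2)" unfolding two(1)[of c] complex_norm_square ..
    also have "A c - of_real ((cmod (C c))\<^sup>2) / K m m = of_real (Re (A c) - (cmod (C c))\<^sup>2 / Re (K m m))"
      using A0[of c] K0 by (auto simp: complex_nonneg_Reals_iff complex_eq_iff Re_divide Im_divide power2_eq_square)
    also have "\<dots> \<in> \<real>\<^sub>\<ge>\<^sub>0"
    proof -
      have "(cmod (C c))\<^sup>2 / Re (K m m) \<le> Re (A c)"
        using two(2)[of c] K0 A0[of c] by (cases "Re (K m m) = 0") (auto simp: complex_nonneg_Reals_iff field_simps)
      then show ?thesis by (simp only: nonneg_Reals_of_real_iff diff_ge_0_iff_ge)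
    qed
    finally show "(\<Sum>i\<in>I. \<Sum>j\<in>I. cnj (c i) * c j * (K i j - K i m * K m j / K m m)) \<in> \<real>\<^sub>\<ge>\<^sub>0" .
  qed
qed

text \<open>Cholesky factorisation by induction: Gram vectors of the Schur complement are extended
  by one coordinate that carries the pivot row.\<close>

lemma psd_gram:
  assumes "finite I" "psd I K"
  shows "\<exists>(n::nat) v. \<forall>i\<in>I. \<forall>j\<in>I. K i j = (\<Sum>k<n. cnj (v k i) * v k j)"
  using assms
proof (induction I arbitrary: K rule: finite_induct)
  case empty
  then show ?case by simp
next
  case (insert m I)
  note ins = psd_insert[OF insert.hyps(1,2) insert.prems]
  obtain n v where v: "\<And>i j. i \<in> I \<Longrightarrow> j \<in> I \<Longrightarrow> K i j - K i m * K m j / K m m = (\<Sum>k<(n::nat). cnj (v k i) * v k j)"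
    using insert.IH[OF ins(1)] by metis
  define r where "r = Re (K m m)"
  have r: "r \<ge> 0" "K m m = of_real r" using ins(4) by (auto simp: r_def complex_nonneg_Reals_iff complex_eq_iff)
  \<comment> \<open>Coordinate \<open>n\<close> is the new one; the old coordinates are zero at
    \<open>m\<close>. For \<open>r = 0\<close> the quotient is 0, in accordance with the vanishing
    row.\<close>
  define w where "w k j = (if k = n then K m j / of_real (sqrt r) else if j = m then 0 else v k j)" for k j
  have sq: "of_real (sqrt r) * of_real (sqrt r) = (of_real r :: complex)" using r by (metis of_real_mult real_sqrt_mult_self abs_of_nonneg)
  have Kmm: "cnj (K m j) = K j m" if "j \<in> insert m I" for j using that ins(2) r(2) by auto
  have zero: "K m j = 0" if "j \<in> insert m I" "r = 0" for j using that ins(3) r(2) by auto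
  have "K i j = (\<Sum>k<Suc n. cnj (w k i) * w k j)" if ij: "i \<in> insert m I" "j \<in> insert m I" for i j
  proof -
    have last: "cnj (w n i) * w n j = K i m * K m j / K m m"
      using sq Kmm[OF ij(1)] by (simp add: w_def r(2))
    have "(\<Sum>k<n. cnj (w k i) * w k j) = K i j - K i m * K m j / K m m"
    proof (cases "i = m \<or> j = m")
      case True
      have "(\<Sum>k<n. cnj (w k i) * w k j) = 0" using True by (intro sum.neutral) (auto simp: w_def)
      moreover have "K i j - K i m * K m j / K m m = 0"
        using True zero[OF ij(1)] zero[OF ij(2)] Kmm[OF ij(1)] Kmm[OF ij(2)] r by (cases "r = 0") auto
      ultimately show ?thesis by simp
    next
      case False
      then have "(\<Sum>k<n. cnj (w k i) * w k j) = (\<Sum>k<n. cnj (v k i) * v k j)"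
        by (intro sum.cong) (auto simp: w_def)
      then show ?thesis using v False ij by simp
    qed
    then show ?thesis using last by simp
  qed
  then show ?case by metis
qed

text \<open>Schur product theorem. Writing \<open>K\<close> as a Gram kernel splits the form of the
  product into forms of \<open>L\<close> at the vectors \<open>c i * v k i\<close>, one for each
  \<open>k\<close>.\<close>

lemma psd_mult:
  assumes I: "finite I" and K: "psd I K" and L: "psd I L"
  shows "psd I (\<lambda>i j. K i j * L i j)"
proof -
  obtain n and v :: "nat \<Rightarrow> 'a \<Rightarrow> complex"
    where v: "\<And>i j. i \<in> I \<Longrightarrow> j \<in> I \<Longrightarrow> K i j = (\<Sum>k<n. cnj (v k i) * v k j)"
    using psd_gram[OF I K] by metis
  show ?thesis
    unfolding psd_def
  proof
    fix c
    have "(\<Sum>i\<in>I. \<Sum>j\<in>I. cnj (c i) * c j * (K i j * L i j))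
        = (\<Sum>i\<in>I. \<Sum>j\<in>I. \<Sum>k<n. cnj (c i * v k i) * (c j * v k j) * L i j)"
      by (intro sum.cong refl) (simp add: v sum_distrib_left sum_distrib_right mult_ac)
    also have "\<dots> = (\<Sum>i\<in>I. \<Sum>k<n. \<Sum>j\<in>I. cnj (c i * v k i) * (c j * v k j) * L i j)"
      by (rule sum.cong[OF refl]) (rule sum.swap)
    also have "\<dots> = (\<Sum>k<n. \<Sum>i\<in>I. \<Sum>j\<in>I. cnj (c i * v k i) * (c j * v k j) * L i j)"
      by (rule sum.swap)
    also have "\<dots> \<in> \<real>\<^sub>\<ge>\<^sub>0" by (rule nonneg_Reals_sum) (use L in \<open>simp only: psd_def\<close>)
    finally show "(\<Sum>i\<in>I. \<Sum>j\<in>I. cnj (c i) * c j * (K i j * L i j)) \<in> \<real>\<^sub>\<ge>\<^sub>0" .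
  qed
qed

lemma psd_sum_nonneg: "psd I K \<Longrightarrow> (\<Sum>i\<in>I. \<Sum>j\<in>I. K i j) \<in> \<real>\<^sub>\<ge>\<^sub>0"
  unfolding psd_def by (drule spec[of _ "\<lambda>_. 1"]) simp

lemma clinear_double_sum:
  assumes "clinear f"
  shows "f (star (\<Sum>i\<in>I. c i *\<^sub>C a i) * (\<Sum>j\<in>J. d j *\<^sub>C b j)) = (\<Sum>i\<in>I. \<Sum>j\<in>J. cnj (c i) * d j * (f (star (a i) * b j) :: complex))"
  by (simp add: star_sum star_scaleC sum_product mult_scaleC_left mult_scaleC_right scaleC_scaleC
      clinear_sum[OF assms] clinear_scale[OF assms] mult_ac)

lemma psd_pos_functional:
  assumes "pos_functional f" shows "psd I (\<lambda>i j. f (star (a i) * a j))"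
  unfolding psd_def
proof
  fix c
  have lin: "clinear f" using assms by (simp add: pos_functional_def)
  have "f (star (\<Sum>i\<in>I. c i *\<^sub>C a i) * (\<Sum>j\<in>I. c j *\<^sub>C a j)) \<in> \<real>\<^sub>\<ge>\<^sub>0"
    using assms unfolding pos_functional_def by blast
  then show "(\<Sum>i\<in>I. \<Sum>j\<in>I. cnj (c i) * c j * f (star (a i) * a j)) \<in> \<real>\<^sub>\<ge>\<^sub>0"
    by (simp only: clinear_double_sum[OF lin])
qed

lemma product_functional_nonneg:
  assumes "finite I" "pos_functional \<phi>" "pos_functional \<psi>"
  shows "(\<Sum>i\<in>I. \<Sum>j\<in>I. \<phi> (star (a i) * a j) * \<psi> (star (b i) * b j)) \<in> \<real>\<^sub>\<ge>\<^sub>0"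
  by (intro psd_sum_nonneg psd_mult psd_pos_functional assms)

text \<open>Positivity of \<open>\<phi> \<otimes> \<psi>\<close> at \<open>c\<close> times the
  tensor plus the unit, combined with \<open>psd_two_by_two\<close>. Only finite families occur,
  because no tensor product is fixed here.\<close>

lemma product_functional_Cauchy_Schwarz:
  assumes \<phi>: "pos_functional \<phi>" and \<psi>: "pos_functional \<psi>"
  shows "(cmod (\<Sum>i<n. \<phi> (a i) * \<psi> (b i)))\<^sup>2 \<le>
    Re (\<phi> 1 * \<psi> 1) * Re (\<Sum>i<(n::nat). \<Sum>j<n. \<phi> (star (a i) * a j) * \<psi> (star (b i) * b j))"
proof -
  let ?Q = "\<Sum>i<n. \<Sum>j<n. \<phi> (star (a i) * a j) * \<psi> (star (b i) * b j)"
  let ?C = "\<Sum>i<n. \<phi> (a i) * \<psi> (b i)"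
  let ?C' = "\<Sum>i<n. \<phi> (star (a i)) * \<psi> (star (b i))"
  have lin: "clinear \<phi>" "clinear \<psi>" using \<phi> \<psi> by (auto simp: pos_functional_def)
  have "\<phi> 1 * \<psi> 1 + c * ?C + cnj c * ?C' + cnj c * c * ?Q \<in> \<real>\<^sub>\<ge>\<^sub>0" for c
  proof -
    \<comment> \<open>Index \<open>n\<close> is the additional summand for the unit; the scalar goes
      to the left factors only.\<close>
    define a' where "a' i = (if i < n then c *\<^sub>C a i else 1)" for i
    define b' where "b' i = (if i < n then b i else 1)" for i
    have "(\<Sum>i<Suc n. \<Sum>j<Suc n. \<phi> (star (a' i) * a' j) * \<psi> (star (b' i) * b' j)) \<in> \<real>\<^sub>\<ge>\<^sub>0"
      by (rule product_functional_nonneg[OF _ \<phi> \<psi>]) simp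
    also have "(\<Sum>i<Suc n. \<Sum>j<Suc n. \<phi> (star (a' i) * a' j) * \<psi> (star (b' i) * b' j))
        = (\<Sum>i<n. (\<Sum>j<n. \<phi> (star (a' i) * a' j) * \<psi> (star (b' i) * b' j)) + \<phi> (star (a' i)) * \<psi> (star (b' i)))
          + ((\<Sum>j<n. \<phi> (a' j) * \<psi> (b' j)) + \<phi> 1 * \<psi> 1)"
      by (simp add: a'_def b'_def)
    also have "\<dots> = (\<Sum>i<n. (\<Sum>j<n. cnj c * c * (\<phi> (star (a i) * a j) * \<psi> (star (b i) * b j))) + cnj c * (\<phi> (star (a i)) * \<psi> (star (b i))))
          + ((\<Sum>j<n. c * (\<phi> (a j) * \<psi> (b j))) + \<phi> 1 * \<psi> 1)"
      by (simp add: a'_def b'_def star_scaleC mult_scaleC_left mult_scaleC_right scaleC_scaleC clinear_scale[OF lin(1)] mult_ac)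
    also have "\<dots> = \<phi> 1 * \<psi> 1 + c * ?C + cnj c * ?C' + cnj c * c * ?Q"
      by (simp add: sum.distrib sum_distrib_left algebra_simps)
    finally show ?thesis .
  qed
  from psd_two_by_two(2)[OF this] show ?thesis .
qed

subsection \<open>States determine the norm\<close>

lemma pos_functional_star:
  assumes "pos_functional \<psi>" shows "\<psi> (star x) = cnj (\<psi> x)"
proof -
  interpret pos_functional_on UNIV \<psi> by (rule pos_functional_on_UNIV[OF assms])
  show ?thesis using hermitian[of 1 x] by simp
qed

text \<open>A state norming \<open>norm b + b\<close> shows that the norm of this element is at most
  \<open>norm b + K\<close>, which makes \<open>K - b\<close> positive. Using this for
  \<open>a\<close> and \<open>- a\<close> and multiplying the commuting elements
  \<open>K - a\<close> and \<open>K + a\<close> bounds \<open>a * a\<close>.\<close>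

lemma norm_selfadjoint_le_of_states:
  fixes a :: "'a::cstar_algebra"
  assumes a: "star a = a" and K: "\<And>\<psi>. state \<psi> \<Longrightarrow> cmod (\<psi> a) \<le> K"
  shows "norm a \<le> K"
proof -
  have pos: "pos_elem (of_real K - b)" if b: "star b = b" "\<And>\<psi>. state \<psi> \<Longrightarrow> cmod (\<psi> b) \<le> K" for b :: 'a
  proof -
    let ?p = "of_real (norm b) + b"
    obtain \<psi> where \<psi>: "state \<psi>" "\<psi> ?p = of_real (norm ?p)"
      using norming_state[OF positive_norm_plus[OF b(1)]] by blast
    have "\<psi> ?p = of_real (norm b) + \<psi> b"
      using \<psi>(1) by (simp add: state_def clinear_add clinear_of_real)
    then have "norm ?p \<le> norm b + K"
      using b(2)[OF \<psi>(1)] \<psi>(2) complex_Re_le_cmod[of "\<psi> b"] by (metis Re_complex_of_real plus_complex.simps(1) add_left_mono order_trans)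
    then have "pos_elem (of_real (norm b + K - norm ?p) + (of_real (norm ?p) - ?p))"
      using b(1) by (intro positive_add positive_of_real positive_norm_minus) (auto simp: star_add)
    then show ?thesis by (simp add: algebra_simps)
  qed
  have p1: "pos_elem (of_real K - a)" using a K by (rule pos)
  have p2: "pos_elem (of_real K - - a)"
    by (rule pos) (use a K in \<open>auto simp: state_def clinear_minus\<close>)
  have "pos_elem ((of_real K - a) * (of_real K - - a))"
    by (intro positive_mult_commute p1 p2) (simp add: algebra_simps of_real_def)
  moreover have "(of_real K - a) * (of_real K - - a) = of_real (K\<^sup>2) - a * a"
    by (simp add: algebra_simps of_real_def power2_eq_square)
  ultimately have "norm (a * a) \<le> K\<^sup>2"
    using positive_square[OF a] by (intro norm_le_of_positive) auto
  moreover have "K \<ge> 0"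
  proof -
    obtain \<psi> :: "'a \<Rightarrow> complex" where "state \<psi>" using norming_state[OF positive_of_real[of 1]] by auto
    then show ?thesis using K norm_ge_zero order_trans by blast
  qed
  ultimately show ?thesis using a by (simp add: norm_square_selfadjoint power2_le_iff_abs_le)
qed

text \<open>The factor 2 comes from estimating real and imaginary part separately; it is harmless,
  as the bound only has to make the slice maps continuous.\<close>

lemma norm_le_of_states:
  fixes y :: "'a::cstar_algebra"
  assumes K: "\<And>\<psi>. state \<psi> \<Longrightarrow> cmod (\<psi> y) \<le> K"
  shows "norm y \<le> 2 * K"
proof -
  have re: "cmod (\<psi> (re_part y)) \<le> K" and im: "cmod (\<psi> (im_part y)) \<le> K" if \<psi>: "state \<psi>" for \<psi>
  proof -
    have pf: "pos_functional \<psi>" and lin: "clinear \<psi>" using \<psi> by (auto simp: state_iff pos_functional_def)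
    have s: "cmod (\<psi> (star y)) \<le> K" using K[OF \<psi>] by (simp add: pos_functional_star[OF pf])
    have "\<psi> (re_part y) = (1/2) * (\<psi> y + \<psi> (star y))"
      by (simp add: re_part_def scaleR_conv_scaleC clinear_scale[OF lin] clinear_add[OF lin])
    then have "cmod (\<psi> (re_part y)) = (1/2) * cmod (\<psi> y + \<psi> (star y))" by (simp only: norm_mult) simp
    then show "cmod (\<psi> (re_part y)) \<le> K" using norm_triangle_ineq[of "\<psi> y" "\<psi> (star y)"] s K[OF \<psi>] by simp
    have "\<psi> (im_part y) = (- \<i> / 2) * (\<psi> y - \<psi> (star y))"
      unfolding im_part_def by (simp only: clinear_scale[OF lin] clinear_diff[OF lin] scaleC_complex)
    then have "cmod (\<psi> (im_part y)) = (1/2) * cmod (\<psi> y - \<psi> (star y))" by (simp add: norm_mult)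
    then show "cmod (\<psi> (im_part y)) \<le> K" using norm_triangle_ineq4[of "\<psi> y" "\<psi> (star y)"] s K[OF \<psi>] by simp
  qed
  have "norm (re_part y) \<le> K" using re_part_selfadjoint re by (rule norm_selfadjoint_le_of_states)
  moreover have "norm (im_part y) \<le> K" using im_part_selfadjoint im by (rule norm_selfadjoint_le_of_states)
  ultimately show ?thesis
    using norm_triangle_ineq[of "re_part y" "\<i> *\<^sub>C im_part y"] unfolding re_im_part[of y, symmetric]
    by (simp add: norm_scaleC)
qed

section \<open>Bilinear maps on tensor products\<close>

definition cbilinear :: "('a::cstar_algebra \<Rightarrow> 'b::cstar_algebra \<Rightarrow> 'c::cstar_algebra) \<Rightarrow> bool"
  where "cbilinear \<tau> \<longleftrightarrow> (\<forall>b. clinear (\<lambda>a. \<tau> a b)) \<and> (\<forall>a. clinear (\<tau> a))"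

definition tspan :: "('a::cstar_algebra \<Rightarrow> 'b::cstar_algebra \<Rightarrow> 'c::cstar_algebra) \<Rightarrow> 'c set"
  where "tspan \<tau> = cspan {\<tau> a b |a b. True}"

lemma csubspace_tspan: "csubspace (tspan \<tau>)"
  unfolding tspan_def by (rule complex_vector.subspace_span)

lemmas tspan_add = complex_vector.subspace_add[OF csubspace_tspan]
lemmas tspan_scale = complex_vector.subspace_scale[OF csubspace_tspan]
lemmas tspan_zero = complex_vector.subspace_0[OF csubspace_tspan]
lemmas tspan_diff = complex_vector.subspace_diff[OF csubspace_tspan]
lemmas tspan_sum = complex_vector.subspace_sum[OF csubspace_tspan]

lemma cbilinear_scale_left: "cbilinear \<tau> \<Longrightarrow> \<tau> (c *\<^sub>C a) b = c *\<^sub>C \<tau> a b"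
  and cbilinear_scale_right: "cbilinear \<tau> \<Longrightarrow> \<tau> a (c *\<^sub>C b) = c *\<^sub>C \<tau> a b"
  and cbilinear_sum_left: "cbilinear \<tau> \<Longrightarrow> \<tau> (sum h I) b = (\<Sum>i\<in>I. \<tau> (h i) b)"
  and cbilinear_sum_right: "cbilinear \<tau> \<Longrightarrow> \<tau> a (sum k I) = (\<Sum>i\<in>I. \<tau> a (k i))"
  unfolding cbilinear_def
  using clinear_scale[of "\<lambda>a. \<tau> a b" c a] clinear_scale[of "\<tau> a" c b]
    clinear_sum[of "\<lambda>a. \<tau> a b" h I] clinear_sum[of "\<tau> a" k I] by auto

lemma cbilinear_clinear_left: "cbilinear \<tau> \<Longrightarrow> clinear (\<lambda>a. \<tau> a b)"
  and cbilinear_clinear_right: "cbilinear \<tau> \<Longrightarrow> clinear (\<tau> a)"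
  by (simp_all add: cbilinear_def)

lemma cbilinear_compose:
  assumes "cbilinear \<tau>" "clinear f" "clinear g" shows "cbilinear (\<lambda>a b. \<tau> (f a) (g b))"
  unfolding cbilinear_def
  using clinear_compose[OF assms(2) cbilinear_clinear_left[OF assms(1)]]
    clinear_compose[OF assms(3) cbilinear_clinear_right[OF assms(1)]] by simp

lemma cbilinear_compose_linear:
  assumes "cbilinear \<tau>" "clinear f" shows "cbilinear (\<lambda>a b. f (\<tau> a b))"
  unfolding cbilinear_def
  using clinear_compose[OF cbilinear_clinear_left[OF assms(1)] assms(2)]
    clinear_compose[OF cbilinear_clinear_right[OF assms(1)] assms(2)] by simp

lemma tspan_base: "\<tau> a b \<in> tspan \<tau>"
  unfolding tspan_def by (rule complex_vector.span_base) blast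

lemma sum_lessThan_append:
  "(\<Sum>i<n + m. if i < n then h i else k (i - n)) = (\<Sum>i<n. h i) + (\<Sum>i<(m::nat). k i :: 'a::comm_monoid_add)"
  by (induction m) (simp_all add: add.assoc)

lemma cbilinear_append:
  assumes "cbilinear \<tau>"
  shows "(\<Sum>i<n + m. \<tau> (if i < n then a i else c *\<^sub>C a' (i - n)) (if i < n then b i else b' (i - n)))
    = (\<Sum>i<n. \<tau> (a i) (b i)) + c *\<^sub>C (\<Sum>i<(m::nat). \<tau> (a' i) (b' i))"
proof -
  have "(\<Sum>i<n + m. \<tau> (if i < n then a i else c *\<^sub>C a' (i - n)) (if i < n then b i else b' (i - n)))
      = (\<Sum>i<n + m. if i < n then \<tau> (a i) (b i) else c *\<^sub>C \<tau> (a' (i - n)) (b' (i - n)))"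
    by (rule sum.cong) (auto simp: cbilinear_scale_left[OF assms])
  also have "\<dots> = (\<Sum>i<n. \<tau> (a i) (b i)) + (\<Sum>i<m. c *\<^sub>C \<tau> (a' i) (b' i))"
    by (rule sum_lessThan_append)
  finally show ?thesis by (simp add: complex_vector.scale_sum_right)
qed

text \<open>The graph of the map that \<open>B\<close> induces on the algebraic tensor product: one
  family of factors represents both sides. For bilinear maps it is single-valued once sums vanishing
  under \<open>\<tau>\<close> vanish under \<open>B\<close>.\<close>

definition lift_rel :: "('a::cstar_algebra \<Rightarrow> 'b::cstar_algebra \<Rightarrow> 'c::cstar_algebra) \<Rightarrow>
    ('a \<Rightarrow> 'b \<Rightarrow> 'd::cstar_algebra) \<Rightarrow> 'c \<Rightarrow> 'd \<Rightarrow> bool"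
  where "lift_rel \<tau> B x v \<longleftrightarrow>
    (\<exists>(n::nat) a b. x = (\<Sum>i<n. \<tau> (a i) (b i)) \<and> v = (\<Sum>i<n. B (a i) (b i)))"

lemma lift_rel_combine:
  assumes "cbilinear \<tau>" "cbilinear B" "lift_rel \<tau> B x v" "lift_rel \<tau> B y w"
  shows "lift_rel \<tau> B (x + c *\<^sub>C y) (v + c *\<^sub>C w)"
proof -
  obtain n a b where n: "x = (\<Sum>i<(n::nat). \<tau> (a i) (b i))" "v = (\<Sum>i<n. B (a i) (b i))"
    using assms(3) unfolding lift_rel_def by blast
  obtain m a' b' where m: "y = (\<Sum>i<(m::nat). \<tau> (a' i) (b' i))" "w = (\<Sum>i<m. B (a' i) (b' i))"
    using assms(4) unfolding lift_rel_def by blast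
  show ?thesis
    unfolding lift_rel_def n m cbilinear_append[OF assms(1), symmetric] cbilinear_append[OF assms(2), symmetric]
    by (intro exI[of _ "n + m"] exI[of _ "\<lambda>i. if i < n then a i else c *\<^sub>C a' (i - n)"]
        exI[of _ "\<lambda>i. if i < n then b i else b' (i - n)"] conjI refl)
qed

lemma lift_rel_base: "lift_rel \<tau> B (\<tau> a b) (B a b)"
  unfolding lift_rel_def by (rule exI[of _ 1], rule exI[of _ "\<lambda>_. a"], rule exI[of _ "\<lambda>_. b"]) simp

lemma lift_rel_zero: "lift_rel \<tau> B 0 0"
  unfolding lift_rel_def by (rule exI[of _ 0]) simp

lemma lift_rel_total:
  assumes "cbilinear \<tau>" "cbilinear B" "x \<in> tspan \<tau>" shows "\<exists>v. lift_rel \<tau> B x v"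
  using assms(3) unfolding tspan_def
proof (induction rule: complex_vector.span_induct_alt)
  case base
  then show ?case using lift_rel_zero by blast
next
  case (step c x y)
  then obtain a b v where "x = \<tau> a b" "lift_rel \<tau> B y v" by blast
  then have "lift_rel \<tau> B (y + c *\<^sub>C x) (v + c *\<^sub>C B a b)"
    using lift_rel_combine[OF assms(1,2)] lift_rel_base by metis
  then show ?case by (metis add.commute)
qed

lemma tspan_cases:
  assumes "cbilinear \<tau>" "x \<in> tspan \<tau>"
  obtains n :: nat and a b where "x = (\<Sum>i<n. \<tau> (a i) (b i))"
  using lift_rel_total[OF assms(1) assms(1) assms(2)] that unfolding lift_rel_def by blast

lemma sum_in_tspan: "(\<Sum>i\<in>I. \<tau> (a i) (b i)) \<in> tspan \<tau>"
  by (rule tspan_sum) (rule tspan_base)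

definition lifts :: "('a::cstar_algebra \<Rightarrow> 'b::cstar_algebra \<Rightarrow> 'c::cstar_algebra) \<Rightarrow>
    ('a \<Rightarrow> 'b \<Rightarrow> 'd::cstar_algebra) \<Rightarrow> ('c \<Rightarrow> 'd) \<Rightarrow> bool"
  where "lifts \<tau> B L \<longleftrightarrow>
    (\<forall>x\<in>tspan \<tau>. \<forall>y\<in>tspan \<tau>. L (x + y) = L x + L y) \<and>
    (\<forall>c. \<forall>x\<in>tspan \<tau>. L (c *\<^sub>C x) = c *\<^sub>C L x) \<and> (\<forall>a b. L (\<tau> a b) = B a b)"

lemma lifts_add: "lifts \<tau> B L \<Longrightarrow> x \<in> tspan \<tau> \<Longrightarrow> y \<in> tspan \<tau> \<Longrightarrow> L (x + y) = L x + L y"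
  and lifts_scale: "lifts \<tau> B L \<Longrightarrow> x \<in> tspan \<tau> \<Longrightarrow> L (c *\<^sub>C x) = c *\<^sub>C L x"
  and lifts_base: "lifts \<tau> B L \<Longrightarrow> L (\<tau> a b) = B a b"
  by (simp_all add: lifts_def)

lemma lifts_sum:
  assumes L: "lifts \<tau> B L" shows "L (\<Sum>i\<in>I. \<tau> (a i) (b i)) = (\<Sum>i\<in>I. B (a i) (b i))"
proof (induction I rule: infinite_finite_induct)
  case (insert i I)
  then show ?case using lifts_add[OF L tspan_base[of \<tau> "a i" "b i"] sum_in_tspan[of \<tau> a b I]]
    by (simp add: lifts_base[OF L])
qed (use lifts_scale[OF L tspan_zero, of 0] in simp_all)

lemma cbilinear_lift:
  assumes \<tau>: "cbilinear \<tau>" and B: "cbilinear B"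
    and zero: "\<And>(n::nat) a b. (\<Sum>i<n. \<tau> (a i) (b i)) = 0 \<Longrightarrow> (\<Sum>i<n. B (a i) (b i)) = 0"
  shows "\<exists>L. lifts \<tau> B L"
proof -
  have unique: "v = w" if "lift_rel \<tau> B x v" "lift_rel \<tau> B x w" for x v w
  proof -
    have "lift_rel \<tau> B (x + (- 1) *\<^sub>C x) (v + (- 1) *\<^sub>C w)"
      by (rule lift_rel_combine[OF \<tau> B that])
    then have "v + (- 1) *\<^sub>C w = 0" unfolding lift_rel_def using zero by force
    then show ?thesis by simp
  qed
  define L where "L x = (THE v. lift_rel \<tau> B x v)" for x
  have L_eq: "L x = v" if "lift_rel \<tau> B x v" for x v
    unfolding L_def using that unique by blast
  have L_rel: "lift_rel \<tau> B x (L x)" if "x \<in> tspan \<tau>" for x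
    using lift_rel_total[OF \<tau> B that] L_eq by metis
  have comb: "L (x + c *\<^sub>C y) = L x + c *\<^sub>C L y" if "x \<in> tspan \<tau>" "y \<in> tspan \<tau>" for x y c
    by (intro L_eq lift_rel_combine[OF \<tau> B] L_rel that)
  have L0: "L 0 = 0" by (rule L_eq[OF lift_rel_zero])
  have "L (x + y) = L x + L y" if "x \<in> tspan \<tau>" "y \<in> tspan \<tau>" for x y
    using comb[OF that, of 1] by simp
  moreover have "L (c *\<^sub>C x) = c *\<^sub>C L x" if "x \<in> tspan \<tau>" for c x
    using comb[OF tspan_zero that, of c] L0 by simp
  moreover have "L (\<tau> a b) = B a b" for a b by (rule L_eq[OF lift_rel_base])
  ultimately show ?thesis unfolding lifts_def by blast
qed

lemma closed_dense_induct:
  assumes "closure D = UNIV" "closed {x. P x}" "\<And>x. x \<in> D \<Longrightarrow> P x" shows "P x"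
  using closure_minimal[of D "{x. P x}"] assms by blast

lemma dense_eq:
  fixes f g :: "'a::topological_space \<Rightarrow> 'b::t2_space"
  assumes "closure D = UNIV" "continuous_on UNIV f" "continuous_on UNIV g" "\<And>x. x \<in> D \<Longrightarrow> f x = g x"
  shows "f x = g x"
  by (rule closed_dense_induct[of D, OF assms(1) closed_Collect_eq[OF assms(2,3)] assms(4)])

lemma cbilinear_extension:
  assumes \<tau>: "cbilinear \<tau>" and B: "cbilinear B" and dense: "closure (tspan \<tau>) = UNIV"
    and bound: "\<And>(n::nat) a b. norm (\<Sum>i<n. B (a i) (b i)) \<le> K * norm (\<Sum>i<n. \<tau> (a i) (b i))"
  obtains f where "clinear f" "\<And>x. norm (f x) \<le> K * norm x" "\<And>a b. f (\<tau> a b) = B a b"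
proof -
  have zero: "(\<Sum>i<n. B (a i) (b i)) = 0" if "(\<Sum>i<n. \<tau> (a i) (b i)) = 0" for n :: nat and a b
    using bound[where n = n and a = a and b = b] that by simp
  obtain L where L: "lifts \<tau> B L" using cbilinear_lift[OF \<tau> B] zero by blast
  have LK: "norm (L x) \<le> K * norm x" if x: "x \<in> tspan \<tau>" for x
  proof -
    obtain n :: nat and a b where "x = (\<Sum>i<n. \<tau> (a i) (b i))" using tspan_cases[OF \<tau> x] by metis
    then show ?thesis using bound[where n = n and a = a and b = b] by (simp add: lifts_sum[OF L])
  qed
  have "uniformly_continuous_on (tspan \<tau>) L"
  proof (rule lipschitz_on_uniformly_continuous)
    \<comment> \<open>The sign of \<open>K\<close> is not assumed, but a Lipschitz constant must be
      nonnegative.\<close>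
    show "(max K 0)-lipschitz_on (tspan \<tau>) L"
    proof (rule lipschitz_onI)
      fix x y assume xy: "x \<in> tspan \<tau>" "y \<in> tspan \<tau>"
      have "L (x + (- 1) *\<^sub>C y) = L x + (- 1) *\<^sub>C L y"
        using xy by (simp only: lifts_add[OF L] lifts_scale[OF L] tspan_scale)
      then have "norm (L x - L y) \<le> K * norm (x - y)"
        using LK[OF tspan_diff[OF xy]] by simp
      also have "\<dots> \<le> max K 0 * norm (x - y)" by (intro mult_right_mono) auto
      finally show "dist (L x) (L y) \<le> max K 0 * dist x y" by (simp add: dist_norm)
    qed simp
  qed
  then obtain f where f: "uniformly_continuous_on (closure (tspan \<tau>)) f" "\<And>x. x \<in> tspan \<tau> \<Longrightarrow> L x = f x"
    using uniformly_continuous_on_extension_on_closure by metis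
  have cont: "continuous_on UNIV f"
    using f(1) unfolding dense by (rule uniformly_continuous_imp_continuous)
  have cf: "continuous_on UNIV (\<lambda>x. f (h x))" if "continuous_on UNIV h" for h :: "'c \<Rightarrow> 'c"
    by (rule continuous_on_compose2[OF cont that]) simp
  have add1: "f (x + y) = f x + f y" if "x \<in> tspan \<tau>" for x y
  proof (rule dense_eq[OF dense, of "\<lambda>y. f (x + y)" "\<lambda>y. f x + f y"])
    show "f (x + y) = f x + f y" if "y \<in> tspan \<tau>" for y
      using lifts_add[OF L \<open>x \<in> tspan \<tau>\<close> that] f(2) that tspan_add \<open>x \<in> tspan \<tau>\<close> by metis
  qed (intro continuous_intros cf cont)+
  have add: "f (x + y) = f x + f y" for x y
  proof (rule dense_eq[OF dense, of "\<lambda>x. f (x + y)" "\<lambda>x. f x + f y"])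
    show "f (x + y) = f x + f y" if "x \<in> tspan \<tau>" for x using add1[OF that] .
  qed (intro continuous_intros cf cont)+
  have scale: "f (c *\<^sub>C x) = c *\<^sub>C f x" for c x
  proof (rule dense_eq[OF dense, of "\<lambda>x. f (c *\<^sub>C x)" "\<lambda>x. c *\<^sub>C f x"])
    show "continuous_on UNIV (\<lambda>x. f (c *\<^sub>C x))" by (intro cf continuous_on_scaleC continuous_intros)
    show "continuous_on UNIV (\<lambda>x. c *\<^sub>C f x)" by (intro continuous_on_scaleC cont)
    show "f (c *\<^sub>C x) = c *\<^sub>C f x" if "x \<in> tspan \<tau>" for x
      using lifts_scale[OF L that, of c] f(2)[OF that] f(2)[OF tspan_scale[OF that, of c]] by simp
  qed
  show thesis
  proof (rule that[of f])
    show "clinear f" using add scale by (rule clinearI)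
    show "norm (f x) \<le> K * norm x" for x
    proof (rule closed_dense_induct[OF dense])
      show "closed {x. norm (f x) \<le> K * norm x}"
        by (intro closed_Collect_le continuous_intros cont)
    qed (use LK f(2) in auto)
    show "f (\<tau> a b) = B a b" for a b using f(2)[OF tspan_base] lifts_base[OF L] by metis
  qed
qed

context cstar_tensor
begin

lemmas dense = tens_dense[folded tspan_def]

lemma bil: "cbilinear tens"
  using tens_linear_left tens_linear_right by (simp add: cbilinear_def)

text \<open>Injectivity of the algebraic tensor product is expressed by \<open>tens_inj\<close> for linearly independent
  left factors; a general sum is first rewritten in a basis of the span of its left factors.\<close>

lemma sum_zero:
  assumes B: "cbilinear B" and zero: "(\<Sum>i<n. tens (a i) (b i)) = 0"
  shows "(\<Sum>i<(n::nat). B (a i) (b i)) = 0"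
proof -
  obtain S where S: "S \<subseteq> a ` {..<n}" "cindependent S" "a ` {..<n} \<subseteq> cspan S"
    using complex_vector.maximal_independent_subset by blast
  have fin: "finite S" using S(1) finite_surj by blast
  have "\<exists>r. \<forall>i<n. a i = (\<Sum>s\<in>S. r i s *\<^sub>C s)"
  proof (rule exI[of _ "\<lambda>i. complex_vector.representation S (a i)"], intro allI impI)
    fix i assume "i < n"
    then have "a i \<in> cspan S" using S(3) by blast
    then show "a i = (\<Sum>s\<in>S. complex_vector.representation S (a i) s *\<^sub>C s)"
      using complex_vector.sum_representation_eq[OF S(2) _ fin order_refl] by simp
  qed
  then obtain r where r: "\<And>i. i < n \<Longrightarrow> a i = (\<Sum>s\<in>S. r i s *\<^sub>C s)" by blast
  have regroup: "(\<Sum>i<n. \<sigma> (a i) (b i)) = (\<Sum>s\<in>S. \<sigma> s (\<Sum>i<n. r i s *\<^sub>C b i))" if \<sigma>: "cbilinear \<sigma>" for \<sigma> :: "'a \<Rightarrow> 'b \<Rightarrow> 'z::cstar_algebra"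
  proof -
    have "(\<Sum>i<n. \<sigma> (a i) (b i)) = (\<Sum>i<n. \<Sum>s\<in>S. r i s *\<^sub>C \<sigma> s (b i))"
    proof (rule sum.cong[OF refl])
      fix i assume "i \<in> {..<n}"
      then have "\<sigma> (a i) (b i) = \<sigma> (\<Sum>s\<in>S. r i s *\<^sub>C s) (b i)" using r by simp
      then show "\<sigma> (a i) (b i) = (\<Sum>s\<in>S. r i s *\<^sub>C \<sigma> s (b i))"
        by (simp add: cbilinear_sum_left[OF \<sigma>] cbilinear_scale_left[OF \<sigma>])
    qed
    also have "\<dots> = (\<Sum>s\<in>S. \<Sum>i<n. r i s *\<^sub>C \<sigma> s (b i))" by (rule sum.swap)
    finally show ?thesis by (simp add: cbilinear_sum_right[OF \<sigma>] cbilinear_scale_right[OF \<sigma>])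
  qed
  have "(\<Sum>i<n. r i s *\<^sub>C b i) = 0" if "s \<in> S" for s
    using tens_inj[OF fin S(2), of "\<lambda>s. \<Sum>i<n. r i s *\<^sub>C b i" s] zero that by (simp add: regroup[OF bil])
  then show ?thesis
    by (simp add: regroup[OF B] clinear_zero[OF cbilinear_clinear_right[OF B]])
qed

end

lemma spatially_boundedD:
  fixes a :: "nat \<Rightarrow> 'a::cstar_algebra" and b :: "nat \<Rightarrow> 'b::cstar_algebra"
    and H :: "('a \<Rightarrow> complex) set" and K :: "('b \<Rightarrow> complex) set"
  assumes "spatially_bounded n a b C" "representation H ipH \<pi>" "representation K ipK \<rho>"
    and "\<And>k. k < m \<Longrightarrow> \<xi> k \<in> H" "\<And>k. k < m \<Longrightarrow> \<eta> k \<in> K"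
  shows "tensor_sqnorm ipH ipK ({..<n} \<times> {..<m})
        (\<lambda>(i, k). \<pi> (a i) (\<xi> k)) (\<lambda>(i, k). \<rho> (b i) (\<eta> k))
      \<le> C\<^sup>2 * tensor_sqnorm ipH ipK {..<m::nat} \<xi> \<eta>"
  using assms(2-)
  by (intro assms(1)[unfolded spatially_bounded_def, rule_format, of H ipH \<pi> K ipK \<rho> m \<xi> \<eta>]) blast

text \<open>The minimal norm is tested on the GNS representations of \<open>\<phi>\<close> and
  \<open>\<psi>\<close> and on the single vector \<open>vec 1 \<otimes> vec 1\<close>, so
  \<open>m = 1\<close>; the squared length of its image is the double sum.\<close>

lemma (in min_tensor) product_bound:
  assumes \<phi>: "pos_functional \<phi>" and \<psi>: "pos_functional \<psi>"
  shows "Re (\<Sum>i<(n::nat). \<Sum>j<n. \<phi> (star (a i) * a j) * \<psi> (star (b i) * b j))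
    \<le> (norm (\<Sum>i<n. tens (a i) (b i)))\<^sup>2 * Re (\<phi> 1 * \<psi> 1)"
proof -
  interpret A: gns \<phi> by unfold_locales (rule \<phi>)
  interpret B: gns \<psi> by unfold_locales (rule \<psi>)
  let ?C = "norm (\<Sum>i<n. tens (a i) (b i))"
  have bd: "spatially_bounded n a b ?C" using norm_min[where C = ?C and n = n and a = a and b = b] by simp
  have "tensor_sqnorm A.Hip B.Hip ({..<n} \<times> {..<1::nat})
        (\<lambda>(i, k). A.act (a i) (A.vec 1)) (\<lambda>(i, k). B.act (b i) (B.vec 1))
      \<le> ?C\<^sup>2 * tensor_sqnorm A.Hip B.Hip {..<1::nat} (\<lambda>_. A.vec 1) (\<lambda>_. B.vec 1)"
    by (rule spatially_boundedD[OF bd A.representation B.representation, where m = 1 and \<xi> = "\<lambda>_. A.vec 1" and \<eta> = "\<lambda>_. B.vec 1"])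
      (rule A.represents_in[OF A.represents_vec], rule B.represents_in[OF B.represents_vec])
  moreover have "{..<n} \<times> {..<1} = (\<lambda>i. (i, 0::nat)) ` {..<n}" by auto
  moreover have "inj_on (\<lambda>i. (i, 0::nat)) {..<n}" by (auto simp: inj_on_def)
  ultimately show ?thesis
    by (simp add: tensor_sqnorm_def sum.reindex A.act_vec B.act_vec A.Hip_vec B.Hip_vec)
qed

subsection \<open>Slice maps\<close>

text \<open>The properties of the minimal tensor product that the proof needs. They are symmetric in the
  two factors and survive composition with a *-isomorphism.\<close>

locale slice_tensor =
  fixes \<tau> :: "'z::cstar_algebra \<Rightarrow> 'x::cstar_algebra \<Rightarrow> 'y::cstar_algebra"
  assumes bilin: "cbilinear \<tau>" and one: "\<tau> 1 1 = 1"
    and mult: "\<tau> a b * \<tau> a' b' = \<tau> (a * a') (b * b')"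
    and star: "star (\<tau> a b) = \<tau> (star a) (star b)"
    and dense: "closure (tspan \<tau>) = UNIV"
    and bound: "\<lbrakk>pos_functional \<phi>; pos_functional \<psi>\<rbrakk> \<Longrightarrow>
      Re (\<Sum>i<(n::nat). \<Sum>j<n. \<phi> (star (u i) * u j) * \<psi> (star (v i) * v j))
      \<le> (norm (\<Sum>i<n. \<tau> (u i) (v i)))\<^sup>2 * Re (\<phi> 1 * \<psi> 1)"
begin

lemma star_hom_right: "star_hom (\<tau> 1)"
  unfolding star_hom_def by (simp add: cbilinear_clinear_right[OF bilin] mult star)

text \<open>The lower estimate is the case \<open>n = 1\<close> of \<open>bound\<close>, with
  \<open>\<psi>\<close> norming \<open>star x * x\<close> and any state
  \<open>\<phi>\<close>.\<close>

lemma norm_right: "norm (\<tau> 1 x) = norm x"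
proof (rule antisym)
  show "norm (\<tau> 1 x) \<le> norm x" by (rule star_hom_contractive[OF star_hom_right one])
  obtain \<psi> where \<psi>: "state \<psi>" "\<psi> (star x * x) = of_real ((norm x)\<^sup>2)" by (rule norming_state_norm)
  obtain \<phi> :: "'z \<Rightarrow> complex" where \<phi>: "state \<phi>" using norming_state[OF positive_of_real[of 1]] by auto
  have "(norm x)\<^sup>2 \<le> (norm (\<tau> 1 x))\<^sup>2"
    using bound[of \<phi> \<psi> "\<lambda>_. 1" "\<lambda>_. x" 1] \<phi> \<psi> by (simp add: state_iff)
  then show "norm x \<le> norm (\<tau> 1 x)" by (simp add: power2_le_iff_abs_le)
qed

text \<open>Composed with a state \<open>\<psi>\<close> the slice map becomes
  \<open>\<phi> \<otimes> \<psi>\<close>, which Cauchy-Schwarz and \<open>bound\<close> control by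
  the norm; \<open>norm_le_of_states\<close> removes \<open>\<psi>\<close> at the cost of the factor
  2.\<close>

lemma slice:
  assumes \<phi>: "state \<phi>"
  obtains E where "clinear E" "\<And>y. norm (E y) \<le> 2 * norm y" "\<And>z x. E (\<tau> z x) = \<phi> z *\<^sub>C x"
proof (rule cbilinear_extension[OF bilin _ dense, of "\<lambda>z x. \<phi> z *\<^sub>C x" 2])
  have pf: "pos_functional \<phi>" and lin: "clinear \<phi>" using \<phi> by (auto simp: state_iff pos_functional_def)
  show "cbilinear (\<lambda>z x. \<phi> z *\<^sub>C (x :: 'x))"
    unfolding cbilinear_def
    by (intro conjI allI clinearI)
      (simp_all add: clinear_add[OF lin] clinear_scale[OF lin] scaleC_add_left scaleC_add_right scaleC_scaleC mult.commute)
  show "norm (\<Sum>i<n. \<phi> (a i) *\<^sub>C b i) \<le> 2 * norm (\<Sum>i<n. \<tau> (a i) (b i))" for n :: nat and a and b :: "nat \<Rightarrow> 'x"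
  proof (rule norm_le_of_states)
    fix \<psi> :: "'x \<Rightarrow> complex" assume \<psi>: "state \<psi>"
    have "\<psi> (\<Sum>i<n. \<phi> (a i) *\<^sub>C b i) = (\<Sum>i<n. \<phi> (a i) * \<psi> (b i))"
      using \<psi> by (simp add: state_def clinear_sum clinear_scale)
    moreover have "(cmod (\<Sum>i<n. \<phi> (a i) * \<psi> (b i)))\<^sup>2 \<le> (norm (\<Sum>i<n. \<tau> (a i) (b i)))\<^sup>2"
    proof -
      have 1: "\<phi> 1 = 1" "\<psi> 1 = 1" and pos: "pos_functional \<psi>" using \<phi> \<psi> by (auto simp: state_iff)
      from order_trans[OF product_functional_Cauchy_Schwarz[OF pf pos, where a = a and b = b and n = n, unfolded 1 mult_1_left mult_1_right complex.sel one_complex.sel]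
          bound[OF pf pos, where u = a and v = b and n = n, unfolded 1 mult_1_left mult_1_right complex.sel one_complex.sel]]
      show ?thesis .
    qed
    ultimately show "cmod (\<psi> (\<Sum>i<n. \<phi> (a i) *\<^sub>C b i)) \<le> norm (\<Sum>i<n. \<tau> (a i) (b i))"
      by (simp add: power2_le_iff_abs_le)
  qed
qed (rule that)

end

lemma slice_tensor_swap:
  fixes \<tau> :: "'z::cstar_algebra \<Rightarrow> 'x::cstar_algebra \<Rightarrow> 'y::cstar_algebra"
  assumes "slice_tensor \<tau>" shows "slice_tensor (\<lambda>x z. \<tau> z x)"
proof -
  interpret slice_tensor \<tau> by (rule assms)
  have "{\<tau> z x |x z. True} = {\<tau> z x |z x. True}" by blast
  then have "closure (tspan (\<lambda>x z. \<tau> z x)) = UNIV" using dense by (simp only: tspan_def)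
  then show ?thesis
  proof unfold_locales
    fix \<phi> :: "'x \<Rightarrow> complex" and \<psi> :: "'z \<Rightarrow> complex" and u :: "nat \<Rightarrow> 'x" and v :: "nat \<Rightarrow> 'z" and n :: nat assume "pos_functional \<phi>" "pos_functional \<psi>"
    then show "Re (\<Sum>i<n. \<Sum>j<n. \<phi> (star (u i) * u j) * \<psi> (star (v i) * v j))
        \<le> (norm (\<Sum>i<n. \<tau> (v i) (u i)))\<^sup>2 * Re (\<phi> 1 * \<psi> 1)"
      using bound[of \<psi> \<phi>, where u = v and v = u and n = n] by (simp only: mult.commute)
  qed (use bilin in \<open>simp_all add: cbilinear_def one mult star\<close>)
qed

text \<open>Contractivity of \<open>\<Phi>\<close> and of its inverse makes \<open>\<Phi>\<close>
  isometric, so density and the norm bound carry over from the minimal tensor product.\<close>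

lemma slice_tensor_min:
  assumes min: "min_tensor tens" and \<Phi>: "star_iso_onto \<Phi> UNIV"
  shows "slice_tensor (\<lambda>a x. \<Phi> (tens a x))"
proof -
  interpret min_tensor tens by (rule min)
  have hom: "clinear \<Phi>" "\<And>x y. \<Phi> (x * y) = \<Phi> x * \<Phi> y" "\<And>x. \<Phi> (star x) = star (\<Phi> x)" and sh: "star_hom \<Phi>"
    and bij: "bij \<Phi>"
    using \<Phi> by (auto simp: star_iso_onto_def star_hom_def)
  define \<Psi> where "\<Psi> = inv \<Phi>"
  have \<Psi>: "\<Phi> (\<Psi> y) = y" "\<Psi> (\<Phi> x) = x" for x y
    using bij by (simp_all add: \<Psi>_def bij_is_surj surj_f_inv_f bij_is_inj)
  have \<Psi>_eq: "\<Phi> x = y \<Longrightarrow> \<Psi> y = x" for x y using \<Psi> by blast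
  \<comment> \<open>\<open>star_iso_onto\<close> does not mention the unit; multiply
    \<open>\<Phi> 1\<close> by 1, written as the image of \<open>\<Psi> 1\<close>.\<close>
  have "\<Phi> 1 = 1"
  proof -
    have "\<Phi> 1 * \<Phi> (\<Psi> 1) = \<Phi> (\<Psi> 1)" by (simp flip: hom(2))
    then show ?thesis by (simp add: \<Psi>)
  qed
  have "star_hom \<Psi>"
    unfolding star_hom_def
    by (intro conjI allI clinearI \<Psi>_eq) (simp_all add: clinear_add[OF hom(1)] clinear_scale[OF hom(1)] hom \<Psi>)
  moreover have "\<Psi> 1 = 1" by (rule \<Psi>_eq) fact
  ultimately have "norm (\<Psi> (\<Phi> x)) \<le> norm (\<Phi> x)" for x by (intro star_hom_contractive)
  then have norm: "norm (\<Phi> x) = norm x" for x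
    using star_hom_contractive[OF sh \<open>\<Phi> 1 = 1\<close>, of x] by (simp add: \<Psi> antisym)
  show "slice_tensor (\<lambda>a x. \<Phi> (tens a x))"
  proof
    show "cbilinear (\<lambda>a x. \<Phi> (tens a x))" by (rule cbilinear_compose_linear[OF bil hom(1)])
    show "\<Phi> (tens 1 1) = 1" by (simp add: tens_one \<open>\<Phi> 1 = 1\<close>)
    show "\<Phi> (tens a b) * \<Phi> (tens a' b') = \<Phi> (tens (a * a') (b * b'))" for a b a' b' by (simp add: tens_mult flip: hom(2))
    show "star (\<Phi> (tens a b)) = \<Phi> (tens (star a) (star b))" for a b by (simp add: tens_star flip: hom(3))
    show "closure (tspan (\<lambda>a x. \<Phi> (tens a x))) = UNIV"
    proof -
      let ?T = "closure (tspan (\<lambda>a x. \<Phi> (tens a x)))"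
      have bl: "bounded_linear \<Phi>" using hom(1) norm by (intro clinear_bounded_linear[of _ 1]) auto
      have "\<Phi> x \<in> ?T" for x
      proof (rule closed_dense_induct[OF dense, of "\<lambda>x. \<Phi> x \<in> ?T"])
        have "closed (\<Phi> -` ?T)"
          by (intro closed_vimage closed_closure linear_continuous_on bl)
        then show "closed {x. \<Phi> x \<in> ?T}" by (simp add: vimage_def)
        fix x assume "x \<in> tspan tens"
        then obtain n :: nat and a b where "x = (\<Sum>i<n. tens (a i) (b i))" using tspan_cases[OF bil] by metis
        then have "\<Phi> x = (\<Sum>i<n. \<Phi> (tens (a i) (b i)))" by (simp add: clinear_sum[OF hom(1)])
        then have "\<Phi> x \<in> tspan (\<lambda>a x. \<Phi> (tens a x))"
          using sum_in_tspan[of "\<lambda>a x. \<Phi> (tens a x)" a b "{..<n}"] by simp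
        then show "\<Phi> x \<in> ?T" using closure_subset by blast
      qed
      then have "y \<in> ?T" for y using \<Psi>(1)[of y] by metis
      then show ?thesis by blast
    qed
    show "Re (\<Sum>i<n. \<Sum>j<n. \<phi> (star (a i) * a j) * \<psi> (star (b i) * b j))
        \<le> (norm (\<Sum>i<n. \<Phi> (tens (a i) (b i))))\<^sup>2 * Re (\<phi> 1 * \<psi> 1)"
      if "pos_functional \<phi>" "pos_functional \<psi>" for \<phi> \<psi> a b and n :: nat
      using product_bound[OF that, where a = a and b = b and n = n] norm[of "\<Sum>i<n. tens (a i) (b i)"]
      by (simp add: clinear_sum[OF hom(1)])
  qed
qed

section \<open>Maximal tensor products\<close>

context pos_functional_on
begin

text \<open>\<open>D\<close> need not be complete, so the root of the squared norm minus
  \<open>star x * x\<close> is taken in the C*-algebra \<open>'b\<close> and carried over by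
  \<open>h\<close>. The squared lengths of \<open>h s * w\<close> and \<open>h x * w\<close> then
  add up to \<open>(norm x)\<^sup>2\<close> times that of \<open>w\<close>.\<close>

lemma sn_star_hom_le:
  fixes h :: "'b::cstar_algebra \<Rightarrow> 'a"
  assumes h: "star_hom h" "h 1 = 1" "\<And>x. h x \<in> D" and w: "w \<in> D"
  shows "sn (h x * w) \<le> norm x * sn w"
proof -
  have hom: "clinear h" "\<And>x y. h (x * y) = h x * h y" "\<And>x. h (star x) = star (h x)"
    using h by (auto simp: star_hom_def)
  have "pos_elem (of_real ((norm x)\<^sup>2) - star x * x)"
    using positive_norm_minus[of "star x * x"] by (simp add: star_mult star_star cstar_identity)
  then obtain s where s: "star s = s" "of_real ((norm x)\<^sup>2) - star x * x = s * s"
    unfolding pos_elem_def by blast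
  have hs: "star (h s) = h s" by (simp add: s(1) flip: hom(3))
  have "h s * h s = of_real ((norm x)\<^sup>2) - star (h x) * h x"
  proof -
    have "h s * h s = h (of_real ((norm x)\<^sup>2) - star x * x)" by (simp only: s(2) hom(2))
    also have "\<dots> = h (of_real ((norm x)\<^sup>2)) - h (star x * x)" by (rule clinear_diff[OF hom(1)])
    also have "\<dots> = of_real ((norm x)\<^sup>2) - star (h x) * h x"
      by (simp only: clinear_of_real[OF hom(1)] h(2) hom(2,3) mult_1_right)
    finally show ?thesis .
  qed
  then have "star w * (h s * h s) * w = star w * (of_real ((norm x)\<^sup>2) - star (h x) * h x) * w"
    by (simp only:)
  also have "\<dots> = (norm x)\<^sup>2 *\<^sub>R (star w * w) - star w * (star (h x) * h x) * w"
    by (simp add: left_diff_distrib right_diff_distrib of_real_def)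
  finally have "star w * (h s * h s) * w = (norm x)\<^sup>2 *\<^sub>R (star w * w) - star w * (star (h x) * h x) * w" .
  then have eq: "star (h s * w) * (h s * w) + star (h x * w) * (h x * w) = of_real ((norm x)\<^sup>2) *\<^sub>C (star w * w)"
    by (simp add: star_mult hs mult.assoc scaleC_of_real del: of_real_power)
  have D: "h s * w \<in> D" "h x * w \<in> D" by (intro mult_D h w)+
  have "L (star (h s * w) * (h s * w)) + L (star (h x * w) * (h x * w)) = of_real ((norm x)\<^sup>2) * L (star w * w)"
    using eq D w by (simp only: L_add[symmetric] mult_D star_D L_scale)
  then have "of_real ((sn (h s * w))\<^sup>2 + (sn (h x * w))\<^sup>2) = (of_real ((norm x * sn w)\<^sup>2) :: complex)"
    using D w by (simp add: sn_square power_mult_distrib)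
  then have "(sn (h s * w))\<^sup>2 + (sn (h x * w))\<^sup>2 = (norm x * sn w)\<^sup>2" by (simp only: of_real_eq_iff)
  then have "(sn (h x * w))\<^sup>2 \<le> (norm x * sn w)\<^sup>2" using zero_le_power2[of "sn (h s * w)"] by linarith
  then show ?thesis using sn_nonneg[OF w] by (simp add: power2_le_iff_abs_le)
qed

text \<open>The operator norm in the GNS representation of \<open>L\<close>.\<close>

definition opnorm :: "'a \<Rightarrow> real" where "opnorm u = Sup {sn (u * w) |w. w \<in> D \<and> sn w \<le> 1}"

context
  assumes bounded: "\<And>u. u \<in> D \<Longrightarrow> \<exists>C. \<forall>w\<in>D. sn (u * w) \<le> C * sn w"
begin

lemma opnorm_upper:
  assumes u: "u \<in> D" and w: "w \<in> D" "sn w \<le> 1" shows "sn (u * w) \<le> opnorm u"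
  unfolding opnorm_def
proof (rule cSup_upper)
  show "sn (u * w) \<in> {sn (u * w) |w. w \<in> D \<and> sn w \<le> 1}" using w by blast
  obtain C where C: "\<And>w. w \<in> D \<Longrightarrow> sn (u * w) \<le> C * sn w" using bounded[OF u] by blast
  have "sn (u * w) \<le> \<bar>C\<bar>" if "w \<in> D" "sn w \<le> 1" for w
  proof -
    have "C * sn w \<le> \<bar>C\<bar> * 1" using that by (intro mult_mono) (auto simp: sn_nonneg)
    then show ?thesis using C[OF that(1)] by simp
  qed
  then show "bdd_above {sn (u * w) |w. w \<in> D \<and> sn w \<le> 1}" by (intro bdd_aboveI[of _ "\<bar>C\<bar>"]) blast
qed

lemma opnorm_least:
  assumes "\<And>w. w \<in> D \<Longrightarrow> sn w \<le> 1 \<Longrightarrow> sn (u * w) \<le> K" shows "opnorm u \<le> K"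
  unfolding opnorm_def
proof (rule cSup_least)
  have "sn (u * 0) \<in> {sn (u * w) |w. w \<in> D \<and> sn w \<le> 1}" using in_D(3) sn_zero by force
  then show "{sn (u * w) |w. w \<in> D \<and> sn w \<le> 1} \<noteq> {}" by blast
qed (use assms in blast)

lemma opnorm_nonneg: "u \<in> D \<Longrightarrow> 0 \<le> opnorm u"
  using opnorm_upper[of u 0] by (simp add: sn_zero in_D)

lemma opnorm_bound:
  assumes u: "u \<in> D" and w: "w \<in> D" shows "sn (u * w) \<le> opnorm u * sn w"
proof (cases "sn w = 0")
  \<comment> \<open>Normalising fails on null vectors; there the bound with some constant shows that
    \<open>u * w\<close> is a null vector too.\<close>
  case True
  obtain C where "sn (u * w) \<le> C * sn w" using bounded[OF u] w by blast
  then show ?thesis using True by simp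
next
  case False
  then have pos: "sn w > 0" using sn_nonneg[OF w] by simp
  let ?w = "complex_of_real (1 / sn w) *\<^sub>C w"
  have "sn (u * ?w) \<le> opnorm u"
    using pos w by (intro opnorm_upper u) (auto simp: in_D sn_scale norm_divide)
  moreover have "sn (u * ?w) = sn (u * w) / sn w"
    using pos sn_scale[OF mult_D[OF u w], of "complex_of_real (1 / sn w)"] by (simp add: mult_scaleC_right norm_divide)
  ultimately have "sn (u * w) / sn w \<le> opnorm u" by (simp only:)
  then show ?thesis using pos by (simp add: field_simps)
qed

text \<open>For the C*-identity, \<open>(sn (v * w))\<^sup>2\<close> is read as the inner product of
  \<open>w\<close> with \<open>star v * v * w\<close>; invariance under \<open>star\<close> then
  follows by cancellation.\<close>

lemma opnorm_cstar_seminorm: "cstar_seminorm_on D opnorm"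
  unfolding cstar_seminorm_on_def
proof (intro conjI ballI allI)
  fix u assume u: "u \<in> D"
  show "0 \<le> opnorm u" by (rule opnorm_nonneg[OF u])
  show "opnorm (u + v) \<le> opnorm u + opnorm v" if v: "v \<in> D" for v
  proof (rule opnorm_least)
    fix w assume w: "w \<in> D" "sn w \<le> 1"
    have "sn (u * w + v * w) \<le> sn (u * w) + sn (v * w)" by (intro sn_triangle mult_D u v w)
    also have "\<dots> \<le> opnorm u + opnorm v" by (intro add_mono opnorm_upper u v w)
    finally show "sn ((u + v) * w) \<le> opnorm u + opnorm v" by (simp add: distrib_right)
  qed
  have scale_le: "opnorm (c *\<^sub>C v) \<le> cmod c * opnorm v" if v: "v \<in> D" for c v
  proof (rule opnorm_least)
    fix w assume w: "w \<in> D" "sn w \<le> 1"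
    show "sn (c *\<^sub>C v * w) \<le> cmod c * opnorm v"
      using opnorm_upper[OF v w] sn_scale[OF mult_D[OF v w(1)], of c]
      by (simp add: mult_scaleC_left mult_left_mono)
  qed
  show "opnorm (c *\<^sub>C u) = cmod c * opnorm u" for c
  proof (cases "c = 0")
    case True
    then show ?thesis using scale_le[OF u, of 0] opnorm_nonneg[OF in_D(3)] by simp
  next
    case False
    have "opnorm u \<le> cmod (1 / c) * opnorm (c *\<^sub>C u)"
      using scale_le[OF in_D(2)[OF u, of c], of "1 / c"] False by simp
    then have "cmod c * opnorm u \<le> opnorm (c *\<^sub>C u)" using False by (simp add: norm_divide field_simps)
    then show ?thesis using scale_le[OF u, of c] by simp
  qed
  have mult_le: "opnorm (u * v) \<le> opnorm u * opnorm v" if u: "u \<in> D" and v: "v \<in> D" for u v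
  proof (rule opnorm_least)
    fix w assume w: "w \<in> D" "sn w \<le> 1"
    have "sn (u * (v * w)) \<le> opnorm u * sn (v * w)" by (intro opnorm_bound mult_D u v w)
    also have "\<dots> \<le> opnorm u * opnorm v" by (intro mult_left_mono opnorm_upper opnorm_nonneg u v w)
    finally show "sn (u * v * w) \<le> opnorm u * opnorm v" by (simp add: mult.assoc)
  qed
  show "opnorm (u * v) \<le> opnorm u * opnorm v" if "v \<in> D" for v by (rule mult_le[OF u that])
  have sq_le: "(opnorm v)\<^sup>2 \<le> opnorm (star v * v)" if v: "v \<in> D" for v
  proof -
    have vv: "star v * v \<in> D" by (intro mult_D star_D v)
    have "opnorm v \<le> sqrt (opnorm (star v * v))"
    proof (rule opnorm_least)
      fix w assume w: "w \<in> D" "sn w \<le> 1"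
      have "(sn (v * w))\<^sup>2 = cmod (L (star w * (star v * v * w)))"
      proof -
        have "L (star w * (star v * v * w)) = of_real ((sn (v * w))\<^sup>2)"
          using sn_square[OF mult_D[OF v w(1)]] by (simp only: star_mult mult.assoc)
        then show ?thesis by (simp only: norm_of_real abs_power2)
      qed
      also have "\<dots> \<le> sn w * sn (star v * v * w)" by (intro Cauchy_Schwarz mult_D vv w)
      also have "\<dots> \<le> 1 * opnorm (star v * v)"
        using w by (intro mult_mono opnorm_upper vv) (auto intro: sn_nonneg mult_D vv)
      finally show "sn (v * w) \<le> sqrt (opnorm (star v * v))" by (simp add: real_le_rsqrt)
    qed
    then have "(opnorm v)\<^sup>2 \<le> (sqrt (opnorm (star v * v)))\<^sup>2" by (intro power_mono opnorm_nonneg v)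
    then show ?thesis using opnorm_nonneg[OF vv] by simp
  qed
  have star_le: "opnorm v \<le> opnorm (star v)" if v: "v \<in> D" for v
  proof (cases "opnorm v = 0")
    case True
    then show ?thesis using opnorm_nonneg[OF star_D[OF v]] by simp
  next
    case False
    then have "opnorm v > 0" using opnorm_nonneg[OF v] by simp
    moreover have "opnorm v * opnorm v \<le> opnorm (star v) * opnorm v"
      using sq_le[OF v] mult_le[OF star_D[OF v] v] by (simp add: power2_eq_square)
    ultimately show ?thesis by simp
  qed
  have "opnorm (star u) = opnorm u" using star_le[OF u] star_le[OF star_D[OF u]] by (simp add: star_star)
  then show "opnorm (star u * u) = (opnorm u)\<^sup>2"
    using sq_le[OF u] mult_le[OF star_D[OF u] u] by (simp add: power2_eq_square)
qed

end

end

section \<open>The algebraic tensor product as a *-algebra\<close>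

context cstar_tensor
begin

lemma star_hom_left: "star_hom (\<lambda>a. tens a 1)"
  unfolding star_hom_def using tens_linear_left by (simp add: tens_mult tens_star)

lemma star_hom_right: "star_hom (\<lambda>b. tens 1 b)"
  unfolding star_hom_def using tens_linear_right by (simp add: tens_mult tens_star)

lemma norm_tens: "norm (tens a b) \<le> norm a * norm b"
proof -
  have "norm (tens a 1 * tens 1 b) \<le> norm (tens a 1) * norm (tens 1 b)" by (rule norm_mult_ineq)
  also have "\<dots> \<le> norm a * norm b"
    using star_hom_contractive[OF star_hom_left, of a] star_hom_contractive[OF star_hom_right, of b]
    by (intro mult_mono) (auto simp: tens_one)
  finally show ?thesis by (simp add: tens_mult)
qed

lemma bounded_bilinear: "bounded_bilinear tens"
proof
  show "\<exists>K. \<forall>a b. norm (tens a b) \<le> norm a * norm b * K" using norm_tens by (intro exI[of _ 1]) simp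
qed (simp_all add: clinear_add[OF tens_linear_left] clinear_add[OF tens_linear_right]
    scaleR_conv_scaleC clinear_scale[OF tens_linear_left] clinear_scale[OF tens_linear_right])

lemma tspan_mult:
  assumes "x \<in> tspan tens" "y \<in> tspan tens" shows "x * y \<in> tspan tens"
proof -
  obtain n :: nat and a b where x: "x = (\<Sum>i<n. tens (a i) (b i))" using tspan_cases[OF bil assms(1)] by metis
  obtain m :: nat and c d where y: "y = (\<Sum>i<m. tens (c i) (d i))" using tspan_cases[OF bil assms(2)] by metis
  show ?thesis unfolding x y sum_product tens_mult by (intro tspan_sum tspan_base)
qed

lemma tspan_star: "x \<in> tspan tens \<Longrightarrow> star x \<in> tspan tens"
proof -
  assume "x \<in> tspan tens"
  then obtain n :: nat and a b where x: "x = (\<Sum>i<n. tens (a i) (b i))" using tspan_cases[OF bil] by metis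
  show ?thesis unfolding x star_sum tens_star by (intro tspan_sum tspan_base)
qed

lemma tspan_one: "1 \<in> tspan tens"
  using tspan_base[of tens 1 1] by (simp add: tens_one)

lemma lifts_finite_sum:
  assumes L: "lifts tens B L" and h: "\<And>i. i \<in> I \<Longrightarrow> h i \<in> tspan tens"
  shows "L (sum h I) = (\<Sum>i\<in>I. L (h i))"
  using h
proof (induction I rule: infinite_finite_induct)
  case (insert i I)
  then have "sum h I \<in> tspan tens" by (intro tspan_sum) auto
  then show ?case using insert lifts_add[OF L, of "h i" "sum h I"] by simp
qed (use lifts_scale[OF L tspan_zero, of 0] in simp_all)

lemma lifts_double_sum:
  assumes L: "lifts tens B L"
  shows "L ((\<Sum>i\<in>I. tens (a i) (b i)) * (\<Sum>j\<in>J. tens (c j) (d j))) = (\<Sum>i\<in>I. \<Sum>j\<in>J. B (a i * c j) (b i * d j))"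
  unfolding sum_product tens_mult
  by (subst lifts_finite_sum[OF L sum_in_tspan]) (simp add: lifts_sum[OF L])

lemma lifts_mult:
  assumes L: "lifts tens B L" and B: "\<And>a b c d. B a b * B c d = B (a * c) (b * d)"
    and "x \<in> tspan tens" "y \<in> tspan tens"
  shows "L (x * y) = L x * L y"
proof -
  obtain n :: nat and a b where x: "x = (\<Sum>i<n. tens (a i) (b i))" using tspan_cases[OF bil assms(3)] by metis
  obtain m :: nat and c d where y: "y = (\<Sum>i<m. tens (c i) (d i))" using tspan_cases[OF bil assms(4)] by metis
  have "L (x * y) = (\<Sum>i<n. \<Sum>j<m. B (a i * c j) (b i * d j))"
    unfolding x y by (rule lifts_double_sum[OF L])
  then show ?thesis by (simp add: x y lifts_sum[OF L] sum_product B)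
qed

lemma lifts_star:
  assumes L: "lifts tens B L" and B: "\<And>a b. star (B a b) = B (star a) (star b)" and "x \<in> tspan tens"
  shows "L (star x) = star (L x)"
proof -
  obtain n :: nat and a b where x: "x = (\<Sum>i<n. tens (a i) (b i))" using tspan_cases[OF bil assms(3)] by metis
  show ?thesis unfolding x star_sum tens_star lifts_sum[OF L] B ..
qed

lemma lifts_pos_functional_on:
  assumes L: "lifts tens B L"
    and pos: "\<And>n a b. (\<Sum>i<(n::nat). \<Sum>j<n. B (star (a i) * a j) (star (b i) * b j)) \<in> \<real>\<^sub>\<ge>\<^sub>0"
  shows "pos_functional_on (tspan tens) L"
proof
  fix x assume "x \<in> tspan tens"
  then obtain n :: nat and a b where x: "x = (\<Sum>i<n. tens (a i) (b i))" using tspan_cases[OF bil] by metis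
  show "L (star x * x) \<in> \<real>\<^sub>\<ge>\<^sub>0"
    unfolding x star_sum tens_star lifts_double_sum[OF L] by (rule pos)
qed (simp_all add: csubspace_tspan tspan_one tspan_mult tspan_star lifts_add[OF L] lifts_scale[OF L])

end

text \<open>Multiplication by \<open>tens a b\<close> is bounded by \<open>norm a * norm b\<close>
  in the GNS space of \<open>L\<close>, because \<open>tens a 1\<close> and \<open>tens 1 b\<close>
  are images of elements of C*-algebras. So \<open>opnorm\<close> is a C*-seminorm, lies below the
  maximal norm, and is applied to the vector 1.\<close>

lemma (in max_tensor) pos_functional_on_le:
  assumes L: "pos_functional_on (tspan tens) L" and u: "u \<in> tspan tens"
  shows "Re (L (star u * u)) \<le> (norm u)\<^sup>2 * Re (L 1)"
proof -
  interpret pos_functional_on "tspan tens" L by (rule L)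
  have bounded: "\<exists>C. \<forall>w\<in>tspan tens. sn (v * w) \<le> C * sn w" if "v \<in> tspan tens" for v
  proof -
    obtain n :: nat and a b where v: "v = (\<Sum>i<n. tens (a i) (b i))" using tspan_cases[OF bil \<open>v \<in> tspan tens\<close>] by metis
    have "sn (v * w) \<le> (\<Sum>i<n. norm (a i) * norm (b i)) * sn w" if w: "w \<in> tspan tens" for w
    proof -
      have elem: "sn (tens (a i) (b i) * w) \<le> norm (a i) * norm (b i) * sn w" for i
      proof -
        have "sn (tens (a i) 1 * (tens 1 (b i) * w)) \<le> norm (a i) * sn (tens 1 (b i) * w)"
          by (rule sn_star_hom_le[OF star_hom_left tens_one tspan_base tspan_mult[OF tspan_base w]])
        also have "\<dots> \<le> norm (a i) * (norm (b i) * sn w)"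
          by (intro mult_left_mono sn_star_hom_le[OF star_hom_right tens_one tspan_base w]) simp
        finally show ?thesis by (simp add: tens_mult flip: mult.assoc)
      qed
      have "sn (v * w) \<le> (\<Sum>i<n. sn (tens (a i) (b i) * w))"
        unfolding v sum_distrib_right using sn_sum[of "{..<n}" "\<lambda>i. tens (a i) (b i) * w"]
        by (simp add: tspan_mult tspan_base w)
      also have "\<dots> \<le> (\<Sum>i<n. norm (a i) * norm (b i) * sn w)" by (intro sum_mono elem)
      finally show ?thesis by (simp add: sum_distrib_right)
    qed
    then show ?thesis by blast
  qed
  have "opnorm u \<le> norm u"
    using norm_max[of opnorm u] opnorm_cstar_seminorm[OF bounded] u unfolding tspan_def by blast
  then have "sn u \<le> norm u * sn 1"
    using opnorm_bound[OF bounded u tspan_one] mult_right_mono[OF _ sn_nonneg[OF tspan_one], of "opnorm u" "norm u"] by simp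
  then have "(sn u)\<^sup>2 \<le> (norm u * sn 1)\<^sup>2" by (intro power_mono sn_nonneg u)
  then show ?thesis
    using sn_square[OF u] sn_square[OF tspan_one] by (simp add: power_mult_distrib)
qed

section \<open>Embeddings of maximal tensor products\<close>

text \<open>The second arguments of \<open>\<tau>A\<close> and \<open>\<tau>B\<close> embed the
  factors of X into those of Y. For \<open>\<iota>\<close> the roles are X = G and Y = F; for
  \<open>\<alpha>\<close> they are X = Y = F with the arguments of each \<open>\<tau>\<close>
  exchanged.\<close>

locale tensor_embedding = X: max_tensor tX + Y: max_tensor tY + A: slice_tensor \<tau>A + B: slice_tensor \<tau>B
  for tX :: "'xa::cstar_algebra \<Rightarrow> 'xb::cstar_algebra \<Rightarrow> 'x::cstar_algebra"
    and tY :: "'ya::cstar_algebra \<Rightarrow> 'yb::cstar_algebra \<Rightarrow> 'y::cstar_algebra"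
    and \<tau>A :: "'za::cstar_algebra \<Rightarrow> 'xa \<Rightarrow> 'ya" and \<tau>B :: "'zb::cstar_algebra \<Rightarrow> 'xb \<Rightarrow> 'yb"
begin

lemma embed_bilinear: "cbilinear (\<lambda>x y. tY (\<tau>A 1 x) (\<tau>B 1 y))"
  by (rule cbilinear_compose[OF Y.bil cbilinear_clinear_right[OF A.bilin] cbilinear_clinear_right[OF B.bilin]])

lemma embed_mult: "tY (\<tau>A 1 a) (\<tau>B 1 b) * tY (\<tau>A 1 c) (\<tau>B 1 d) = tY (\<tau>A 1 (a * c)) (\<tau>B 1 (b * d))"
  by (simp add: Y.tens_mult A.mult B.mult)

lemma embed_star: "star (tY (\<tau>A 1 a) (\<tau>B 1 b)) = tY (\<tau>A 1 (star a)) (\<tau>B 1 (star b))"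
  by (simp add: Y.tens_star A.star B.star)

text \<open>The easy half: the norm pulled back along the map of algebraic tensor products is a
  C*-seminorm, hence at most the maximal norm.\<close>

lemma embed_norm_le: "norm (\<Sum>i<(n::nat). tY (\<tau>A 1 (a i)) (\<tau>B 1 (b i))) \<le> norm (\<Sum>i<n. tX (a i) (b i))"
proof -
  obtain L where L: "lifts tX (\<lambda>x y. tY (\<tau>A 1 x) (\<tau>B 1 y)) L"
    using cbilinear_lift[OF X.bil embed_bilinear] X.sum_zero[OF embed_bilinear] by blast
  note LX = lifts_add[OF L] lifts_scale[OF L] X.lifts_mult[OF L embed_mult] X.lifts_star[OF L embed_star]
  have "cstar_seminorm_on (tspan tX) (\<lambda>x. norm (L x))"
    unfolding cstar_seminorm_on_def
    by (simp add: LX X.tspan_star norm_triangle_ineq norm_scaleC norm_mult_ineq cstar_identity)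
  then have "norm (L (\<Sum>i<n. tX (a i) (b i))) \<le> norm (\<Sum>i<n. tX (a i) (b i))"
    using X.norm_max[of "\<lambda>x. norm (L x)"] sum_in_tspan unfolding tspan_def by blast
  then show ?thesis by (simp add: lifts_sum[OF L])
qed

section \<open>Positivity and boundedness of a sliced state\<close>

context
  fixes \<psi> :: "'x \<Rightarrow> complex" and \<phi>A :: "'za \<Rightarrow> complex" and \<phi>B :: "'zb \<Rightarrow> complex" and EA EB
  assumes \<psi>: "state \<psi>" and \<phi>A: "state \<phi>A" and \<phi>B: "state \<phi>B"
    and EA: "clinear EA" "\<And>y. norm (EA y) \<le> 2 * norm y" "\<And>z x. EA (\<tau>A z x) = \<phi>A z *\<^sub>C x"
    and EB: "clinear EB" "\<And>y. norm (EB y) \<le> 2 * norm y" "\<And>z x. EB (\<tau>B z x) = \<phi>B z *\<^sub>C x"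
begin

text \<open>The functional \<open>\<psi> \<circ> (EA \<otimes> EB)\<close> as a bilinear form:
  \<open>EA\<close> and \<open>EB\<close> are continuous, but nothing is known yet about their
  tensor product and the maximal norm.\<close>

definition slice_form :: "'ya \<Rightarrow> 'yb \<Rightarrow> complex" where "slice_form z w = \<psi> (tX (EA z) (EB w))"

lemma lin_\<psi>: "clinear \<psi>" and pf: "pos_functional \<psi>" "pos_functional \<phi>A" "pos_functional \<phi>B"
  using \<psi> \<phi>A \<phi>B by (auto simp: state_iff pos_functional_def)

lemma slice_form_bilinear: "cbilinear slice_form"
  unfolding slice_form_def[abs_def]
  by (intro cbilinear_compose_linear[OF _ lin_\<psi>] cbilinear_compose[OF X.bil EA(1) EB(1)])

lemma slice_form_tendsto:
  assumes "z \<longlonglongrightarrow> z'" "w \<longlonglongrightarrow> w'" shows "(\<lambda>k. slice_form (z k) (w k)) \<longlonglongrightarrow> slice_form z' w'"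
  unfolding slice_form_def
  by (intro bounded_linear.tendsto[OF pos_functional_bounded_linear[OF pf(1)]]
      bounded_bilinear.tendsto[OF X.bounded_bilinear]
      bounded_linear.tendsto[OF clinear_bounded_linear[OF EA(1,2)]]
      bounded_linear.tendsto[OF clinear_bounded_linear[OF EB(1,2)]] assms)

text \<open>The kernel is the pointwise product of the Gram kernels of \<open>\<phi>A\<close>,
  \<open>\<phi>B\<close> and \<open>\<psi>\<close>, so the Schur product theorem applies.\<close>

lemma slice_form_elementary:
  "(\<Sum>i<(n::nat). \<Sum>j<n. slice_form (star (\<tau>A (c i) (x i)) * \<tau>A (c j) (x j)) (star (\<tau>B (d i) (y i)) * \<tau>B (d j) (y j))) \<in> \<real>\<^sub>\<ge>\<^sub>0"
proof -
  have "slice_form (star (\<tau>A (c i) (x i)) * \<tau>A (c j) (x j)) (star (\<tau>B (d i) (y i)) * \<tau>B (d j) (y j))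
      = \<phi>A (star (c i) * c j) * (\<phi>B (star (d i) * d j) * \<psi> (star (tX (x i) (y i)) * tX (x j) (y j)))" for i j
    by (simp add: slice_form_def A.star A.mult B.star B.mult EA(3) EB(3) X.tens_star X.tens_mult
        cbilinear_scale_left[OF X.bil] cbilinear_scale_right[OF X.bil] clinear_scale[OF lin_\<psi>] mult_ac)
  then show ?thesis by (simp only:) (intro psd_sum_nonneg psd_mult psd_pos_functional pf finite_lessThan)
qed

lemma slice_form_lift: obtains M where "lifts tY slice_form M"
  using cbilinear_lift[OF Y.bil slice_form_bilinear] Y.sum_zero[OF slice_form_bilinear] by blast

text \<open>The lift \<open>M\<close> depends only on the tensor and not on how it is written. So
  \<open>\<Sum>i<n. tY (z i) (w i)\<close> may be expanded into elementary summands, which reduces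
  the claim to \<open>slice_form_elementary\<close>.\<close>

lemma slice_form_algebraic:
  assumes z: "\<And>i. z i \<in> tspan \<tau>A" and w: "\<And>i. w i \<in> tspan \<tau>B"
  shows "(\<Sum>i<(n::nat). \<Sum>j<n. slice_form (star (z i) * z j) (star (w i) * w j)) \<in> \<real>\<^sub>\<ge>\<^sub>0"
proof -
  obtain M where M: "lifts tY slice_form M" by (rule slice_form_lift)
  define S where "S = {tY (\<tau>A c x) (\<tau>B d y) |c x d y. True}"
  have S: "tY (\<tau>A c x) (\<tau>B d y) \<in> cspan S" for c x d y
    by (rule complex_vector.span_base) (auto simp: S_def)
  have form: "\<exists>(m::nat) c x d y. u = (\<Sum>i<m. tY (\<tau>A (c i) (x i)) (\<tau>B (d i) (y i)))" if "u \<in> cspan S" for u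
    using that
  proof (induction rule: complex_vector.span_induct_alt)
    case base
    show ?case by (rule exI[of _ 0]) simp
  next
    case (step k s v)
    obtain c0 x0 d0 y0 where s: "s = tY (\<tau>A c0 x0) (\<tau>B d0 y0)" using step(1) by (auto simp: S_def)
    obtain m c x d y where v: "v = (\<Sum>i<(m::nat). tY (\<tau>A (c i) (x i)) (\<tau>B (d i) (y i)))" using step(2) by blast
    have "k *\<^sub>C s + v = (\<Sum>i<Suc m. tY (\<tau>A ((c(m := k *\<^sub>C c0)) i) ((x(m := x0)) i)) (\<tau>B ((d(m := d0)) i) ((y(m := y0)) i)))"
      by (simp add: s v cbilinear_scale_left[OF A.bilin] cbilinear_scale_left[OF Y.bil] add.commute)
    then show ?case by blast
  qed
  have "tY (z i) (w i) \<in> cspan S" for i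
  proof -
    obtain n :: nat and c x where zi: "z i = (\<Sum>k<n. \<tau>A (c k) (x k))" using tspan_cases[OF A.bilin z] by metis
    obtain m :: nat and d y where wi: "w i = (\<Sum>k<m. \<tau>B (d k) (y k))" using tspan_cases[OF B.bilin w] by metis
    show ?thesis
      unfolding zi wi cbilinear_sum_left[OF Y.bil] cbilinear_sum_right[OF Y.bil]
      by (intro complex_vector.span_sum S)
  qed
  then have "(\<Sum>i<n. tY (z i) (w i)) \<in> cspan S" by (intro complex_vector.span_sum)
  then obtain m :: nat and c x d y where eq: "(\<Sum>i<n. tY (z i) (w i)) = (\<Sum>i<m. tY (\<tau>A (c i) (x i)) (\<tau>B (d i) (y i)))"
    using form by blast
  have gram: "M (star (\<Sum>i<k. tY (z i) (w i)) * (\<Sum>i<k. tY (z i) (w i)))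
      = (\<Sum>i<k. \<Sum>j<k. slice_form (star (z i) * z j) (star (w i) * w j))" for k :: nat and z w
    unfolding star_sum Y.tens_star by (rule Y.lifts_double_sum[OF M])
  \<comment> \<open>\<open>gram\<close> is used backwards for the given expansion and forwards for
    the elementary one.\<close>
  show ?thesis unfolding gram[symmetric] eq unfolding gram by (rule slice_form_elementary)
qed

text \<open>Density of the algebraic tensor products, joint continuity of \<open>slice_form\<close>
  and closedness of the nonnegative reals. The norm bounds on \<open>EA\<close> and
  \<open>EB\<close> enter through the continuity.\<close>

lemma slice_form_nonneg:
  "(\<Sum>i<(n::nat). \<Sum>j<n. slice_form (star (z i) * z j) (star (w i) * w j)) \<in> \<real>\<^sub>\<ge>\<^sub>0"
proof -
  have "\<forall>i. \<exists>Z. (\<forall>k. Z k \<in> tspan \<tau>A) \<and> Z \<longlonglongrightarrow> z i" using A.dense by (simp flip: closure_sequential)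
  then obtain Z where Z: "\<And>i k. Z i k \<in> tspan \<tau>A" "\<And>i. Z i \<longlonglongrightarrow> z i" by metis
  have "\<forall>i. \<exists>W. (\<forall>k. W k \<in> tspan \<tau>B) \<and> W \<longlonglongrightarrow> w i" using B.dense by (simp flip: closure_sequential)
  then obtain W where W: "\<And>i k. W i k \<in> tspan \<tau>B" "\<And>i. W i \<longlonglongrightarrow> w i" by metis
  have lim: "(\<lambda>k. \<Sum>i<n. \<Sum>j<n. slice_form (star (Z i k) * Z j k) (star (W i k) * W j k))
      \<longlonglongrightarrow> (\<Sum>i<n. \<Sum>j<n. slice_form (star (z i) * z j) (star (w i) * w j))"
    by (intro tendsto_sum slice_form_tendsto tendsto_mult tendsto_star Z W)
  have "(\<Sum>i<n. \<Sum>j<n. slice_form (star (Z i k) * Z j k) (star (W i k) * W j k)) \<in> \<real>\<^sub>\<ge>\<^sub>0" for k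
    by (rule slice_form_algebraic[OF Z(1) W(1)])
  then show ?thesis by (rule closed_sequentially[OF closed_nonneg_Reals_complex _ lim])
qed

text \<open>Slicing \<open>\<tau>A 1 x\<close> gives back \<open>x\<close>, so the lift of
  \<open>slice_form\<close> extends \<open>\<psi>\<close> along \<open>J\<close>. Being positive and
  1 at the unit, it is controlled by the maximal norm of Y through
  \<open>pos_functional_on_le\<close>.\<close>

lemma state_le_embed_norm:
  assumes J: "lifts tX (\<lambda>x y. tY (\<tau>A 1 x) (\<tau>B 1 y)) J" and u: "u \<in> tspan tX"
  shows "Re (\<psi> (star u * u)) \<le> (norm (J u))\<^sup>2"
proof -
  obtain M where M: "lifts tY slice_form M" by (rule slice_form_lift)
  have posM: "pos_functional_on (tspan tY) M"
    by (rule Y.lifts_pos_functional_on[OF M slice_form_nonneg])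
  have one: "\<phi>A 1 = 1" "\<phi>B 1 = 1" "\<psi> 1 = 1" using \<psi> \<phi>A \<phi>B by (auto simp: state_def)
  have Jv: "J v \<in> tspan tY" "M (J v) = \<psi> v" if v: "v \<in> tspan tX" for v
  proof -
    obtain n :: nat and a b where v: "v = (\<Sum>i<n. tX (a i) (b i))" using tspan_cases[OF X.bil v] by metis
    have J_v: "J v = (\<Sum>i<n. tY (\<tau>A 1 (a i)) (\<tau>B 1 (b i)))" unfolding v by (rule lifts_sum[OF J])
    show "J v \<in> tspan tY" unfolding J_v by (intro tspan_sum tspan_base)
    have "M (J v) = (\<Sum>i<n. slice_form (\<tau>A 1 (a i)) (\<tau>B 1 (b i)))" unfolding J_v
      by (subst Y.lifts_finite_sum[OF M tspan_base]) (simp add: lifts_base[OF M])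
    then show "M (J v) = \<psi> v" by (simp add: v slice_form_def EA(3) EB(3) one clinear_sum[OF lin_\<psi>])
  qed
  have "J (star u * u) = star (J u) * J u"
    using X.lifts_mult[OF J embed_mult X.tspan_star[OF u] u] X.lifts_star[OF J embed_star u] by simp
  then have "\<psi> (star u * u) = M (star (J u) * J u)"
    using Jv(2)[OF X.tspan_mult[OF X.tspan_star[OF u] u]] by simp
  moreover have "M 1 = 1"
    using Jv(2)[OF X.tspan_one] lifts_base[OF J, of 1 1] by (simp add: X.tens_one Y.tens_one A.one B.one one)
  ultimately show ?thesis
    using Y.pos_functional_on_le[OF posM Jv(1)[OF u]] by simp
qed

end

lemma embedding:
  obtains J where "star_hom J" "J 1 = 1" "\<And>x. norm (J x) = norm x"
    "\<And>x y. J (tX x y) = tY (\<tau>A 1 x) (\<tau>B 1 y)"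
proof -
  let ?B = "\<lambda>x y. tY (\<tau>A 1 x) (\<tau>B 1 y)"
  obtain J where J: "clinear J" "\<And>x. norm (J x) \<le> 1 * norm x" "\<And>a b. J (tX a b) = ?B a b"
    using cbilinear_extension[OF X.bil embed_bilinear X.dense, of 1] embed_norm_le by auto
  have lJ: "lifts tX ?B J"
    unfolding lifts_def by (simp add: clinear_add[OF J(1)] clinear_scale[OF J(1)] J(3))
  have cont: "continuous_on UNIV J" by (intro linear_continuous_on clinear_bounded_linear[OF J(1,2)])
  have cJ: "continuous_on UNIV (\<lambda>x. J (h x))" if "continuous_on UNIV h" for h :: "'x \<Rightarrow> 'x"
    by (rule continuous_on_compose2[OF cont that]) simp
  have mult1: "J (x * y) = J x * J y" if x: "x \<in> tspan tX" for x y
    by (rule dense_eq[OF X.dense, of "\<lambda>y. J (x * y)" "\<lambda>y. J x * J y"])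
      (intro continuous_intros cJ cont, intro continuous_intros cJ cont, rule X.lifts_mult[OF lJ embed_mult x])
  have mult: "J (x * y) = J x * J y" for x y
    by (rule dense_eq[OF X.dense, of "\<lambda>x. J (x * y)" "\<lambda>x. J x * J y"])
      (intro continuous_intros cJ cont, intro continuous_intros cJ cont, rule mult1)
  have star: "J (star x) = star (J x)" for x
    by (rule dense_eq[OF X.dense, of "\<lambda>x. J (star x)" "\<lambda>x. star (J x)"])
      (intro continuous_intros cJ cont continuous_on_star, intro continuous_on_star cont, rule X.lifts_star[OF lJ embed_star])
  have ge: "norm u \<le> norm (J u)" if u: "u \<in> tspan tX" for u
  proof -
    obtain \<psi> where \<psi>: "state \<psi>" "\<psi> (star u * u) = of_real ((norm u)\<^sup>2)" by (rule norming_state_norm)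
    \<comment> \<open>Any states of the complementary factors will do; only \<open>\<psi>\<close>
      depends on \<open>u\<close>.\<close>
    obtain \<phi>A :: "'za \<Rightarrow> complex" where \<phi>A: "state \<phi>A" using norming_state[OF positive_of_real[of 1]] by auto
    obtain \<phi>B :: "'zb \<Rightarrow> complex" where \<phi>B: "state \<phi>B" using norming_state[OF positive_of_real[of 1]] by auto
    obtain EA where EA: "clinear EA" "\<And>y. norm (EA y) \<le> 2 * norm y" "\<And>z x. EA (\<tau>A z x) = \<phi>A z *\<^sub>C x"
      using A.slice[OF \<phi>A] by blast
    obtain EB where EB: "clinear EB" "\<And>y. norm (EB y) \<le> 2 * norm y" "\<And>z x. EB (\<tau>B z x) = \<phi>B z *\<^sub>C x"
      using B.slice[OF \<phi>B] by blast
    have "(norm u)\<^sup>2 \<le> (norm (J u))\<^sup>2"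
      using state_le_embed_norm[OF \<psi>(1) \<phi>A \<phi>B EA EB lJ u] \<psi>(2) by simp
    then show ?thesis by (simp add: power2_le_iff_abs_le)
  qed
  have "norm x \<le> norm (J x)" for x
    by (rule closed_dense_induct[OF X.dense, of "\<lambda>x. norm x \<le> norm (J x)"])
      (intro closed_Collect_le continuous_intros cont, rule ge)
  then have "norm (J x) = norm x" for x using J(2)[of x] by (simp add: antisym)
  moreover have "J 1 = 1" using J(3)[of 1 1] by (simp add: X.tens_one Y.tens_one A.one B.one)
  ultimately show thesis using that[of J] J mult star by (simp add: star_hom_def)
qed

end

section \<open>Infinitely many copies\<close>

lemma (in cstar_tensor) eq_on_tensors:
  assumes "clinear h" "clinear k" "\<And>x. norm (h x) \<le> K * norm x" "\<And>x. norm (k x) \<le> M * norm x"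
    and "\<And>a b. h (tens a b) = k (tens a b)"
  shows "h x = k x"
proof (rule dense_eq[OF dense])
  show "continuous_on UNIV h" "continuous_on UNIV k"
    by (intro linear_continuous_on clinear_bounded_linear[OF assms(1,3)] clinear_bounded_linear[OF assms(2,4)])+
  fix x assume "x \<in> tspan tens"
  then obtain n :: nat and a b where "x = (\<Sum>i<n. tens (a i) (b i))" using tspan_cases[OF bil] by metis
  then show "h x = k x" by (simp add: clinear_sum[OF assms(1)] clinear_sum[OF assms(2)] assms(5))
qed

section \<open>Isometric *-homomorphisms and their ranges\<close>

definition isometric_star_hom :: "('a::cstar_algebra \<Rightarrow> 'b::cstar_algebra) \<Rightarrow> bool"
  where "isometric_star_hom h \<longleftrightarrow> star_hom h \<and> h 1 = 1 \<and> (\<forall>x. norm (h x) = norm x)"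

lemma isometric_star_hom_compose:
  "isometric_star_hom h \<Longrightarrow> isometric_star_hom k \<Longrightarrow> isometric_star_hom (\<lambda>x. k (h x))"
  by (auto simp: isometric_star_hom_def star_hom_def intro: clinear_compose)

lemma isometric_star_hom_funpow:
  fixes h :: "'a::cstar_algebra \<Rightarrow> 'a"
  assumes "isometric_star_hom h" shows "isometric_star_hom (h ^^ n)"
proof (induction n)
  case 0
  show ?case by (simp add: isometric_star_hom_def star_hom_def id_def clinearI)
next
  case (Suc n)
  then show ?case using isometric_star_hom_compose[OF Suc assms] by (simp add: o_def)
qed

text \<open>Isometry makes the range complete, hence closed, so \<open>range h\<close> is already
  the C*-algebra that it generates.\<close>

lemma isometric_star_hom_onto:
  fixes h :: "'a::cstar_algebra \<Rightarrow> 'b::cstar_algebra"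
  assumes "isometric_star_hom h"
  shows "star_iso_onto h (cstar_generated (range h))"
proof -
  have hom: "clinear h" "\<And>x y. h (x * y) = h x * h y" "\<And>x. h (star x) = star (h x)" "h 1 = 1"
    and norm: "\<And>x. norm (h x) = norm x" and sh: "star_hom h"
    using assms by (auto simp: isometric_star_hom_def star_hom_def)
  have "inj h"
  proof (rule injI)
    fix x y assume "h x = h y"
    then have "norm (h (x - y)) = 0" by (simp add: clinear_diff[OF hom(1)])
    then show "x = y" by (simp add: norm)
  qed
  have "complete (range h)"
    by (rule complete_isometric_image[of 1])
      (auto simp: norm complete_UNIV intro!: clinear_bounded_linear[OF hom(1), of 1])
  then have "closed (range h)" by (rule complete_imp_closed)
  then have "unital_cstar_subalgebra (range h)"
    unfolding unital_cstar_subalgebra_def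
  proof (intro conjI ballI)
    show "csubspace (range h)"
    proof (rule complex_vector.subspaceI)
      show "0 \<in> range h" using clinear_zero[OF hom(1)] by (metis rangeI)
    qed (auto simp flip: clinear_add[OF hom(1)] clinear_scale[OF hom(1)])
    show "1 \<in> range h" using hom(4) by (metis rangeI)
  qed (auto simp flip: hom(2,3))
  then have "cstar_generated (range h) = range h" unfolding cstar_generated_def by (rule hull_same)
  then show ?thesis using sh \<open>inj h\<close> by (simp add: star_iso_onto_def bij_betw_def)
qed

lemma slice_tensor_isometric: "slice_tensor \<tau> \<Longrightarrow> isometric_star_hom (\<tau> 1)"
  by (simp add: isometric_star_hom_def slice_tensor.star_hom_right slice_tensor.norm_right slice_tensor.one)

text \<open>All that the induction over copies needs from the tensor products: a shift
  \<open>\<alpha>\<close> and a first copy \<open>\<iota>\<close> that commutes with the shifted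
  algebra and is independent of it under \<open>f\<close>.\<close>

locale shift_copies =
  fixes f :: "'f::cstar_algebra \<Rightarrow> complex" and g :: "'g::cstar_algebra \<Rightarrow> complex"
    and \<alpha> :: "'f \<Rightarrow> 'f" and \<iota> :: "'g \<Rightarrow> 'f"
  assumes \<alpha>: "isometric_star_hom \<alpha>" and \<iota>: "isometric_star_hom \<iota>"
    and g1: "g 1 = 1" and f1: "f 1 = 1"
    and comm: "\<iota> P * \<alpha> Y = \<alpha> Y * \<iota> P"
    and split: "f (\<iota> P * \<alpha> Y) = g P * f Y"
begin

lemma unit: "\<alpha> 1 = 1" "\<iota> 1 = 1" and mult: "\<alpha> (x * y) = \<alpha> x * \<alpha> y"
  using \<alpha> \<iota> by (auto simp: isometric_star_hom_def star_hom_def)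

lemma f_shift: "f (\<alpha> Y) = f Y"
  using split[of 1 Y] by (simp add: unit g1)

lemma f_shift_pow: "f ((\<alpha> ^^ n) Y) = f Y"
  by (induction n) (simp_all add: f_shift)

lemma pow_mult: "(\<alpha> ^^ n) (x * y) = (\<alpha> ^^ n) x * (\<alpha> ^^ n) y"
  by (induction n) (simp_all add: mult)

lemma pow_one: "(\<alpha> ^^ n) 1 = 1"
  by (induction n) (simp_all add: unit)

text \<open>After removing \<open>\<alpha> ^^ i\<close> from both factors at least one
  \<open>\<alpha>\<close> is left in front of the later copy, so \<open>comm\<close>
  applies.\<close>

lemma copies_commute:
  assumes "i < j"
  shows "(\<alpha> ^^ i) (\<iota> P) * (\<alpha> ^^ j) (\<iota> Q) = (\<alpha> ^^ j) (\<iota> Q) * (\<alpha> ^^ i) (\<iota> P)"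
proof -
  obtain k where "j = i + Suc k" using assms less_imp_Suc_add by auto
  then have "(\<alpha> ^^ j) (\<iota> Q) = (\<alpha> ^^ i) (\<alpha> ((\<alpha> ^^ k) (\<iota> Q)))" by (simp add: funpow_add funpow_swap1)
  then show ?thesis by (simp add: comm flip: pow_mult)
qed

text \<open>Factors of index at least \<open>k\<close> all lie in the range of
  \<open>\<alpha> ^^ k\<close>, which is closed under products.\<close>

lemma prod_shift:
  assumes "\<And>i. i \<in> set l \<Longrightarrow> k \<le> i"
  shows "\<exists>Y. prod_list (map (\<lambda>i. (\<alpha> ^^ i) (\<iota> (a i))) l) = (\<alpha> ^^ k) Y"
  using assms
proof (induction l)
  case Nil
  show ?case by (simp, rule exI[of _ 1]) (simp add: pow_one)
next
  case (Cons i l)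
  then obtain Y where Y: "prod_list (map (\<lambda>i. (\<alpha> ^^ i) (\<iota> (a i))) l) = (\<alpha> ^^ k) Y" by auto
  have "i = k + (i - k)" using Cons.prems[of i] by simp
  then have "(\<alpha> ^^ i) (\<iota> (a i)) = (\<alpha> ^^ k) ((\<alpha> ^^ (i - k)) (\<iota> (a i)))" by (metis funpow_add o_apply)
  then show ?case using Y by (auto simp flip: pow_mult)
qed

lemma f_prod:
  "sorted_wrt (<) l \<Longrightarrow> f (prod_list (map (\<lambda>i. (\<alpha> ^^ i) (\<iota> (a i))) l)) = prod_list (map (\<lambda>i. g (a i)) l)"
proof (induction l)
  case Nil
  then show ?case by (simp add: f1)
next
  case (Cons i l)
  \<comment> \<open>Strict sorting gives the bound \<open>Suc i\<close>: after pulling out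
    \<open>\<alpha> ^^ i\<close> one \<open>\<alpha>\<close> remains, as \<open>split\<close>
    demands.\<close>
  obtain Y where Y: "prod_list (map (\<lambda>i. (\<alpha> ^^ i) (\<iota> (a i))) l) = (\<alpha> ^^ Suc i) Y"
    using prod_shift[of l "Suc i" a] Cons.prems by (auto simp: Suc_le_eq simp del: funpow.simps)
  have "f (prod_list (map (\<lambda>i. (\<alpha> ^^ i) (\<iota> (a i))) (i # l))) = f ((\<alpha> ^^ i) (\<iota> (a i) * \<alpha> Y))"
    by (simp add: Y pow_mult funpow_swap1)
  also have "\<dots> = g (a i) * f ((\<alpha> ^^ Suc i) Y)" by (simp only: f_shift_pow split)
  finally show ?case using Cons by (simp add: Y)
qed

lemma infinite_copies:
  "infinite_copies f g (\<lambda>n. range (\<lambda>P. (\<alpha> ^^ n) (\<iota> P))) (\<lambda>n P. (\<alpha> ^^ n) (\<iota> P))"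
  unfolding infinite_copies_def
proof (intro conjI allI impI ballI)
  show "star_iso_onto (\<lambda>P. (\<alpha> ^^ i) (\<iota> P)) (cstar_generated (range (\<lambda>P. (\<alpha> ^^ i) (\<iota> P))))" for i
    by (intro isometric_star_hom_onto isometric_star_hom_compose[OF \<iota>] isometric_star_hom_funpow \<alpha>)
  show "f ((\<alpha> ^^ i) (\<iota> P)) = g P" for i P
    using split[of P 1] by (simp add: f_shift_pow unit f1)
  show "x * y = y * x" if "i \<noteq> j" "x \<in> range (\<lambda>P. (\<alpha> ^^ i) (\<iota> P))" "y \<in> range (\<lambda>P. (\<alpha> ^^ j) (\<iota> P))" for i j x y
    using that copies_commute[of i j] copies_commute[of j i] by (auto simp: neq_iff)
  show "f (prod_list (map (\<lambda>i. (\<alpha> ^^ i) (\<iota> (a i))) (sorted_list_of_set N))) = (\<Prod>i\<in>N. g (a i))"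
    if "finite N" for N a
    using f_prod[of "sorted_list_of_set N" a] that
      prod.distinct_set_conv_list[of "sorted_list_of_set N" "\<lambda>i. g (a i)"]
    by simp
qed

end

theorem theorem1:
  fixes tens_FGA :: "'fa::cstar_algebra \<Rightarrow> 'ga::cstar_algebra \<Rightarrow> 'fga::cstar_algebra"
    and tens_FGB :: "'fb::cstar_algebra \<Rightarrow> 'gb::cstar_algebra \<Rightarrow> 'fgb::cstar_algebra"
    and tens_F :: "'fa \<Rightarrow> 'fb \<Rightarrow> 'f::cstar_algebra"
    and tens_G :: "'ga \<Rightarrow> 'gb \<Rightarrow> 'g::cstar_algebra"
    and \<Phi>A :: "'fga \<Rightarrow> 'fa" and \<Phi>B :: "'fgb \<Rightarrow> 'fb"
    and f :: "'f \<Rightarrow> complex" and g :: "'g \<Rightarrow> complex"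
  assumes "min_tensor tens_FGA" and "min_tensor tens_FGB"
    and "max_tensor tens_F" and "max_tensor tens_G"
    and "star_iso_onto \<Phi>A UNIV" and "star_iso_onto \<Phi>B UNIV"
    and "state f" and "state g" and "entangled tens_G g"
    and "\<And>a b x y. f (tens_F (\<Phi>A (tens_FGA a x)) (\<Phi>B (tens_FGB b y)))
                      = f (tens_F a b) * g (tens_G x y)"
  shows "locally_contains_infinitely_many_copies tens_F tens_G f g"
proof -
  define \<tau>A where "\<tau>A = (\<lambda>a x. \<Phi>A (tens_FGA a x))"
  define \<tau>B where "\<tau>B = (\<lambda>b y. \<Phi>B (tens_FGB b y))"
  have \<tau>: "slice_tensor \<tau>A" "slice_tensor \<tau>B"
    unfolding \<tau>A_def \<tau>B_def by (intro slice_tensor_min assms)+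
  note \<tau>' = slice_tensor_swap[OF \<tau>(1)] slice_tensor_swap[OF \<tau>(2)]
  interpret F: max_tensor tens_F by fact
  interpret G: max_tensor tens_G by fact
  interpret A: slice_tensor \<tau>A by (rule \<tau>)
  interpret B: slice_tensor \<tau>B by (rule \<tau>)
  interpret I: tensor_embedding tens_G tens_F \<tau>A \<tau>B ..
  obtain \<iota> where \<iota>: "star_hom \<iota>" "\<iota> 1 = 1" "\<And>x. norm (\<iota> x) = norm x"
    "\<And>x y. \<iota> (tens_G x y) = tens_F (\<tau>A 1 x) (\<tau>B 1 y)"
    by (rule I.embedding) blast
  \<comment> \<open>Exchanged arguments: here F is the embedded algebra and the unit is put in the
    place of G.\<close>
  interpret S: tensor_embedding tens_F tens_F "\<lambda>x a. \<tau>A a x" "\<lambda>y b. \<tau>B b y"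
    by (intro tensor_embedding.intro \<tau>' assms)
  obtain \<alpha> where \<alpha>: "star_hom \<alpha>" "\<alpha> 1 = 1" "\<And>x. norm (\<alpha> x) = norm x"
    "\<And>a b. \<alpha> (tens_F a b) = tens_F (\<tau>A a 1) (\<tau>B b 1)"
    by (rule S.embedding) blast
  have lin: "clinear \<iota>" "clinear \<alpha>" "clinear f" "clinear g"
    using \<iota>(1) \<alpha>(1) assms(7,8) by (auto simp: star_hom_def state_def)
  have bound: "cmod (f x) \<le> norm x" "cmod (g y) \<le> norm y" for x y
    using pos_functional_bound[of f x] pos_functional_bound[of g y] assms(7,8) by (simp_all add: state_iff)
  have mult_lin: "clinear (\<lambda>P. \<iota> P * z)" "clinear (\<lambda>Y. z * \<alpha> Y)" "clinear (\<lambda>P. z * \<iota> P)" "clinear (\<lambda>Y. \<alpha> Y * z)" for z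
    by (auto intro!: clinearI simp: clinear_add[OF lin(1)] clinear_scale[OF lin(1)] clinear_add[OF lin(2)]
        clinear_scale[OF lin(2)] distrib_left distrib_right mult_scaleC_left mult_scaleC_right)
  have mult_bound: "norm (\<iota> P * z) \<le> norm z * norm P" "norm (z * \<iota> P) \<le> norm z * norm P"
      "norm (\<alpha> Y * z) \<le> norm z * norm Y" "norm (z * \<alpha> Y) \<le> norm z * norm Y" for P Y z
    using norm_mult_ineq[of "\<iota> P" z] norm_mult_ineq[of z "\<iota> P"] norm_mult_ineq[of "\<alpha> Y" z] norm_mult_ineq[of z "\<alpha> Y"]
    by (simp_all add: \<iota>(3) \<alpha>(3) mult.commute)
  \<comment> \<open>On elementary tensors this is the commutation of \<open>1 \<otimes> x\<close>
    with \<open>a \<otimes> 1\<close> on each side; density is used once in \<open>P\<close> and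
    once in \<open>Y\<close>.\<close>
  have comm: "\<iota> P * \<alpha> Y = \<alpha> Y * \<iota> P" for P Y
  proof (rule G.eq_on_tensors[OF mult_lin(1,3) mult_bound(1,2)])
    fix x y
    show "\<iota> (tens_G x y) * \<alpha> Y = \<alpha> Y * \<iota> (tens_G x y)"
      by (rule F.eq_on_tensors[OF mult_lin(2,4) mult_bound(4,3)])
        (simp add: \<iota>(4) \<alpha>(4) F.tens_mult A.mult B.mult)
  qed
  have split: "f (\<iota> P * \<alpha> Y) = g P * f Y" for P Y
  proof (rule G.eq_on_tensors[where h = "\<lambda>P. f (\<iota> P * \<alpha> Y)" and k = "\<lambda>P. g P * f Y"])
    show "clinear (\<lambda>P. f (\<iota> P * \<alpha> Y))" by (rule clinear_compose[OF mult_lin(1) lin(3)])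
    show "clinear (\<lambda>P. g P * f Y)" by (auto intro!: clinearI simp: clinear_add[OF lin(4)] clinear_scale[OF lin(4)] distrib_right)
    show "norm (f (\<iota> P * \<alpha> Y)) \<le> norm (\<alpha> Y) * norm P" for P using bound(1) mult_bound(1) order_trans by blast
    show "norm (g P * f Y) \<le> cmod (f Y) * norm P" for P
      using mult_left_mono[OF bound(2)[of P], of "cmod (f Y)"] by (simp add: norm_mult mult.commute)
    fix x y
    show "f (\<iota> (tens_G x y) * \<alpha> Y) = g (tens_G x y) * f Y"
    proof (rule F.eq_on_tensors[where h = "\<lambda>Y. f (\<iota> (tens_G x y) * \<alpha> Y)" and k = "\<lambda>Y. g (tens_G x y) * f Y"])
      show "clinear (\<lambda>Y. f (\<iota> (tens_G x y) * \<alpha> Y))" by (rule clinear_compose[OF mult_lin(2) lin(3)])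
      show "clinear (\<lambda>Y. g (tens_G x y) * f Y)" by (auto intro!: clinearI simp: clinear_add[OF lin(3)] clinear_scale[OF lin(3)] distrib_left)
      show "norm (f (\<iota> (tens_G x y) * \<alpha> Y)) \<le> norm (\<iota> (tens_G x y)) * norm Y" for Y
        using bound(1) mult_bound(4) order_trans by blast
      show "norm (g (tens_G x y) * f Y) \<le> cmod (g (tens_G x y)) * norm Y" for Y
        using mult_left_mono[OF bound(1)[of Y], of "cmod (g (tens_G x y))"] by (simp add: norm_mult)
      \<comment> \<open>On each side \<open>1 \<otimes> x\<close> and \<open>a \<otimes> 1\<close>
        multiply to \<open>a \<otimes> x\<close>, so the hypothesis on \<open>f\<close> applies
        literally.\<close>
      show "f (\<iota> (tens_G x y) * \<alpha> (tens_F a b)) = g (tens_G x y) * f (tens_F a b)" for a b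
        using assms(10)[of a x b y] by (simp add: \<iota>(4) \<alpha>(4) F.tens_mult A.mult B.mult) (simp add: \<tau>A_def \<tau>B_def)
    qed
  qed
  interpret C: shift_copies f g \<alpha> \<iota>
    by unfold_locales (use \<alpha> \<iota> assms(7,8) comm split in \<open>simp_all add: isometric_star_hom_def state_def\<close>)
  \<comment> \<open>The local factors of copy \<open>n\<close>: each party iterates its own shift
    after its own first copy.\<close>
  have iso: "isometric_star_hom (\<lambda>x. ((\<lambda>a. \<tau>A a 1) ^^ n) (\<tau>A 1 x))" "isometric_star_hom (\<lambda>y. ((\<lambda>b. \<tau>B b 1) ^^ n) (\<tau>B 1 y))" for n
    by (rule isometric_star_hom_compose[OF slice_tensor_isometric[OF \<tau>(1)]
          isometric_star_hom_funpow[OF slice_tensor_isometric[OF \<tau>'(1)]]],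
        rule isometric_star_hom_compose[OF slice_tensor_isometric[OF \<tau>(2)]
          isometric_star_hom_funpow[OF slice_tensor_isometric[OF \<tau>'(2)]]])
  have factor: "(\<alpha> ^^ n) (\<iota> (tens_G x y)) = tens_F (((\<lambda>a. \<tau>A a 1) ^^ n) (\<tau>A 1 x)) (((\<lambda>b. \<tau>B b 1) ^^ n) (\<tau>B 1 y))" for n x y
    by (induction n) (simp_all add: \<iota>(4) \<alpha>(4))
  show ?thesis
    unfolding locally_contains_infinitely_many_copies_def
    using C.infinite_copies isometric_star_hom_onto[OF iso(1)] isometric_star_hom_onto[OF iso(2)] factor by blast
qed

end
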